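(* Let $V$ be a fixed linear homeomorphism from $\mathbb{L}^2_{t}(\partial\Omega)$ onto $\mathbb{H}^{-1/2}(\mathrm{curl}_{\partial\Omega})$, and let $V^\#:\mathbb{H}^{-1/2}(\mathrm{div}_{\partial\Omega})\to \mathbb{L}^2_{t}(\partial\Omega)$ be its $\mathbb{L}^2_t$-pairing-adjoint, i.e. the operator determined by $\langle Vf\,|\,g\rangle = (f\,|\,V^\# g)_{\mathbb{L}^2_t}$ for all $f\in \mathbb{L}^2_t(\partial\Omega)$, $g\in \mathbb{H}^{-1/2}(\mathrm{div}_{\partial\Omega})$. For an operator $\widehat{\mathcal{M}}$ in $\mathbb{L}^2_{\varepsilon,\mu}(\Omega)$ which is an extension of $\mathcal{M}$, the following two statements are equivalent: (i) $\widehat{\mathcal{M}}$ is m-dissipative in $\mathbb{L}^2_{\varepsilon,\mu}(\Omega)$; (ii) there exists a contraction $K$ on $\mathbb{L}^2_t(\partial\Omega)$ such that $\widehat{\mathcal M}$ is the Maxwell operator defined by the boundary condition $(I+K)V^{-1}\pi_\top \mathbf H + (I-K)V^\#\gamma_\top \mathbf E = 0$ (here $I$ is the identity on $\mathbb{L}^2_t(\partial\Omega)$), i.e. $\widehat{\mathcal M}$ is the restriction of $\mathcal M^*$ to the set of all $\{\mathbf E,\mathbf H\}\in \mathbb{H}(\mathrm{curl},\Omega)^2$ satisfying this condition. This equivalence establishes a one-to-one correspondence between m-dissipative extensions $\widehat{\mathcal M}$ of $\mathcal M$ and contractions $K$ on $\mathbb{L}^2_t(\partial\Omega)$. Moreover,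 $\widehat{\mathcal M}$ is selfadjoint if and only if the corresponding $K$ is unitary.
   Context: $\Omega\subset\mathbb R^3$ is a bounded Lipschitz domain (nonempty, open, connected, bounded, with Lipschitz boundary $\partial\Omega$); $\mathbf n$ is the outward unit normal, defined a.e. on $\partial\Omega$ with respect to surface measure. $\mathbb L^2(\Omega)=L^2(\Omega;\mathbb C^3)$. $\mathbb H(\mathrm{curl},\Omega)=\{\mathbf u\in\mathbb L^2(\Omega):\nabla\times\mathbf u\in\mathbb L^2(\Omega)\}$ (distributional curl) with the graph norm, and $\mathbb H_0(\mathrm{curl},\Omega)$ is the closure of $C_0^\infty(\Omega;\mathbb C^3)$ in it. $\varepsilon,\mu\in L^\infty(\Omega;\mathbb R^{3\times3}_{\mathrm{sym}})$ satisfy $\varepsilon(\mathbf x)\ge c I$, $\mu(\mathbf x)\ge cI$ a.e. for some $c>0$. $\mathbb L^2_{\varepsilon,\mu}(\Omega)$ is $\mathbb L^2(\Omega)\times\mathbb L^2(\Omega)$ with the inner product $(\{\mathbf E,\mathbf H\}|\{\mathbf E',\mathbf H'\})=(\varepsilon\mathbf E|\mathbf E')_{\mathbb L^2}+(\mu\mathbf H|\mathbf H')_{\mathbb L^2}$. The symmetric Maxwell operator is $\mathcal M\{\mathbf E,\mathbf H\}=\{\mathrm i\varepsilon^{-1}\nabla\times\mathbf H,-\mathrm i\mu^{-1}\nabla\times\mathbf E\}$ on $\mathrm{dom}\,\mathcal M=\mathbb H_0(\mathrm{curl},\Omega)^2$; its adjoint $\mathcal M^*$ acts by the same expression on $\mathbb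 H(\mathrm{curl},\Omega)^2$. $\mathbb L^2_t(\partial\Omega)=\{\mathbf v\in L^2(\partial\Omega;\mathbb C^3):\mathbf n\cdot\mathbf v=0\text{ a.e.}\}$. The tangential trace $\gamma_\top\mathbf u=-\mathbf n\times\mathbf u|_{\partial\Omega}$ and tangential component trace $\pi_\top\mathbf u=-\mathbf n\times(\mathbf n\times\mathbf u|_{\partial\Omega})$, defined for $\mathbf u\in C^\infty(\overline\Omega;\mathbb C^3)$, extend continuously to $\mathbb H(\mathrm{curl},\Omega)$; $\mathbb H^{-1/2}(\mathrm{curl}_{\partial\Omega}):=\pi_\top\mathbb H(\mathrm{curl},\Omega)$ and $\mathbb H^{-1/2}(\mathrm{div}_{\partial\Omega}):=\gamma_\top\mathbb H(\mathrm{curl},\Omega)$, Hilbert spaces with the quotient norms $|\mathbf u|_\pi=\inf\{\|\mathbf U\|_{\mathbb H(\mathrm{curl})}:\pi_\top\mathbf U=\mathbf u\}$, $|\mathbf v|_\gamma=\inf\{\|\mathbf V\|_{\mathbb H(\mathrm{curl})}:\gamma_\top\mathbf V=\mathbf v\}$. The $\mathbb L^2_t$-pairing of $\mathbf u\in\mathbb H^{-1/2}(\mathrm{curl}_{\partial\Omega})$ and $\mathbf v\in\mathbb H^{-1/2}(\mathrm{div}_{\partial\Omega})$ is $\langle\mathbf u|\mathbf v\rangle:=(\nabla\times\mathbf U|\mathbf V)_{\mathbb L^2(\Omega)}-(\mathbf U|\nabla\times\mathbf V)_{\mathbb L^2(\Omega)}$ for any $\mathbf U,\mathbf V\in\mathbb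 H(\mathrm{curl},\Omega)$ with $\pi_\top\mathbf U=\mathbf u$, $\gamma_\top\mathbf V=\mathbf v$ (independent of the choice), and $\langle\mathbf v|\mathbf u\rangle:=\overline{\langle\mathbf u|\mathbf v\rangle}$. An operator $T$ in a Hilbert space is m-dissipative if $\{\lambda:\mathrm{Im}\lambda>0\}$ lies in its resolvent set and $\|(T-\lambda I)^{-1}\|\le(\mathrm{Im}\lambda)^{-1}$ there. A contraction on a Hilbert space is an everywhere defined operator of norm $\le1$. *)

theory Defs
  imports "HOL-Analysis.Analysis"
begin

type_synonym pt = "real^3"
type_synonym cv = "complex^3"
type_synonym fld = "pt \<Rightarrow> cv"
type_synonym st = "fld \<times> fld"           (* a pair {E,H} *)
type_synonym mop = "(st \<times> st) set"      (* an operator, given by its graph *)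

definition cdot :: "cv \<Rightarrow> cv \<Rightarrow> complex" where
  "cdot a b = (\<Sum>i\<in>UNIV. a $ i * cnj (b $ i))"

definition rmatvec :: "real^3^3 \<Rightarrow> cv \<Rightarrow> cv" where
  "rmatvec m v = (\<chi> i. \<Sum>j\<in>UNIV. complex_of_real (m $ i $ j) * v $ j)"

definition ndot :: "real^3 \<Rightarrow> cv \<Rightarrow> complex" where
  "ndot n v = (\<Sum>i\<in>UNIV. complex_of_real (n $ i) * v $ i)"

definition lipschitz_domain :: "pt set \<Rightarrow> bool" where
  "lipschitz_domain \<Omega> \<longleftrightarrow> open \<Omega> \<and> connected \<Omega> \<and> bounded \<Omega> \<and> \<Omega> \<noteq> {} \<and>
    (\<forall>p\<in>frontier \<Omega>. \<exists>(Q :: pt \<Rightarrow> pt) (r::real) (h::real) (L::real) (g :: real \<Rightarrow> real \<Rightarrow> real).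
       orthogonal_transformation Q \<and> r > 0 \<and> h > 0 \<and>
       (\<forall>a b c d. \<bar>g a b - g c d\<bar> \<le> L * sqrt ((a - c)\<^sup>2 + (b - d)\<^sup>2)) \<and>
       (let C = {x. (Q (x - p) $ 1)\<^sup>2 + (Q (x - p) $ 2)\<^sup>2 < r\<^sup>2 \<and> \<bar>Q (x - p) $ 3\<bar> < h}
        in \<Omega> \<inter> C = {x\<in>C. Q (x - p) $ 3 < g (Q (x - p) $ 1) (Q (x - p) $ 2)}))"

definition hausdorff2_delta :: "real \<Rightarrow> pt set \<Rightarrow> ennreal" where
  "hausdorff2_delta \<delta> A = Inf {(\<Sum>i. ennreal (pi / 4 * (diameter (C i))\<^sup>2)) | C.
      A \<subseteq> (\<Union>i. C i) \<and> (\<forall>i. bounded (C i) \<and> diameter (C i) \<le> \<delta>)}"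

definition hausdorff2 :: "pt set \<Rightarrow> ennreal" where
  "hausdorff2 A = (SUP \<delta>\<in>{0<..}. hausdorff2_delta \<delta> A)"

definition surf :: "pt set \<Rightarrow> pt measure" where
  "surf \<Omega> = measure_of (frontier \<Omega>) (sets (restrict_space borel (frontier \<Omega>))) hausdorff2"

definition is_outward_normal :: "pt set \<Rightarrow> pt \<Rightarrow> real^3 \<Rightarrow> bool" where
  "is_outward_normal \<Omega> p n \<longleftrightarrow> norm n = 1 \<and>
     (\<forall>e>0. \<exists>r>0. \<forall>x. norm (x - p) < r \<longrightarrow>
        ((x - p) \<bullet> n > e * norm (x - p) \<longrightarrow> x \<notin> \<Omega>) \<and>
        ((x - p) \<bullet> n < - e * norm (x - p) \<longrightarrow> x \<in> \<Omega>))"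

definition normal :: "pt set \<Rightarrow> pt \<Rightarrow> real^3" where
  "normal \<Omega> p = (SOME n. is_outward_normal \<Omega> p n)"

definition L2 :: "pt set \<Rightarrow> fld \<Rightarrow> bool" where
  "L2 \<Omega> f \<longleftrightarrow> f \<in> borel_measurable (lebesgue_on \<Omega>) \<and>
      integrable (lebesgue_on \<Omega>) (\<lambda>x. (norm (f x))\<^sup>2)"

definition l2ip :: "pt set \<Rightarrow> fld \<Rightarrow> fld \<Rightarrow> complex" where
  "l2ip \<Omega> f g = (LINT x|lebesgue_on \<Omega>. cdot (f x) (g x))"

definition l2norm :: "pt set \<Rightarrow> fld \<Rightarrow> real" where
  "l2norm \<Omega> f = sqrt (LINT x|lebesgue_on \<Omega>. (norm (f x))\<^sup>2)"

definition aeq :: "pt set \<Rightarrow> fld \<Rightarrow> fld \<Rightarrow> bool" where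
  "aeq \<Omega> f g \<longleftrightarrow> (AE x in lebesgue_on \<Omega>. f x = g x)"

definition pd :: "3 \<Rightarrow> (pt \<Rightarrow> 'a::real_normed_vector) \<Rightarrow> pt \<Rightarrow> 'a" where
  "pd i f x = frechet_derivative f (at x) (axis i 1)"

fun Ck :: "nat \<Rightarrow> pt set \<Rightarrow> fld \<Rightarrow> bool" where
  "Ck 0 U f = continuous_on U f"
| "Ck (Suc k) U f = ((\<forall>x\<in>U. f differentiable (at x)) \<and> (\<forall>i. Ck k U (pd i f)))"

definition Cinf :: "pt set \<Rightarrow> fld \<Rightarrow> bool" where
  "Cinf U f \<longleftrightarrow> (\<forall>k. Ck k U f)"

definition test_field :: "pt set \<Rightarrow> fld \<Rightarrow> bool" where
  "test_field \<Omega> \<phi> \<longleftrightarrow> Cinf UNIV \<phi> \<and> compact (closure {x. \<phi> x \<noteq> 0}) \<and>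
      closure {x. \<phi> x \<noteq> 0} \<subseteq> \<Omega>"

definition curl :: "fld \<Rightarrow> fld" where
  "curl f x = (\<chi> i. if i = 1 then pd 2 (\<lambda>y. f y $ 3) x - pd 3 (\<lambda>y. f y $ 2) x
                 else if i = 2 then pd 3 (\<lambda>y. f y $ 1) x - pd 1 (\<lambda>y. f y $ 3) x
                 else pd 1 (\<lambda>y. f y $ 2) x - pd 2 (\<lambda>y. f y $ 1) x)"

definition is_dcurl :: "pt set \<Rightarrow> fld \<Rightarrow> fld \<Rightarrow> bool" where
  "is_dcurl \<Omega> U W \<longleftrightarrow> L2 \<Omega> W \<and>
     (\<forall>\<phi>. test_field \<Omega> \<phi> \<longrightarrow> l2ip \<Omega> U (curl \<phi>) = l2ip \<Omega> W \<phi>)"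

definition hcurl :: "pt set \<Rightarrow> fld \<Rightarrow> bool" where
  "hcurl \<Omega> U \<longleftrightarrow> L2 \<Omega> U \<and> (\<exists>W. is_dcurl \<Omega> U W)"

definition dcurl :: "pt set \<Rightarrow> fld \<Rightarrow> fld" where
  "dcurl \<Omega> U = (SOME W. is_dcurl \<Omega> U W)"

definition hcurl_norm :: "pt set \<Rightarrow> fld \<Rightarrow> real" where
  "hcurl_norm \<Omega> U = sqrt ((l2norm \<Omega> U)\<^sup>2 + (l2norm \<Omega> (dcurl \<Omega> U))\<^sup>2)"

definition hcurl0 :: "pt set \<Rightarrow> fld \<Rightarrow> bool" where
  "hcurl0 \<Omega> U \<longleftrightarrow> hcurl \<Omega> U \<and> (\<exists>\<phi>s. (\<forall>k. test_field \<Omega> (\<phi>s k)) \<and>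
      (\<lambda>k. hcurl_norm \<Omega> (\<lambda>x. \<phi>s k x - U x)) \<longlonglongrightarrow> 0)"

text \<open>The element pi_T U of H^{-1/2}(curl) (resp. gamma_T W of H^{-1/2}(div)) is
  represented by the field U (resp. W) in H(curl); the pairing is the one of the paper.\<close>

definition bd_pair :: "pt set \<Rightarrow> fld \<Rightarrow> fld \<Rightarrow> complex" where
  "bd_pair \<Omega> U W = l2ip \<Omega> (dcurl \<Omega> U) W - l2ip \<Omega> U (dcurl \<Omega> W)"

text \<open>Equality of traces: the traces of U and U' agree iff their difference pairs to zero
  with every trace of the dual space.\<close>
definition teq :: "pt set \<Rightarrow> fld \<Rightarrow> fld \<Rightarrow> bool" where
  "teq \<Omega> U U' \<longleftrightarrow> (\<forall>W. hcurl \<Omega> W \<longrightarrow> bd_pair \<Omega> (\<lambda>x. U x - U' x) W = 0)"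

definition pi_norm :: "pt set \<Rightarrow> fld \<Rightarrow> real" where
  "pi_norm \<Omega> U = Inf {hcurl_norm \<Omega> U' | U'. hcurl \<Omega> U' \<and> teq \<Omega> U' U}"

definition L2t :: "pt set \<Rightarrow> fld \<Rightarrow> bool" where
  "L2t \<Omega> f \<longleftrightarrow> f \<in> borel_measurable (surf \<Omega>) \<and>
      integrable (surf \<Omega>) (\<lambda>x. (norm (f x))\<^sup>2) \<and>
      (AE x in surf \<Omega>. ndot (normal \<Omega> x) (f x) = 0)"

definition ip_t :: "pt set \<Rightarrow> fld \<Rightarrow> fld \<Rightarrow> complex" where
  "ip_t \<Omega> f g = (LINT x|surf \<Omega>. cdot (f x) (g x))"

definition norm_t :: "pt set \<Rightarrow> fld \<Rightarrow> real" where
  "norm_t \<Omega> f = sqrt (LINT x|surf \<Omega>. (norm (f x))\<^sup>2)"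

definition aeq_t :: "pt set \<Rightarrow> fld \<Rightarrow> fld \<Rightarrow> bool" where
  "aeq_t \<Omega> f g \<longleftrightarrow> (AE x in surf \<Omega>. f x = g x)"

definition lin_homeo_V :: "pt set \<Rightarrow> (fld \<Rightarrow> fld) \<Rightarrow> bool" where
  "lin_homeo_V \<Omega> V \<longleftrightarrow>
     (\<forall>f. L2t \<Omega> f \<longrightarrow> hcurl \<Omega> (V f)) \<and>
     (\<forall>f g. L2t \<Omega> f \<and> L2t \<Omega> g \<and> aeq_t \<Omega> f g \<longrightarrow> teq \<Omega> (V f) (V g)) \<and>
     (\<forall>f g a b. L2t \<Omega> f \<and> L2t \<Omega> g \<longrightarrow>
        teq \<Omega> (V (\<lambda>x. a *s f x + b *s g x)) (\<lambda>x. a *s V f x + b *s V g x)) \<and>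
     (\<forall>f g. L2t \<Omega> f \<and> L2t \<Omega> g \<and> teq \<Omega> (V f) (V g) \<longrightarrow> aeq_t \<Omega> f g) \<and>
     (\<forall>U. hcurl \<Omega> U \<longrightarrow> (\<exists>f. L2t \<Omega> f \<and> teq \<Omega> (V f) U)) \<and>
     (\<exists>C. \<forall>f. L2t \<Omega> f \<longrightarrow> pi_norm \<Omega> (V f) \<le> C * norm_t \<Omega> f \<and> norm_t \<Omega> f \<le> C * pi_norm \<Omega> (V f))"

definition Vinv :: "pt set \<Rightarrow> (fld \<Rightarrow> fld) \<Rightarrow> fld \<Rightarrow> fld" where
  "Vinv \<Omega> V U = (SOME f. L2t \<Omega> f \<and> teq \<Omega> (V f) U)"

definition Vsharp :: "pt set \<Rightarrow> (fld \<Rightarrow> fld) \<Rightarrow> fld \<Rightarrow> fld" where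
  "Vsharp \<Omega> V W = (SOME g. L2t \<Omega> g \<and> (\<forall>f. L2t \<Omega> f \<longrightarrow> bd_pair \<Omega> (V f) W = ip_t \<Omega> f g))"

definition contraction_t :: "pt set \<Rightarrow> (fld \<Rightarrow> fld) \<Rightarrow> bool" where
  "contraction_t \<Omega> K \<longleftrightarrow>
     (\<forall>f. L2t \<Omega> f \<longrightarrow> L2t \<Omega> (K f)) \<and>
     (\<forall>f g. L2t \<Omega> f \<and> L2t \<Omega> g \<and> aeq_t \<Omega> f g \<longrightarrow> aeq_t \<Omega> (K f) (K g)) \<and>
     (\<forall>f g a b. L2t \<Omega> f \<and> L2t \<Omega> g \<longrightarrow>
        aeq_t \<Omega> (K (\<lambda>x. a *s f x + b *s g x)) (\<lambda>x. a *s K f x + b *s K g x)) \<and>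
     (\<forall>f. L2t \<Omega> f \<longrightarrow> norm_t \<Omega> (K f) \<le> norm_t \<Omega> f)"

definition unitary_t :: "pt set \<Rightarrow> (fld \<Rightarrow> fld) \<Rightarrow> bool" where
  "unitary_t \<Omega> K \<longleftrightarrow> contraction_t \<Omega> K \<and>
     (\<forall>f. L2t \<Omega> f \<longrightarrow> norm_t \<Omega> (K f) = norm_t \<Omega> f) \<and>
     (\<forall>g. L2t \<Omega> g \<longrightarrow> (\<exists>f. L2t \<Omega> f \<and> aeq_t \<Omega> (K f) g))"

definition L2em :: "pt set \<Rightarrow> st \<Rightarrow> bool" where
  "L2em \<Omega> u \<longleftrightarrow> L2 \<Omega> (fst u) \<and> L2 \<Omega> (snd u)"

definition em_ip :: "pt set \<Rightarrow> (pt \<Rightarrow> real^3^3) \<Rightarrow> (pt \<Rightarrow> real^3^3) \<Rightarrow> st \<Rightarrow> st \<Rightarrow> complex" where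
  "em_ip \<Omega> \<epsilon> \<mu> u v = l2ip \<Omega> (\<lambda>x. rmatvec (\<epsilon> x) (fst u x)) (fst v)
                     + l2ip \<Omega> (\<lambda>x. rmatvec (\<mu> x) (snd u x)) (snd v)"

definition em_norm :: "pt set \<Rightarrow> (pt \<Rightarrow> real^3^3) \<Rightarrow> (pt \<Rightarrow> real^3^3) \<Rightarrow> st \<Rightarrow> real" where
  "em_norm \<Omega> \<epsilon> \<mu> u = sqrt (Re (em_ip \<Omega> \<epsilon> \<mu> u u))"

definition eqv :: "pt set \<Rightarrow> st \<Rightarrow> st \<Rightarrow> bool" where
  "eqv \<Omega> u v \<longleftrightarrow> aeq \<Omega> (fst u) (fst v) \<and> aeq \<Omega> (snd u) (snd v)"

definition lc :: "complex \<Rightarrow> st \<Rightarrow> complex \<Rightarrow> st \<Rightarrow> st" where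
  "lc a u b v = ((\<lambda>x. a *s fst u x + b *s fst v x), (\<lambda>x. a *s snd u x + b *s snd v x))"

definition is_op :: "pt set \<Rightarrow> mop \<Rightarrow> bool" where
  "is_op \<Omega> T \<longleftrightarrow>
     (\<forall>(u, w)\<in>T. L2em \<Omega> u \<and> L2em \<Omega> w) \<and>
     (\<forall>u w u' w'. (u, w) \<in> T \<and> L2em \<Omega> u' \<and> L2em \<Omega> w' \<and> eqv \<Omega> u u' \<and> eqv \<Omega> w w'
        \<longrightarrow> (u', w') \<in> T) \<and>
     (\<forall>u w w'. (u, w) \<in> T \<and> (u, w') \<in> T \<longrightarrow> eqv \<Omega> w w') \<and>
     (\<forall>u w u' w' a b. (u, w) \<in> T \<and> (u', w') \<in> T \<longrightarrow> (lc a u b u', lc a w b w') \<in> T)"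

definition m_dissipative :: "pt set \<Rightarrow> (pt \<Rightarrow> real^3^3) \<Rightarrow> (pt \<Rightarrow> real^3^3) \<Rightarrow> mop \<Rightarrow> bool" where
  "m_dissipative \<Omega> \<epsilon> \<mu> T \<longleftrightarrow> (\<forall>z. Im z > 0 \<longrightarrow>
     (\<forall>f. L2em \<Omega> f \<longrightarrow> (\<exists>u. (u, lc 1 f z u) \<in> T)) \<and>
     (\<forall>u f. L2em \<Omega> f \<and> (u, lc 1 f z u) \<in> T \<longrightarrow> em_norm \<Omega> \<epsilon> \<mu> u \<le> em_norm \<Omega> \<epsilon> \<mu> f / Im z))"

definition adj :: "pt set \<Rightarrow> (pt \<Rightarrow> real^3^3) \<Rightarrow> (pt \<Rightarrow> real^3^3) \<Rightarrow> mop \<Rightarrow> mop" where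
  "adj \<Omega> \<epsilon> \<mu> T = {(v, w). L2em \<Omega> v \<and> L2em \<Omega> w \<and>
      (\<forall>u z. (u, z) \<in> T \<longrightarrow> em_ip \<Omega> \<epsilon> \<mu> z v = em_ip \<Omega> \<epsilon> \<mu> u w)}"

definition selfadjoint :: "pt set \<Rightarrow> (pt \<Rightarrow> real^3^3) \<Rightarrow> (pt \<Rightarrow> real^3^3) \<Rightarrow> mop \<Rightarrow> bool" where
  "selfadjoint \<Omega> \<epsilon> \<mu> T \<longleftrightarrow>
     (\<forall>f. L2em \<Omega> f \<longrightarrow> (\<forall>e>0. \<exists>u w. (u, w) \<in> T \<and>
         em_norm \<Omega> \<epsilon> \<mu> (lc 1 u (-1) f) < e)) \<and>
     T = adj \<Omega> \<epsilon> \<mu> T"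

definition Mx :: "pt set \<Rightarrow> (pt \<Rightarrow> real^3^3) \<Rightarrow> (pt \<Rightarrow> real^3^3) \<Rightarrow> st \<Rightarrow> st" where
  "Mx \<Omega> \<epsilon> \<mu> u = ((\<lambda>x. \<i> *s rmatvec (matrix_inv (\<epsilon> x)) (dcurl \<Omega> (snd u) x)),
                  (\<lambda>x. (- \<i>) *s rmatvec (matrix_inv (\<mu> x)) (dcurl \<Omega> (fst u) x)))"

definition Mmin :: "pt set \<Rightarrow> (pt \<Rightarrow> real^3^3) \<Rightarrow> (pt \<Rightarrow> real^3^3) \<Rightarrow> mop" where
  "Mmin \<Omega> \<epsilon> \<mu> = {(u, w). hcurl0 \<Omega> (fst u) \<and> hcurl0 \<Omega> (snd u) \<and> L2em \<Omega> w \<and>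
      eqv \<Omega> w (Mx \<Omega> \<epsilon> \<mu> u)}"

definition bc :: "pt set \<Rightarrow> (fld \<Rightarrow> fld) \<Rightarrow> (fld \<Rightarrow> fld) \<Rightarrow> st \<Rightarrow> bool" where
  "bc \<Omega> V K u \<longleftrightarrow>
     (let a = Vinv \<Omega> V (snd u); b = Vsharp \<Omega> V (fst u)
      in aeq_t \<Omega> (\<lambda>x. (a x + K a x) + (b x - K b x)) (\<lambda>x. 0))"

text \<open>Restriction of M^* to the fields in H(curl)^2 satisfying the boundary condition.\<close>
definition Mbc :: "pt set \<Rightarrow> (pt \<Rightarrow> real^3^3) \<Rightarrow> (pt \<Rightarrow> real^3^3) \<Rightarrow> (fld \<Rightarrow> fld) \<Rightarrow> (fld \<Rightarrow> fld) \<Rightarrow> mop" where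
  "Mbc \<Omega> \<epsilon> \<mu> V K = {(u, w). hcurl \<Omega> (fst u) \<and> hcurl \<Omega> (snd u) \<and> bc \<Omega> V K u \<and>
      L2em \<Omega> w \<and> eqv \<Omega> w (Mx \<Omega> \<epsilon> \<mu> u)}"

definition admissible_coeff :: "pt set \<Rightarrow> (pt \<Rightarrow> real^3^3) \<Rightarrow> bool" where
  "admissible_coeff \<Omega> m \<longleftrightarrow>
     (\<forall>i j. (\<lambda>x. m x $ i $ j) \<in> borel_measurable (lebesgue_on \<Omega>)) \<and>
     (\<exists>C. AE x in lebesgue_on \<Omega>. \<forall>i j. \<bar>m x $ i $ j\<bar> \<le> C) \<and>
     (AE x in lebesgue_on \<Omega>. transpose (m x) = m x)"

definition unif_pos :: "pt set \<Rightarrow> (pt \<Rightarrow> real^3^3) \<Rightarrow> real \<Rightarrow> bool" where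
  "unif_pos \<Omega> m c \<longleftrightarrow> (AE x in lebesgue_on \<Omega>. \<forall>v. v \<bullet> (m x *v v) \<ge> c * (norm v)\<^sup>2)"

end

(* Set P = V^# (gamma E) + V^{-1} (pi H) and Q = V^# (gamma E) - V^{-1} (pi H).  Integration by
   parts becomes (M^* u | v) - (u | M^* v) = (i/2) ((P u | P v) - (Q u | Q v)), and (P, Q) maps
   H(curl)^2 onto pairs of tangential fields, so the boundary condition reads P u = K (Q u) and
   |K| <= 1 is exactly Im (M^* u | u) <= 0.  An m-dissipative extension T of M is a restriction of
   M^*, its boundary values (Q u, P u) form the graph of a contraction, and maximality shows that
   every contraction extending it defines T.  Conversely, the domain given by K is the adjoint of
   the one given by P v = g, Q v = K^* g, hence closed, and the range of its operator minus z is
   dense for Im z > 0. *)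
theory Submission
  imports Defs "HOL-Library.Function_Algebras"
begin

section \<open>Semi-inner-product spaces that are complete\<close>

text \<open>Fields are functions rather than classes modulo null sets, and the distributional curl,
  V^{-1} and V^# are picked by choice, so \<open>A\<close>, \<open>P\<close>, \<open>Q\<close>
  respect linear combinations only up to vectors of norm zero. The abstract half therefore works in
  complete semi-inner-product spaces with \<open>eqn\<close> as equality and postulates no linearity
  of the boundary maps: Green's identity and surjectivity of (P, Q) force it. Traces are not
  constructed as boundary fields: an H(curl) field stands for its trace and acts only through the
  pairing. The analysis rests on three facts: the distributional curl is unique (fundamental lemma
  for test fields); on test fields it is the classical curl (translation invariance of Lebesgue
  measure); every tangential field is a value of V^#. With a = V^{-1} pi H and b = V^# gamma E, the
  boundary form is i ((a|b') + (b|a')). Passing to b + a and b - a diagonalises it, which explains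
  the factor i/2 and the shape (I+K) a + (I-K) b = 0, that is b + a = K (b - a).\<close>

lemma linear_le_quadratic_imp_zero:
  fixes a b c :: real
  assumes "\<And>t. t > 0 \<Longrightarrow> a * t \<le> b * t\<^sup>2" "a \<ge> 0"
  shows "a = 0"
proof (rule ccontr)
  assume "a \<noteq> 0" then have a: "a > 0" using assms by simp
  \<comment> \<open>This makes \<open>(\<bar>b\<bar> + 1) * t\<close> equal to a / 2, against a
    \<le> b t; the added 1 keeps the denominator positive.\<close>
  define t where "t = a / (2 * (\<bar>b\<bar> + 1))"
  have t: "t > 0" using a by (simp add: t_def)
  have "a \<le> b * t" using assms(1)[OF t] t by (simp add: power2_eq_square)
  also have "\<dots> \<le> (\<bar>b\<bar> + 1) * t" using t by (intro mult_right_mono) auto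
  also have "\<dots> = a / 2" by (simp add: t_def field_simps add_eq_0_iff)
  finally show False using a by simp
qed

text \<open>Definiteness is deliberately absent: \<open>ip x x = 0\<close> holds for functions
  vanishing almost everywhere. \<open>H\<close> is a carrier inside the type of all functions, where
  addition and scaling are total but the laws of \<open>ip\<close> hold only on \<open>H\<close>.
  Completeness asks for some limit, which need not be unique.\<close>

locale semihilbert = module scale
  for scale :: "complex \<Rightarrow> 'a::ab_group_add \<Rightarrow> 'a"  (infixr "*\<^sub>s" 75) +
  fixes H :: "'a set" and ip :: "'a \<Rightarrow> 'a \<Rightarrow> complex"
  assumes zero_mem [simp]: "0 \<in> H"
    and add_mem [simp]: "x \<in> H \<Longrightarrow> y \<in> H \<Longrightarrow> x + y \<in> H"
    and scale_mem [simp]: "x \<in> H \<Longrightarrow> a *\<^sub>s x \<in> H"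
    and ip_add_left: "x \<in> H \<Longrightarrow> y \<in> H \<Longrightarrow> z \<in> H \<Longrightarrow> ip (x + y) z = ip x z + ip y z"
    and ip_scale_left: "x \<in> H \<Longrightarrow> y \<in> H \<Longrightarrow> ip (a *\<^sub>s x) y = a * ip x y"
    and ip_cnj: "x \<in> H \<Longrightarrow> y \<in> H \<Longrightarrow> ip y x = cnj (ip x y)"
    and ip_pos: "x \<in> H \<Longrightarrow> 0 \<le> Re (ip x x)"
    and complete: "(\<And>n::nat. s n \<in> H) \<Longrightarrow>
      (\<And>e. e > 0 \<Longrightarrow> \<exists>N. \<forall>m\<ge>N. \<forall>n\<ge>N. sqrt (Re (ip (s m - s n) (s m - s n))) < e) \<Longrightarrow>
      \<exists>p\<in>H. (\<lambda>n. sqrt (Re (ip (s n - p) (s n - p)))) \<longlonglongrightarrow> 0"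
begin

definition nrm :: "'a \<Rightarrow> real" where
  "nrm x = sqrt (Re (ip x x))"

definition eqn :: "'a \<Rightarrow> 'a \<Rightarrow> bool" where
  "eqn x y \<longleftrightarrow> nrm (x - y) = 0"

notation eqn (infix "\<doteq>" 50)

definition conv :: "(nat \<Rightarrow> 'a) \<Rightarrow> 'a \<Rightarrow> bool" where
  "conv s p \<longleftrightarrow> (\<lambda>n. nrm (s n - p)) \<longlonglongrightarrow> 0"

lemma uminus_mem [simp]: "x \<in> H \<Longrightarrow> - x \<in> H"
  using scale_mem[of x "-1"] by simp

lemma diff_mem [simp]: "x \<in> H \<Longrightarrow> y \<in> H \<Longrightarrow> x - y \<in> H"
  using add_mem[of x "- y"] by simp

lemma ip_add_right: "x \<in> H \<Longrightarrow> y \<in> H \<Longrightarrow> z \<in> H \<Longrightarrow> ip z (x + y) = ip z x + ip z y"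
  using ip_cnj[of "x + y" z] ip_cnj[of x z] ip_cnj[of y z] ip_add_left[of x y z] by simp

lemma ip_scale_right: "x \<in> H \<Longrightarrow> y \<in> H \<Longrightarrow> ip x (a *\<^sub>s y) = cnj a * ip x y"
  using ip_cnj[of "a *\<^sub>s y" x] ip_cnj[of y x] ip_scale_left[of y x a] by simp

lemma ip_minus_left: "x \<in> H \<Longrightarrow> y \<in> H \<Longrightarrow> ip (- x) y = - ip x y"
  using ip_scale_left[of x y "-1"] by simp

lemma ip_minus_right: "x \<in> H \<Longrightarrow> y \<in> H \<Longrightarrow> ip x (- y) = - ip x y"
  using ip_scale_right[of x y "-1"] by simp

lemma ip_diff_left: "x \<in> H \<Longrightarrow> y \<in> H \<Longrightarrow> z \<in> H \<Longrightarrow> ip (x - y) z = ip x z - ip y z"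
  using ip_add_left[of x "- y" z] by (simp add: ip_minus_left)

lemma ip_diff_right: "x \<in> H \<Longrightarrow> y \<in> H \<Longrightarrow> z \<in> H \<Longrightarrow> ip z (x - y) = ip z x - ip z y"
  using ip_add_right[of x "- y" z] by (simp add: ip_minus_right)

lemma ip_zero_left [simp]: "x \<in> H \<Longrightarrow> ip 0 x = 0"
  using ip_scale_left[of x x 0] by simp

lemma ip_zero_right [simp]: "x \<in> H \<Longrightarrow> ip x 0 = 0"
  using ip_scale_right[of x x 0] by simp

lemmas ip_lin = ip_add_left ip_add_right ip_diff_left ip_diff_right ip_scale_left ip_scale_right
  ip_minus_left ip_minus_right

lemma Im_ip_self: "x \<in> H \<Longrightarrow> Im (ip x x) = 0"
  using ip_cnj[of x x] by (metis complex_cnj_zero_iff Reals_cnj_iff complex_is_Real_iff)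

lemma nrm_nonneg [simp]: "x \<in> H \<Longrightarrow> 0 \<le> nrm x"
  by (simp add: nrm_def ip_pos)

lemma nrm_sq: "x \<in> H \<Longrightarrow> (nrm x)\<^sup>2 = Re (ip x x)"
  by (simp add: nrm_def ip_pos)

lemma ip_self: "x \<in> H \<Longrightarrow> ip x x = complex_of_real ((nrm x)\<^sup>2)"
  by (simp add: complex_eq_iff nrm_sq Im_ip_self)

lemma nrm_zero [simp]: "nrm 0 = 0"
  by (simp add: nrm_def)

lemma nrm_scale: "x \<in> H \<Longrightarrow> nrm (a *\<^sub>s x) = cmod a * nrm x"
proof -
  assume x: "x \<in> H"
  have "ip (a *\<^sub>s x) (a *\<^sub>s x) = (a * cnj a) * ip x x" using x by (simp add: ip_lin)
  also have "\<dots> = complex_of_real ((cmod a)\<^sup>2 * (nrm x)\<^sup>2)"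
    using x by (simp add: ip_self complex_norm_square[symmetric])
  finally show ?thesis using x unfolding nrm_def[of "a *\<^sub>s x"] by (simp add: real_sqrt_mult)
qed

lemma nrm_minus: "x \<in> H \<Longrightarrow> nrm (- x) = nrm x"
  using nrm_scale[of x "-1"] by simp

lemma nrm_minus_commute: "x \<in> H \<Longrightarrow> y \<in> H \<Longrightarrow> nrm (x - y) = nrm (y - x)"
  using nrm_minus[of "x - y"] by simp

lemma nrm_sq_add: 
  assumes "x \<in> H" "y \<in> H"
  shows "(nrm (x + y))\<^sup>2 = (nrm x)\<^sup>2 + 2 * Re (ip x y) + (nrm y)\<^sup>2"
  using assms ip_cnj[of x y] by (simp add: nrm_sq ip_lin)

lemma nrm_sq_diff: 
  assumes "x \<in> H" "y \<in> H"
  shows "(nrm (x - y))\<^sup>2 = (nrm x)\<^sup>2 - 2 * Re (ip x y) + (nrm y)\<^sup>2"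
  using assms ip_cnj[of x y] by (simp add: nrm_sq ip_lin)

text \<open>The displacement carries the phase of \<open>ip x y\<close>, so the quadratic in t has
  real coefficients. It serves both Cauchy-Schwarz and the first-order condition in
  \<open>projection\<close>.\<close>

lemma nrm_sq_sub_scaled:
  assumes "x \<in> H" "y \<in> H"
  shows "(nrm (x - (of_real t * ip x y) *\<^sub>s y))\<^sup>2
    = (nrm x)\<^sup>2 - 2 * t * (cmod (ip x y))\<^sup>2 + t\<^sup>2 * (cmod (ip x y))\<^sup>2 * (nrm y)\<^sup>2"
proof -
  have "ip x ((of_real t * ip x y) *\<^sub>s y) = of_real t * (ip x y * cnj (ip x y))"
    using assms by (simp add: ip_lin)
  also have "\<dots> = of_real (t * (cmod (ip x y))\<^sup>2)"
    by (simp add: complex_norm_square[symmetric])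
  finally have "Re (ip x ((of_real t * ip x y) *\<^sub>s y)) = t * (cmod (ip x y))\<^sup>2" by simp
  then show ?thesis using assms
    by (simp add: nrm_sq_diff nrm_scale norm_mult power_mult_distrib)
qed

text \<open>A null \<open>y\<close> needs its own argument: the quadratic of
  \<open>nrm_sq_sub_scaled\<close> is then affine in t and nonnegative for all t, so its slope
  vanishes.\<close>

lemma cauchy_schwarz:
  assumes "x \<in> H" "y \<in> H"
  shows "cmod (ip x y) \<le> nrm x * nrm y"
proof (cases "nrm y = 0")
  case True
  have *: "2 * t * (cmod (ip x y))\<^sup>2 \<le> (nrm x)\<^sup>2" for t
    using nrm_sq_sub_scaled[OF assms, of t] True zero_le_power2[of "nrm (x - (of_real t * ip x y) *\<^sub>s y)"]
    by simp
  have "(cmod (ip x y))\<^sup>2 = 0"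
  proof (rule ccontr)
    assume "(cmod (ip x y))\<^sup>2 \<noteq> 0"
    then show False using *[of "((nrm x)\<^sup>2 + 1) / (2 * (cmod (ip x y))\<^sup>2)"] by simp
  qed
  then show ?thesis using True by simp
next
  case False
  \<comment> \<open>The minimiser of the quadratic in t.\<close>
  define t where "t = 1 / (nrm y)\<^sup>2"
  have "0 \<le> (nrm x)\<^sup>2 - 2 * t * (cmod (ip x y))\<^sup>2 + t\<^sup>2 * (cmod (ip x y))\<^sup>2 * (nrm y)\<^sup>2"
    using nrm_sq_sub_scaled[OF assms, of t] by (metis zero_le_power2)
  also have "\<dots> = (nrm x)\<^sup>2 - (cmod (ip x y))\<^sup>2 / (nrm y)\<^sup>2"
    using False by (simp add: t_def field_simps power2_eq_square)
  finally have "(cmod (ip x y))\<^sup>2 \<le> (nrm x * nrm y)\<^sup>2"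
    using False by (simp add: divide_le_eq power_mult_distrib)
  then show ?thesis using assms by (simp add: power2_le_iff_abs_le)
qed

lemma nrm_triangle:
  assumes "x \<in> H" "y \<in> H"
  shows "nrm (x + y) \<le> nrm x + nrm y"
proof -
  have "Re (ip x y) \<le> nrm x * nrm y"
    using cauchy_schwarz[OF assms] complex_Re_le_cmod order_trans by blast
  then have "(nrm (x + y))\<^sup>2 \<le> (nrm x + nrm y)\<^sup>2"
    using nrm_sq_add[OF assms] by (simp add: power2_sum)
  then show ?thesis using assms by (simp add: power2_le_iff_abs_le)
qed

lemma nrm_triangle_diff:
  assumes "x \<in> H" "y \<in> H" "z \<in> H"
  shows "nrm (x - z) \<le> nrm (x - y) + nrm (y - z)"
  using nrm_triangle[of "x - y" "y - z"] assms by simp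

lemma nrm_diff_bound:
  assumes "x \<in> H" "y \<in> H"
  shows "\<bar>nrm x - nrm y\<bar> \<le> nrm (x - y)"
  using nrm_triangle[of "x - y" y] nrm_triangle[of "y - x" x] nrm_minus_commute[of x y] assms
  by simp

lemma eqn_refl [simp]: "x \<doteq> x"
  by (simp add: eqn_def)

text \<open>Testing against all of \<open>H\<close> turns equality modulo null vectors into scalar
  equations, so the congruence rules below reduce to additivity and homogeneity of
  \<open>ip\<close>.\<close>

lemma eqn_iff_ip:
  assumes "x \<in> H" "y \<in> H"
  shows "x \<doteq> y \<longleftrightarrow> (\<forall>z\<in>H. ip x z = ip y z)"
proof
  assume "x \<doteq> y"
  then have "cmod (ip (x - y) z) \<le> 0" if "z \<in> H" for z
    using cauchy_schwarz[of "x - y" z] assms that by (simp add: eqn_def)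
  then show "\<forall>z\<in>H. ip x z = ip y z" using assms by (simp add: ip_lin)
next
  assume "\<forall>z\<in>H. ip x z = ip y z"
  then have "ip (x - y) (x - y) = 0" using assms by (simp add: ip_diff_left)
  then show "x \<doteq> y" by (simp add: eqn_def nrm_def)
qed

lemma eqn_ip_left: "x \<doteq> y \<Longrightarrow> x \<in> H \<Longrightarrow> y \<in> H \<Longrightarrow> z \<in> H \<Longrightarrow> ip x z = ip y z"
  using eqn_iff_ip by blast

lemma eqn_ip_right: "x \<doteq> y \<Longrightarrow> x \<in> H \<Longrightarrow> y \<in> H \<Longrightarrow> z \<in> H \<Longrightarrow> ip z x = ip z y"
  using eqn_ip_left[of x y z] ip_cnj[of x z] ip_cnj[of y z] by simp

lemma eqn_sym: "x \<doteq> y \<Longrightarrow> x \<in> H \<Longrightarrow> y \<in> H \<Longrightarrow> y \<doteq> x"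
  using eqn_iff_ip by simp

lemma eqn_trans: "x \<doteq> y \<Longrightarrow> y \<doteq> z \<Longrightarrow> x \<in> H \<Longrightarrow> y \<in> H \<Longrightarrow> z \<in> H \<Longrightarrow> x \<doteq> z"
  by (simp add: eqn_iff_ip)

lemma eqn_lin:
  "x \<doteq> y \<Longrightarrow> x' \<doteq> y' \<Longrightarrow> x \<in> H \<Longrightarrow> y \<in> H \<Longrightarrow> x' \<in> H \<Longrightarrow> y' \<in> H \<Longrightarrow>
    a *\<^sub>s x + b *\<^sub>s x' \<doteq> a *\<^sub>s y + b *\<^sub>s y'"
  by (simp add: eqn_iff_ip ip_lin)

lemma eqn_add:
  "x \<doteq> y \<Longrightarrow> x' \<doteq> y' \<Longrightarrow> x \<in> H \<Longrightarrow> y \<in> H \<Longrightarrow> x' \<in> H \<Longrightarrow> y' \<in> H \<Longrightarrow> x + x' \<doteq> y + y'"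
  by (simp add: eqn_iff_ip ip_lin)

lemma eqn_diff:
  "x \<doteq> y \<Longrightarrow> x' \<doteq> y' \<Longrightarrow> x \<in> H \<Longrightarrow> y \<in> H \<Longrightarrow> x' \<in> H \<Longrightarrow> y' \<in> H \<Longrightarrow> x - x' \<doteq> y - y'"
  by (simp add: eqn_iff_ip ip_lin)

lemma eqn_scale: "x \<doteq> y \<Longrightarrow> x \<in> H \<Longrightarrow> y \<in> H \<Longrightarrow> a *\<^sub>s x \<doteq> a *\<^sub>s y"
  by (simp add: eqn_iff_ip ip_lin)

lemma eqn_nrm: "x \<doteq> y \<Longrightarrow> x \<in> H \<Longrightarrow> y \<in> H \<Longrightarrow> nrm x = nrm y"
  using eqn_ip_left[of x y x] eqn_ip_right[of x y y] by (simp add: nrm_def)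

lemma eqn_zero_iff: "x \<doteq> 0 \<longleftrightarrow> nrm x = 0"
  by (simp add: eqn_def)

lemma nrm_le_zero_iff: "x \<in> H \<Longrightarrow> nrm x \<le> 0 \<longleftrightarrow> x \<doteq> 0"
  using nrm_nonneg[of x] by (simp add: eqn_zero_iff order_antisym_conv)

lemma conv_const [simp]: "conv (\<lambda>n. x) x"
  by (simp add: conv_def)

lemma conv_ip_left:
  assumes "conv s p" "\<And>n. s n \<in> H" "p \<in> H" "y \<in> H"
  shows "(\<lambda>n. ip (s n) y) \<longlonglongrightarrow> ip p y"
proof -
  have "(\<lambda>n. ip (s n - p) y) \<longlonglongrightarrow> 0"
  proof (rule tendsto_norm_zero_cancel, rule Lim_null_comparison)
    show "\<forall>\<^sub>F n in sequentially. norm (norm (ip (s n - p) y)) \<le> nrm (s n - p) * nrm y"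
      using cauchy_schwarz assms by simp
    show "(\<lambda>n. nrm (s n - p) * nrm y) \<longlonglongrightarrow> 0"
      using assms(1) by (auto simp: conv_def intro: tendsto_mult_left_zero)
  qed
  then have "(\<lambda>n. ip (s n) y - ip p y) \<longlonglongrightarrow> 0" using assms by (simp add: ip_lin)
  then show ?thesis by (simp add: LIM_zero_iff)
qed

lemma conv_nrm:
  assumes "conv s p" "\<And>n. s n \<in> H" "p \<in> H"
  shows "(\<lambda>n. nrm (s n)) \<longlonglongrightarrow> nrm p"
proof -
  have "(\<lambda>n. nrm (s n) - nrm p) \<longlonglongrightarrow> 0"
    by (rule Lim_null_comparison[of _ "\<lambda>n. nrm (s n - p)"])
       (use assms nrm_diff_bound in \<open>auto simp: conv_def\<close>)
  then show ?thesis by (simp add: LIM_zero_iff)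
qed

lemma conv_lin:
  assumes "conv s p" "\<And>n. s n \<in> H" "p \<in> H" "conv s' p'" "\<And>n. s' n \<in> H" "p' \<in> H"
  shows "conv (\<lambda>n. a *\<^sub>s s n + b *\<^sub>s s' n) (a *\<^sub>s p + b *\<^sub>s p')"
  unfolding conv_def
proof (rule Lim_null_comparison)
  have "nrm (a *\<^sub>s s n + b *\<^sub>s s' n - (a *\<^sub>s p + b *\<^sub>s p')) \<le> cmod a * nrm (s n - p) + cmod b * nrm (s' n - p')" for n
  proof -
    have "a *\<^sub>s s n + b *\<^sub>s s' n - (a *\<^sub>s p + b *\<^sub>s p') = a *\<^sub>s (s n - p) + b *\<^sub>s (s' n - p')"
      by (simp add: scale_right_diff_distrib)
    then show ?thesis
      using nrm_triangle[of "a *\<^sub>s (s n - p)" "b *\<^sub>s (s' n - p')"] assms by (simp add: nrm_scale)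
  qed
  then show "\<forall>\<^sub>F n in sequentially. norm (nrm (a *\<^sub>s s n + b *\<^sub>s s' n - (a *\<^sub>s p + b *\<^sub>s p')))
      \<le> cmod a * nrm (s n - p) + cmod b * nrm (s' n - p')"
    using assms by simp
  show "(\<lambda>n. cmod a * nrm (s n - p) + cmod b * nrm (s' n - p')) \<longlonglongrightarrow> 0"
    using assms unfolding conv_def by (auto intro!: tendsto_eq_intros)
qed

lemma cauchy_conv:
  assumes "\<And>n. s n \<in> H" "\<And>e. e > 0 \<Longrightarrow> \<exists>N. \<forall>m\<ge>N. \<forall>n\<ge>N. nrm (s m - s n) < e"
  obtains p where "p \<in> H" "conv s p"
  using complete[of s] assms unfolding nrm_def conv_def by blast

lemma conv_cauchy:
  assumes "conv s p" "\<And>n. s n \<in> H" "p \<in> H" "e > 0"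
  shows "\<exists>N. \<forall>m\<ge>N. \<forall>n\<ge>N. nrm (s m - s n) < e"
proof -
  obtain N where N: "\<And>n. n \<ge> N \<Longrightarrow> nrm (s n - p) < e / 2"
    using assms LIMSEQ_D[of "\<lambda>n. nrm (s n - p)" 0 "e/2"] by (force simp: conv_def)
  have "nrm (s m - s n) < e" if "m \<ge> N" "n \<ge> N" for m n
    using nrm_triangle_diff[of "s m" p "s n"] N[OF that(1)] N[OF that(2)] assms
      nrm_minus_commute[of p "s n"] by simp
  then show ?thesis by blast
qed

section \<open>Subspaces, orthogonal projection and the Riesz theorem\<close>

definition csub :: "'a set \<Rightarrow> bool" where
  "csub S \<longleftrightarrow> S \<subseteq> H \<and> 0 \<in> S \<and> (\<forall>x\<in>S. \<forall>y\<in>S. \<forall>a b. a *\<^sub>s x + b *\<^sub>s y \<in> S)"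

lemma csubD:
  assumes "csub S"
  shows "x \<in> S \<Longrightarrow> x \<in> H" "0 \<in> S" "x \<in> S \<Longrightarrow> y \<in> S \<Longrightarrow> x + y \<in> S"
    "x \<in> S \<Longrightarrow> a *\<^sub>s x \<in> S" "x \<in> S \<Longrightarrow> y \<in> S \<Longrightarrow> a *\<^sub>s x + b *\<^sub>s y \<in> S"
    "x \<in> S \<Longrightarrow> y \<in> S \<Longrightarrow> x - y \<in> S"
proof -
  have *: "a *\<^sub>s x + b *\<^sub>s y \<in> S" if "x \<in> S" "y \<in> S" for a b x y using assms that by (simp add: csub_def)
  show "x \<in> S \<Longrightarrow> x \<in> H" "0 \<in> S" "x \<in> S \<Longrightarrow> y \<in> S \<Longrightarrow> a *\<^sub>s x + b *\<^sub>s y \<in> S"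
    using assms by (auto simp: csub_def)
  show "x \<in> S \<Longrightarrow> y \<in> S \<Longrightarrow> x + y \<in> S" using *[of x y 1 1] by simp
  show "x \<in> S \<Longrightarrow> y \<in> S \<Longrightarrow> x - y \<in> S" using *[of x y 1 "-1"] by simp
  show "x \<in> S \<Longrightarrow> a *\<^sub>s x \<in> S" using *[of x x a 0] by simp
qed

text \<open>The parallelogram law makes a minimising sequence Cauchy. The foot \<open>p\<close> may
  lie outside \<open>S\<close>, so it is returned together with a sequence from \<open>S\<close>
  converging to it, and later arguments work with that sequence.\<close>

lemma projection:
  assumes S: "csub S" and f: "f \<in> H"
  obtains s p where "\<And>n::nat. s n \<in> S" "p \<in> H" "conv s p" "\<And>y. y \<in> S \<Longrightarrow> ip (f - p) y = 0"
proof -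
  note SD = csubD[OF S]
  define d where "d = (INF s\<in>S. (nrm (f - s))\<^sup>2)"
  have bdd: "bdd_below ((\<lambda>s. (nrm (f - s))\<^sup>2) ` S)" by (rule bdd_belowI2[of _ 0]) simp
  have d_le: "d \<le> (nrm (f - s))\<^sup>2" if "s \<in> S" for s
    unfolding d_def by (rule cINF_lower[OF bdd that])
  have "\<exists>s\<in>S. (nrm (f - s))\<^sup>2 < d + 1 / real (Suc n)" for n
    unfolding d_def using cINF_less_iff[OF _ bdd, of "d + 1 / real (Suc n)"] SD(2)
    by (auto simp: d_def)
  then obtain s where s: "\<And>n. s n \<in> S" "\<And>n. (nrm (f - s n))\<^sup>2 < d + 1 / real (Suc n)" by metis
  note sH = SD(1)[OF s(1)]
  have par: "(nrm (s m - s n))\<^sup>2 < 2 / real (Suc m) + 2 / real (Suc n)" for m n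
  proof -
    \<comment> \<open>The midpoint lies in \<open>S\<close>, so its squared distance to
      \<open>f\<close> is at least d; this is what makes the parallelogram law bound
      \<open>s m - s n\<close>.\<close>
    define h where "h = (1/2) *\<^sub>s (s m + s n)"
    have hS: "h \<in> S" using s SD by (simp add: h_def)
    have eq: "(f - s m) + (f - s n) = 2 *\<^sub>s (f - h)"
      unfolding h_def scale_right_diff_distrib scale_scale scale_left_distrib[of 1 1 f, simplified]
      by simp
    have "(nrm ((f - s m) + (f - s n)))\<^sup>2 + (nrm ((f - s n) - (f - s m)))\<^sup>2
        = 2 * (nrm (f - s m))\<^sup>2 + 2 * (nrm (f - s n))\<^sup>2"
      using nrm_sq_add[of "f - s m" "f - s n"] nrm_sq_diff[of "f - s n" "f - s m"] f sH
        ip_cnj[of "f - s m" "f - s n"] by simp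
    moreover have "(nrm ((f - s m) + (f - s n)))\<^sup>2 = 4 * (nrm (f - h))\<^sup>2"
      unfolding eq using nrm_scale[of "f - h" 2] f hS SD by (simp add: power_mult_distrib)
    ultimately have "(nrm (s m - s n))\<^sup>2 \<le> 2 * (nrm (f - s m))\<^sup>2 + 2 * (nrm (f - s n))\<^sup>2 - 4 * d"
      using d_le[OF hS] by simp
    then show ?thesis using s(2)[of m] s(2)[of n] by simp
  qed
  have cau: "\<exists>N. \<forall>m\<ge>N. \<forall>n\<ge>N. nrm (s m - s n) < e" if e: "e > 0" for e
  proof -
    \<comment> \<open>The threshold makes 2 / N + 2 / N smaller than e^2.\<close>
    obtain N where N: "4 / e\<^sup>2 < real N" using reals_Archimedean2 by blast
    have "nrm (s m - s n) < e" if "m \<ge> N" "n \<ge> N" for m n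
    proof -
      have N0: "0 < real N" using N e by (smt (verit) divide_nonneg_nonneg zero_le_power2)
      have "(nrm (s m - s n))\<^sup>2 < 2 / real (Suc m) + 2 / real (Suc n)" by (rule par)
      also have "\<dots> \<le> 2 / real N + 2 / real N"
        using that N0 by (intro add_mono divide_left_mono) auto
      also have "\<dots> < e\<^sup>2" using N N0 e by (simp add: field_simps)
      finally show ?thesis using e by (simp add: power_less_imp_less_base)
    qed
    then show ?thesis by blast
  qed
  obtain p where p: "p \<in> H" "conv s p" using cauchy_conv[of s] sH cau by blast
  have p_le: "(nrm (f - p))\<^sup>2 \<le> d"
  proof (rule LIMSEQ_le)
    have "conv (\<lambda>n. 1 *\<^sub>s f + (-1) *\<^sub>s s n) (1 *\<^sub>s f + (-1) *\<^sub>s p)"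
      using f sH p by (intro conv_lin) auto
    then have "conv (\<lambda>n. f - s n) (f - p)" by simp
    then show "(\<lambda>n. (nrm (f - s n))\<^sup>2) \<longlonglongrightarrow> (nrm (f - p))\<^sup>2"
      using f sH p by (intro tendsto_power conv_nrm) auto
    show "(\<lambda>n. d + 1 / real (Suc n)) \<longlonglongrightarrow> d"
      using tendsto_add[OF tendsto_const[of d] LIMSEQ_inverse_real_of_nat] by (simp add: inverse_eq_divide)
    show "\<exists>N. \<forall>n\<ge>N. (nrm (f - s n))\<^sup>2 \<le> d + 1 / real (Suc n)" using s(2) less_imp_le by blast
  qed
  have p_ge: "d \<le> (nrm (f - p - y))\<^sup>2" if "y \<in> S" for y
  proof (rule LIMSEQ_le_const)
    have yH: "y \<in> H" using SD that by blast
    have "conv (\<lambda>n. 1 *\<^sub>s (f - y) + (-1) *\<^sub>s s n) (1 *\<^sub>s (f - y) + (-1) *\<^sub>s p)"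
      using f sH p yH by (intro conv_lin) auto
    then have "conv (\<lambda>n. f - (y + s n)) (f - p - y)" by (simp add: algebra_simps)
    then show "(\<lambda>n. (nrm (f - (y + s n)))\<^sup>2) \<longlonglongrightarrow> (nrm (f - p - y))\<^sup>2"
      using f sH p yH by (intro tendsto_power conv_nrm) auto
    show "\<exists>N. \<forall>n\<ge>N. d \<le> (nrm (f - (y + s n)))\<^sup>2" using d_le[OF SD(3)[OF that s(1)]] by blast
  qed
  have "ip (f - p) y = 0" if y: "y \<in> S" for y
  proof -
    define c where "c = (cmod (ip (f - p) y))\<^sup>2"
    \<comment> \<open>Moving from \<open>p\<close> along \<open>y\<close> cannot decrease the
      squared distance to \<open>f\<close>, so the term linear in t is dominated by the quadratic
      one.\<close>
    have "2 * c * t \<le> (c * (nrm y)\<^sup>2) * t\<^sup>2" for t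
      using p_le p_ge[of "(of_real t * ip (f - p) y) *\<^sub>s y"] y SD
        nrm_sq_sub_scaled[of "f - p" y t] f p by (simp add: c_def mult_ac)
    then have "2 * c = 0" by (intro linear_le_quadratic_imp_zero) (auto simp: c_def)
    then show ?thesis by (simp add: c_def)
  qed
  then show ?thesis using that s p by blast
qed

text \<open>The residual of the projection onto \<open>S\<close> is orthogonal to \<open>S\<close>,
  hence null, so the approximating sequence already converges to \<open>f\<close>.\<close>

lemma dense_of_trivial_complement:
  assumes S: "csub S" and f: "f \<in> H" and triv: "\<And>h. h \<in> H \<Longrightarrow> (\<And>y. y \<in> S \<Longrightarrow> ip y h = 0) \<Longrightarrow> h \<doteq> 0"
  obtains s where "\<And>n::nat. s n \<in> S" "conv s f"
proof -
  obtain s p where sp: "\<And>n::nat. s n \<in> S" "p \<in> H" "conv s p" "\<And>y. y \<in> S \<Longrightarrow> ip (f - p) y = 0"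
    using projection[OF S f] by blast
  have sH: "s n \<in> H" for n using sp csubD[OF S] by blast
  have "f - p \<doteq> 0"
  proof (rule triv)
    show "f - p \<in> H" using f sp by simp
    show "ip y (f - p) = 0" if "y \<in> S" for y
      using sp(4)[OF that] ip_cnj[of "f - p" y] csubD(1)[OF S that] f sp(2) by simp
  qed
  then have "nrm (p - f) = 0" using f sp nrm_minus_commute[of p f] by (simp add: eqn_zero_iff)
  then have "nrm (s n - f) \<le> nrm (s n - p)" for n
    using nrm_triangle_diff[OF sH sp(2) f] by simp
  then have "conv s f" unfolding conv_def
    by (intro Lim_null_comparison[OF _ sp(3)[unfolded conv_def]]) (simp add: f sH)
  then show ?thesis using that sp(1) by blast
qed

text \<open>The representing vector is a multiple of the residual of some \<open>x0\<close> outside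
  the kernel of \<open>L\<close>. Boundedness makes \<open>L\<close> vanish at the foot of the
  projection, although that foot is only a limit of kernel elements.\<close>

lemma riesz:
  assumes add: "\<And>x y a b. x \<in> H \<Longrightarrow> y \<in> H \<Longrightarrow> L (a *\<^sub>s x + b *\<^sub>s y) = a * L x + b * L y"
    and bd: "\<And>x. x \<in> H \<Longrightarrow> cmod (L x) \<le> C * nrm x"
  obtains g where "g \<in> H" "\<And>x. x \<in> H \<Longrightarrow> L x = ip x g"
proof (cases "\<forall>x\<in>H. L x = 0")
  case True
  then show ?thesis using that[of 0] by simp
next
  case False
  then obtain x0 where x0: "x0 \<in> H" "L x0 \<noteq> 0" by blast
  define S where "S = {x\<in>H. L x = 0}"
  have L0: "L 0 = 0" using add[of 0 0 0 0] by simp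
  have S: "csub S" unfolding csub_def S_def using L0 add by simp
  obtain s p where sp: "\<And>n::nat. s n \<in> S" "p \<in> H" "conv s p" "\<And>y. y \<in> S \<Longrightarrow> ip (x0 - p) y = 0"
    using projection[OF S x0(1)] by blast
  have sH: "s n \<in> H" for n using sp csubD[OF S] by blast
  have Ld: "L (x - y) = L x - L y" if "x \<in> H" "y \<in> H" for x y
    using add[OF that, of 1 "-1"] by simp
  have "(\<lambda>n. L (s n - p)) \<longlonglongrightarrow> 0"
  proof (rule Lim_null_comparison)
    show "\<forall>\<^sub>F n in sequentially. norm (L (s n - p)) \<le> C * nrm (s n - p)" using bd sH sp by simp
    show "(\<lambda>n. C * nrm (s n - p)) \<longlonglongrightarrow> 0"
      using sp(3) unfolding conv_def by (rule tendsto_mult_right_zero)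
  qed
  moreover have "L (s n - p) = - L p" for n using Ld sH sp(1)[of n] sp(2) by (simp add: S_def)
  ultimately have Lp: "L p = 0" by (simp add: LIMSEQ_const_iff)
  define e where "e = x0 - p"
  have eH: "e \<in> H" using x0 sp by (simp add: e_def)
  have Le: "L e \<noteq> 0" using Ld x0 sp Lp by (simp add: e_def)
  have ne: "nrm e \<noteq> 0" using bd[OF eH] Le by auto
  \<comment> \<open>Scaled so that \<open>ip e g = L e\<close>.\<close>
  define g where "g = (cnj (L e) / of_real ((nrm e)\<^sup>2)) *\<^sub>s e"
  have gH: "g \<in> H" using eH by (simp add: g_def)
  have "L x = ip x g" if x: "x \<in> H" for x
  proof -
    \<comment> \<open>Removing the right multiple of \<open>e\<close> from \<open>x\<close> leaves a
      kernel element, which is orthogonal to \<open>e\<close>.\<close>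
    have "1 *\<^sub>s x + (- (L x / L e)) *\<^sub>s e \<in> S"
      unfolding S_def using x eH add[OF x eH, of 1 "- (L x / L e)"] Le by simp
    then have "ip e (1 *\<^sub>s x + (- (L x / L e)) *\<^sub>s e) = 0" using sp(4) by (simp add: e_def)
    then have "ip e x = cnj (L x / L e) * ip e e" using x eH by (simp add: ip_lin)
    then have "ip x e = (L x / L e) * ip e e" using ip_cnj[of e x] ip_cnj[of e e] x eH by simp
    then show ?thesis using x eH ne Le by (simp add: g_def ip_lin ip_self)
  qed
  then show ?thesis using that gH by blast
qed

section \<open>Contractions: isometries, adjoint values, extension from a subspace\<close>

text \<open>\<open>K\<close> acts on representatives: it has to respect null differences, and its
  linearity is asked only modulo them.\<close>

definition contr :: "('a \<Rightarrow> 'a) \<Rightarrow> bool" where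
  "contr K \<longleftrightarrow> (\<forall>f\<in>H. K f \<in> H) \<and> (\<forall>f\<in>H. \<forall>g\<in>H. f \<doteq> g \<longrightarrow> K f \<doteq> K g) \<and>
    (\<forall>f\<in>H. \<forall>g\<in>H. \<forall>a b. K (a *\<^sub>s f + b *\<^sub>s g) \<doteq> a *\<^sub>s K f + b *\<^sub>s K g) \<and>
    (\<forall>f\<in>H. nrm (K f) \<le> nrm f)"

lemma contrD:
  assumes "contr K"
  shows "f \<in> H \<Longrightarrow> K f \<in> H" "f \<doteq> g \<Longrightarrow> f \<in> H \<Longrightarrow> g \<in> H \<Longrightarrow> K f \<doteq> K g"
    "f \<in> H \<Longrightarrow> g \<in> H \<Longrightarrow> K (a *\<^sub>s f + b *\<^sub>s g) \<doteq> a *\<^sub>s K f + b *\<^sub>s K g"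
    "f \<in> H \<Longrightarrow> nrm (K f) \<le> nrm f"
  using assms by (auto simp: contr_def)

text \<open>Polarisation: comparing the norms of f + a g and of its image gives equal real parts for
  a = 1 and equal imaginary parts for a = i.\<close>

lemma isometry_ip:
  assumes K: "contr K" and iso: "\<And>f. f \<in> H \<Longrightarrow> nrm (K f) = nrm f" and fg: "f \<in> H" "g \<in> H"
  shows "ip (K f) (K g) = ip f g"
proof -
  note KD = contrD[OF K]
  have *: "Re (cnj a * ip (K f) (K g)) = Re (cnj a * ip f g)" for a
  proof -
    have "nrm (1 *\<^sub>s K f + a *\<^sub>s K g) = nrm (K (1 *\<^sub>s f + a *\<^sub>s g))"
      by (rule eqn_nrm[OF eqn_sym[OF KD(3)]]) (use fg KD(1) in auto)
    also have "\<dots> = nrm (1 *\<^sub>s f + a *\<^sub>s g)" using fg by (intro iso) auto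
    finally have "nrm (K f + a *\<^sub>s K g) = nrm (f + a *\<^sub>s g)" by simp
    then have "(nrm (K f + a *\<^sub>s K g))\<^sup>2 = (nrm (f + a *\<^sub>s g))\<^sup>2" by simp
    then show ?thesis using fg KD(1) iso
      by (simp add: nrm_sq_add nrm_scale ip_scale_right)
  qed
  from *[of 1] *[of \<i>] show ?thesis by (simp add: complex_eq_iff)
qed

text \<open>The Riesz theorem yields the adjoint of \<open>K\<close> one value at a time, which is
  all that is used later.\<close>

lemma contr_adjoint:
  assumes K: "contr K" and g: "g \<in> H"
  obtains k where "k \<in> H" "\<And>f. f \<in> H \<Longrightarrow> ip (K f) g = ip f k"
proof (rule riesz[of "\<lambda>f. ip (K f) g" "nrm g"])
  fix x y a b assume xy: "x \<in> H" "y \<in> H"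
  have "ip (K (a *\<^sub>s x + b *\<^sub>s y)) g = ip (a *\<^sub>s K x + b *\<^sub>s K y) g"
    using K xy g unfolding contr_def by (intro eqn_ip_left) auto
  then show "ip (K (a *\<^sub>s x + b *\<^sub>s y)) g = a * ip (K x) g + b * ip (K y) g"
    using K xy g unfolding contr_def by (simp add: ip_lin)
next
  fix x assume x: "x \<in> H"
  then have "cmod (ip (K x) g) \<le> nrm (K x) * nrm g" using K g unfolding contr_def
    by (intro cauchy_schwarz) auto
  also have "\<dots> \<le> nrm x * nrm g" using K x g unfolding contr_def by (intro mult_right_mono) auto
  finally show "cmod (ip (K x) g) \<le> nrm g * nrm x" by (simp add: mult.commute)
qed (use that in blast)

text \<open>Extension by continuity to the closure of the domain of \<open>R\<close> and by zero on
  the orthogonal complement; neither step increases the norm.\<close>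

lemma contraction_extension:
  assumes RH: "R \<subseteq> H \<times> H" and R0: "(0, 0) \<in> R"
    and Rlin: "\<And>x y x' y' a b. (x, y) \<in> R \<Longrightarrow> (x', y') \<in> R \<Longrightarrow> (a *\<^sub>s x + b *\<^sub>s x', a *\<^sub>s y + b *\<^sub>s y') \<in> R"
    and Rc: "\<And>x y. (x, y) \<in> R \<Longrightarrow> nrm y \<le> nrm x"
  obtains K where "contr K" "\<And>x y. (x, y) \<in> R \<Longrightarrow> K x \<doteq> y"
proof -
  define S where "S = Domain R"
  have S: "csub S" unfolding csub_def S_def using RH R0 Rlin by fast
  \<comment> \<open>\<open>p\<close> is the projection of \<open>f\<close> onto the closure of
    \<open>S\<close>, and \<open>k\<close> the limit of values along a sequence reaching
    \<open>p\<close>. As a relation this can be checked for linearity and the norm bound before any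
    value is chosen; single-valuedness modulo null vectors follows from these two.\<close>
  define B where "B = {(f, k). f \<in> H \<and> k \<in> H \<and> (\<exists>s y p. (\<forall>n. (s n, y n) \<in> R) \<and> p \<in> H \<and> conv s p \<and>
      conv y k \<and> (\<forall>x\<in>S. ip (f - p) x = 0))}"
  have tot: "\<exists>k. (f, k) \<in> B" if f: "f \<in> H" for f
  proof -
    obtain s p where sp: "\<And>n::nat. s n \<in> S" "p \<in> H" "conv s p" "\<And>y. y \<in> S \<Longrightarrow> ip (f - p) y = 0"
      using projection[OF S f] by blast
    have "\<forall>n. \<exists>y. (s n, y) \<in> R" using sp(1) by (auto simp: S_def)
    then obtain y where y: "\<And>n. (s n, y n) \<in> R" by metis
    have sH: "s n \<in> H" "y n \<in> H" for n using y RH by auto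
    have le: "nrm (y m - y n) \<le> nrm (s m - s n)" for m n
      using Rc[OF Rlin[OF y y, of 1 m "-1" n]] by simp
    have "\<exists>N. \<forall>m\<ge>N. \<forall>n\<ge>N. nrm (y m - y n) < e" if "e > 0" for e
      using conv_cauchy[OF sp(3) sH(1) sp(2) that] le by (meson le_less_trans)
    then obtain k where "k \<in> H" "conv y k" using cauchy_conv[of y] sH by blast
    then show ?thesis using f sp y unfolding B_def by blast
  qed
  have BH: "f \<in> H" "k \<in> H" if "(f, k) \<in> B" for f k using that unfolding B_def by auto
  have Bc: "nrm k \<le> nrm f" if fk: "(f, k) \<in> B" for f k
  proof -
    obtain s y p where a: "f \<in> H" "k \<in> H" "\<And>n. (s n, y n) \<in> R" "p \<in> H" "conv s p" "conv y k"
      "\<And>x. x \<in> S \<Longrightarrow> ip (f - p) x = 0" using fk unfolding B_def by blast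
    have sH: "s n \<in> H" "y n \<in> H" "s n \<in> S" for n using a(3) RH by (auto simp: S_def)
    have "nrm k \<le> nrm p"
      by (rule LIMSEQ_le[OF conv_nrm conv_nrm]) (use a sH Rc in blast)+
    moreover have "nrm p \<le> nrm f"
    proof -
      \<comment> \<open>\<open>f - p\<close> is orthogonal to \<open>S\<close>, hence to the limit
        \<open>p\<close>, so \<open>p\<close> is no longer than \<open>f\<close>.\<close>
      have "(\<lambda>n. ip (s n) (f - p)) \<longlonglongrightarrow> ip p (f - p)" using a sH by (intro conv_ip_left) auto
      moreover have "ip (s n) (f - p) = 0" for n using a(7)[OF sH(3)] ip_cnj[of "f - p" "s n"] a sH by simp
      ultimately have "ip p (f - p) = 0" by (simp add: LIMSEQ_const_iff)
      then have "(nrm p)\<^sup>2 = Re (ip p f)" using a by (simp add: ip_lin nrm_sq)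
      also have "\<dots> \<le> nrm p * nrm f"
        using cauchy_schwarz[of p f] a complex_Re_le_cmod order_trans by blast
      finally show ?thesis using a(1,4)
        by (metis mult_le_cancel_left_pos nrm_nonneg order_le_less power2_eq_square)
    qed
    ultimately show ?thesis by simp
  qed
  have Blin: "(a *\<^sub>s f + b *\<^sub>s f', a *\<^sub>s k + b *\<^sub>s k') \<in> B" if fk: "(f, k) \<in> B" "(f', k') \<in> B" for f k f' k' a b
  proof -
    obtain s y p where A: "f \<in> H" "k \<in> H" "\<And>n. (s n, y n) \<in> R" "p \<in> H" "conv s p" "conv y k"
      "\<And>x. x \<in> S \<Longrightarrow> ip (f - p) x = 0" using fk(1) unfolding B_def by blast
    obtain s' y' p' where A': "f' \<in> H" "k' \<in> H" "\<And>n. (s' n, y' n) \<in> R" "p' \<in> H" "conv s' p'" "conv y' k'"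
      "\<And>x. x \<in> S \<Longrightarrow> ip (f' - p') x = 0" using fk(2) unfolding B_def by blast
    have sH: "s n \<in> H" "y n \<in> H" "s' n \<in> H" "y' n \<in> H" for n using A(3) A'(3) RH by auto
    have e: "a *\<^sub>s f + b *\<^sub>s f' - (a *\<^sub>s p + b *\<^sub>s p') = a *\<^sub>s (f - p) + b *\<^sub>s (f' - p')"
      by (simp add: scale_right_diff_distrib)
    show ?thesis unfolding B_def mem_Collect_eq prod.case
    proof (intro conjI exI)
      show "\<forall>n. (a *\<^sub>s s n + b *\<^sub>s s' n, a *\<^sub>s y n + b *\<^sub>s y' n) \<in> R" using Rlin A(3) A'(3) by blast
      show "conv (\<lambda>n. a *\<^sub>s s n + b *\<^sub>s s' n) (a *\<^sub>s p + b *\<^sub>s p')" using A A' sH by (intro conv_lin) auto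
      show "conv (\<lambda>n. a *\<^sub>s y n + b *\<^sub>s y' n) (a *\<^sub>s k + b *\<^sub>s k')" using A A' sH by (intro conv_lin) auto
      show "\<forall>x\<in>S. ip (a *\<^sub>s f + b *\<^sub>s f' - (a *\<^sub>s p + b *\<^sub>s p')) x = 0"
        unfolding e using A A' csubD(1)[OF S] by (simp add: ip_add_left ip_scale_left)
    qed (use A A' in auto)
  qed
  have RB: "(x, y) \<in> B" if "(x, y) \<in> R" for x y
    unfolding B_def mem_Collect_eq prod.case
    by (intro conjI exI[of _ "\<lambda>_. x"] exI[of _ "\<lambda>_. y"] exI[of _ x]) (use that RH csubD(1)[OF S] in auto)
  have Bdiff: "nrm (k - k') \<le> nrm (f - f')" if "(f, k) \<in> B" "(f', k') \<in> B" for f k f' k'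
    using Bc[OF Blin[OF that, of 1 "-1"]] by simp
  define K where "K f = (SOME k. (f, k) \<in> B)" for f
  have K: "(f, K f) \<in> B" if "f \<in> H" for f using tot[OF that] unfolding K_def by (rule someI_ex)
  have uni: "k \<doteq> k'" if "(f, k) \<in> B" "(f', k') \<in> B" "f \<doteq> f'" for f f' k k'
    using Bdiff[OF that(1,2)] that(3) BH[OF that(1)] BH[OF that(2)] nrm_nonneg[of "k - k'"]
    unfolding eqn_def by (metis diff_mem order_antisym)
  have "contr K" unfolding contr_def
  proof (intro conjI ballI allI impI)
    show "K f \<in> H" "nrm (K f) \<le> nrm f" if "f \<in> H" for f using BH[OF K] Bc[OF K] that by auto
    show "K f \<doteq> K g" if "f \<in> H" "g \<in> H" "f \<doteq> g" for f g using uni K that by blast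
    show "K (a *\<^sub>s f + b *\<^sub>s g) \<doteq> a *\<^sub>s K f + b *\<^sub>s K g" if "f \<in> H" "g \<in> H" for f g a b
      using uni[OF K Blin[OF K K]] that by simp
  qed
  moreover have "K x \<doteq> y" if "(x, y) \<in> R" for x y
  proof -
    have "x \<in> H" using that RH by auto
    then show ?thesis using uni[OF K RB[OF that]] by simp
  qed
  ultimately show ?thesis using that by blast
qed

no_notation eqn (infix "\<doteq>" 50)

section \<open>Operators as graphs: dissipativity and adjoints\<close>

definition unit :: "('a \<Rightarrow> 'a) \<Rightarrow> bool" where
  "unit K \<longleftrightarrow> contr K \<and> (\<forall>f\<in>H. nrm (K f) = nrm f) \<and> (\<forall>g\<in>H. \<exists>f\<in>H. eqn (K f) g)"

definition isop :: "('a \<times> 'a) set \<Rightarrow> bool" where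
  "isop T \<longleftrightarrow> (\<forall>(u, w)\<in>T. u \<in> H \<and> w \<in> H) \<and>
    (\<forall>u w u' w'. (u, w) \<in> T \<and> u' \<in> H \<and> w' \<in> H \<and> eqn u u' \<and> eqn w w' \<longrightarrow> (u', w') \<in> T) \<and>
    (\<forall>u w w'. (u, w) \<in> T \<and> (u, w') \<in> T \<longrightarrow> eqn w w') \<and>
    (\<forall>u w u' w' a b. (u, w) \<in> T \<and> (u', w') \<in> T \<longrightarrow>
      (a *\<^sub>s u + b *\<^sub>s u', a *\<^sub>s w + b *\<^sub>s w') \<in> T)"

text \<open>\<open>(u, f + z *\<^sub>s u) \<in> T\<close> says (T - z) u = f. The clauses are
  surjectivity of T - z and the resolvent bound, which also yields injectivity modulo null
  vectors.\<close>

definition mdiss :: "('a \<times> 'a) set \<Rightarrow> bool" where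
  "mdiss T \<longleftrightarrow> (\<forall>z. Im z > 0 \<longrightarrow> (\<forall>f\<in>H. \<exists>u. (u, f + z *\<^sub>s u) \<in> T) \<and>
    (\<forall>u f. f \<in> H \<and> (u, f + z *\<^sub>s u) \<in> T \<longrightarrow> nrm u \<le> nrm f / Im z))"

definition adjoint :: "('a \<times> 'a) set \<Rightarrow> ('a \<times> 'a) set" where
  "adjoint T = {(v, w). v \<in> H \<and> w \<in> H \<and> (\<forall>u z. (u, z) \<in> T \<longrightarrow> ip z v = ip u w)}"

definition selfadj :: "('a \<times> 'a) set \<Rightarrow> bool" where
  "selfadj T \<longleftrightarrow> (\<forall>f\<in>H. \<forall>e>0. \<exists>u w. (u, w) \<in> T \<and> nrm (u - f) < e) \<and> T = adjoint T"

lemma isopD: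
  assumes "isop T"
  shows "(u, w) \<in> T \<Longrightarrow> u \<in> H" "(u, w) \<in> T \<Longrightarrow> w \<in> H"
    "(u, w) \<in> T \<Longrightarrow> u' \<in> H \<Longrightarrow> w' \<in> H \<Longrightarrow> eqn u u' \<Longrightarrow> eqn w w' \<Longrightarrow> (u', w') \<in> T"
    "(u, w) \<in> T \<Longrightarrow> (u', w') \<in> T \<Longrightarrow> (a *\<^sub>s u + b *\<^sub>s u', a *\<^sub>s w + b *\<^sub>s w') \<in> T"
proof -
  from assms have *: "(u, w) \<in> T \<Longrightarrow> u \<in> H \<and> w \<in> H" unfolding isop_def by blast
  then show "(u, w) \<in> T \<Longrightarrow> u \<in> H" "(u, w) \<in> T \<Longrightarrow> w \<in> H" by blast+
  show "(u, w) \<in> T \<Longrightarrow> u' \<in> H \<Longrightarrow> w' \<in> H \<Longrightarrow> eqn u u' \<Longrightarrow> eqn w w' \<Longrightarrow> (u', w') \<in> T"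
    using assms unfolding isop_def by meson
  show "(u, w) \<in> T \<Longrightarrow> (u', w') \<in> T \<Longrightarrow> (a *\<^sub>s u + b *\<^sub>s u', a *\<^sub>s w + b *\<^sub>s w') \<in> T"
    using assms unfolding isop_def by meson
qed

text \<open>Im (w - z u | u) equals Im (w | u) minus Im z times the squared norm of
  \<open>u\<close>; Cauchy-Schwarz bounds its modulus from above.\<close>

lemma dissipative_bound:
  assumes uw: "u \<in> H" "w \<in> H" and im: "Im (ip w u) \<le> 0" and z: "Im z > 0"
  shows "Im z * nrm u \<le> nrm (w - z *\<^sub>s u)"
proof (cases "nrm u = 0")
  case False
  then have pos: "nrm u > 0" using uw nrm_nonneg[of u] by linarith
  have "Im (ip (w - z *\<^sub>s u) u) = Im (ip w u) - Im z * (nrm u)\<^sup>2"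
    using uw by (simp add: ip_diff_left ip_scale_left ip_self)
  then have "Im z * (nrm u)\<^sup>2 \<le> \<bar>Im (ip (w - z *\<^sub>s u) u)\<bar>" using im by linarith
  also have "\<dots> \<le> cmod (ip (w - z *\<^sub>s u) u)" by (rule abs_Im_le_cmod)
  also have "\<dots> \<le> nrm (w - z *\<^sub>s u) * nrm u" using uw by (intro cauchy_schwarz) auto
  finally show ?thesis using pos by (simp add: power2_eq_square)
qed (use uw in simp)

text \<open>The resolvent bound at z = i t, squared and expanded, reads 2 t Im (w | u) \<le> |w|^2
  once the terms t^2 |u|^2 cancel; large t decides the sign.\<close>

lemma mdiss_Im_le:
  assumes T: "isop T" "mdiss T" and uw: "(u, w) \<in> T"
  shows "Im (ip w u) \<le> 0"
proof (rule ccontr)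
  assume "\<not> ?thesis"
  then have pos: "Im (ip w u) > 0" by simp
  have H: "u \<in> H" "w \<in> H" using isopD[OF T(1)] uw by blast+
  have *: "2 * t * Im (ip w u) \<le> (nrm w)\<^sup>2" if t: "t > 0" for t :: real
  proof -
    define z where "z = \<i> * complex_of_real t"
    have "w - z *\<^sub>s u \<in> H" "(u, (w - z *\<^sub>s u) + z *\<^sub>s u) \<in> T" "Im z > 0"
      using uw t H by (auto simp: z_def)
    then have "nrm u \<le> nrm (w - z *\<^sub>s u) / Im z"
      using T(2) unfolding mdiss_def by blast
    then have "t * nrm u \<le> nrm (w - z *\<^sub>s u)" using t by (simp add: z_def field_simps)
    then have "(t * nrm u)\<^sup>2 \<le> (nrm (w - z *\<^sub>s u))\<^sup>2" using t H by (intro power_mono) auto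
    also have "\<dots> = (nrm w)\<^sup>2 - 2 * t * Im (ip w u) + (t * nrm u)\<^sup>2"
      using H t by (simp add: nrm_sq_diff ip_scale_right nrm_scale z_def norm_mult)
    finally show ?thesis by simp
  qed
  define t where "t = ((nrm w)\<^sup>2 + 1) / (2 * Im (ip w u))"
  have "t > 0" using pos by (auto simp: t_def add_nonneg_pos)
  from *[OF this] show False using pos by (simp add: t_def)
qed

end

section \<open>Extensions defined by boundary conditions\<close>

text \<open>\<open>D\<close> and \<open>A\<close> describe the adjoint of \<open>M0\<close>. In the
  application \<open>A\<close>, \<open>P\<close> and \<open>Q\<close> come from choice operators, so
  no linearity is postulated. The condition \<open>onto\<close> is simultaneous for both boundary
  maps: they can be prescribed independently.\<close>

locale boundary_triple = X: semihilbert sX HX ipX + G: semihilbert sG HG ipG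
  for sX :: "complex \<Rightarrow> 'a::ab_group_add \<Rightarrow> 'a"  (infixr "*\<^sub>X" 75)
    and HX :: "'a set" and ipX :: "'a \<Rightarrow> 'a \<Rightarrow> complex"
    and sG :: "complex \<Rightarrow> 'b::ab_group_add \<Rightarrow> 'b"  (infixr "*\<^sub>G" 75)
    and HG :: "'b set" and ipG :: "'b \<Rightarrow> 'b \<Rightarrow> complex" +
  fixes D :: "'a set" and A :: "'a \<Rightarrow> 'a" and P Q :: "'a \<Rightarrow> 'b" and M0 :: "('a \<times> 'a) set"
  assumes D_sub: "u \<in> D \<Longrightarrow> u \<in> HX" and A_mem: "u \<in> D \<Longrightarrow> A u \<in> HX"
    and P_mem: "u \<in> D \<Longrightarrow> P u \<in> HG" and Q_mem: "u \<in> D \<Longrightarrow> Q u \<in> HG"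
    and green: "u \<in> D \<Longrightarrow> v \<in> D \<Longrightarrow>
      ipX (A u) v - ipX u (A v) = (\<i> / 2) * (ipG (P u) (P v) - ipG (Q u) (Q v))"
    and onto: "p \<in> HG \<Longrightarrow> q \<in> HG \<Longrightarrow> \<exists>u\<in>D. G.eqn (P u) p \<and> G.eqn (Q u) q"
    and maximal: "v \<in> HX \<Longrightarrow> w \<in> HX \<Longrightarrow> (\<And>u z. (u, z) \<in> M0 \<Longrightarrow> ipX z v = ipX u w) \<Longrightarrow>
      v \<in> D \<and> X.eqn w (A v)"
    and minimal: "(u, z) \<in> M0 \<Longrightarrow>
      u \<in> D \<and> z \<in> HX \<and> X.eqn z (A u) \<and> G.eqn (P u) 0 \<and> G.eqn (Q u) 0"
begin

lemmas mems [simp] = D_sub A_mem P_mem Q_mem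

lemma minimal_green:
  assumes "(p, q) \<in> M0" "u \<in> D" "w \<in> HX" "X.eqn w (A u)"
  shows "ipX q u = ipX p w"
proof -
  note m = minimal[OF assms(1)]
  have "ipG (P p) (P u) = 0" "ipG (Q p) (Q u) = 0"
    using G.eqn_ip_left[of "P p" 0 "P u"] G.eqn_ip_left[of "Q p" 0 "Q u"] m assms by auto
  then have "ipX (A p) u = ipX p (A u)" using green[of p u] m assms by simp
  moreover have "ipX q u = ipX (A p) u" using m assms by (intro X.eqn_ip_left) auto
  moreover have "ipX p w = ipX p (A u)" using m assms by (intro X.eqn_ip_right) auto
  ultimately show ?thesis by simp
qed

text \<open>Membership in the adjoint of \<open>M0\<close> is a linear condition, and
  \<open>maximal\<close> converts it back into membership in \<open>D\<close>.\<close>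

lemma D_lin:
  assumes "u \<in> D" "v \<in> D"
  shows "a *\<^sub>X u + b *\<^sub>X v \<in> D" "X.eqn (a *\<^sub>X A u + b *\<^sub>X A v) (A (a *\<^sub>X u + b *\<^sub>X v))"
proof -
  have "a *\<^sub>X u + b *\<^sub>X v \<in> D \<and> X.eqn (a *\<^sub>X A u + b *\<^sub>X A v) (A (a *\<^sub>X u + b *\<^sub>X v))"
  proof (rule maximal)
    fix p q assume pq: "(p, q) \<in> M0"
    have "ipX q u = ipX p (A u)" "ipX q v = ipX p (A v)"
      using minimal_green[OF pq] assms by auto
    then show "ipX q (a *\<^sub>X u + b *\<^sub>X v) = ipX p (a *\<^sub>X A u + b *\<^sub>X A v)"
      using minimal[OF pq] assms by (simp add: X.ip_add_right X.ip_scale_right)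
  qed (use assms in auto)
  then show "a *\<^sub>X u + b *\<^sub>X v \<in> D" "X.eqn (a *\<^sub>X A u + b *\<^sub>X A v) (A (a *\<^sub>X u + b *\<^sub>X v))" by auto
qed

lemma zero_D: "0 \<in> D"
  using maximal[of 0 0] minimal by auto

text \<open>By \<open>onto\<close> the pairs (P v, Q v) reach every pair in \<open>HG\<close> modulo
  null vectors, so the boundary form of \<open>u\<close> determines P u and Q u. Linearity and
  congruence of the boundary maps both come from here.\<close>

lemma boundary_eqI:
  assumes u: "u \<in> D" and pq: "p \<in> HG" "q \<in> HG"
    and eq: "\<And>v. v \<in> D \<Longrightarrow> ipX (A u) v - ipX u (A v) = (\<i> / 2) * (ipG p (P v) - ipG q (Q v))"
  shows "G.eqn (P u) p" "G.eqn (Q u) q"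
proof -
  have *: "ipG (P u - p) r = ipG (Q u - q) s" if rs: "r \<in> HG" "s \<in> HG" for r s
  proof -
    obtain v where v: "v \<in> D" "G.eqn (P v) r" "G.eqn (Q v) s" using onto[OF rs] by blast
    have "ipG (P u) (P v) - ipG (Q u) (Q v) = ipG p (P v) - ipG q (Q v)"
      using green[OF u v(1)] eq[OF v(1)] by simp
    then have "ipG (P u - p) (P v) = ipG (Q u - q) (Q v)"
      using u v pq by (simp add: G.ip_diff_left algebra_simps)
    moreover have "ipG (P u - p) (P v) = ipG (P u - p) r" using u v pq rs by (intro G.eqn_ip_right) auto
    moreover have "ipG (Q u - q) (Q v) = ipG (Q u - q) s" using u v pq rs by (intro G.eqn_ip_right) auto
    ultimately show ?thesis by simp
  qed
  have "ipG (P u) r = ipG p r" if "r \<in> HG" for r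
    using *[OF that, of 0] u pq that by (simp add: G.ip_diff_left)
  then show "G.eqn (P u) p" using u pq by (simp add: G.eqn_iff_ip)
  have "ipG (Q u) r = ipG q r" if "r \<in> HG" for r
    using *[of 0, OF _ that] u pq that by (simp add: G.ip_diff_left)
  then show "G.eqn (Q u) q" using u pq by (simp add: G.eqn_iff_ip)
qed

lemma boundary_lin:
  assumes u: "u \<in> D" and v: "v \<in> D"
  shows "G.eqn (P (a *\<^sub>X u + b *\<^sub>X v)) (a *\<^sub>G P u + b *\<^sub>G P v)"
    and "G.eqn (Q (a *\<^sub>X u + b *\<^sub>X v)) (a *\<^sub>G Q u + b *\<^sub>G Q v)"
proof -
  let ?c = "a *\<^sub>X u + b *\<^sub>X v"
  have c: "?c \<in> D" using D_lin u v by blast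
  have *: "ipX (A ?c) w - ipX ?c (A w) = (\<i> / 2) * (ipG (a *\<^sub>G P u + b *\<^sub>G P v) (P w) - ipG (a *\<^sub>G Q u + b *\<^sub>G Q v) (Q w))"
    if w: "w \<in> D" for w
  proof -
    have "ipX (A ?c) w = ipX (a *\<^sub>X A u + b *\<^sub>X A v) w"
      using D_lin[OF u v] u v w by (intro X.eqn_ip_left[symmetric]) auto
    also have "\<dots> = a * ipX (A u) w + b * ipX (A v) w"
      using u v w by (simp add: X.ip_add_left X.ip_scale_left)
    finally have "ipX (A ?c) w - ipX ?c (A w)
        = a * (ipX (A u) w - ipX u (A w)) + b * (ipX (A v) w - ipX v (A w))"
      using u v w by (simp add: X.ip_add_left X.ip_scale_left algebra_simps)
    then show ?thesis unfolding green[OF u w] green[OF v w]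
      using u v w by (simp add: G.ip_add_left G.ip_scale_left algebra_simps)
  qed
  show "G.eqn (P ?c) (a *\<^sub>G P u + b *\<^sub>G P v)" "G.eqn (Q ?c) (a *\<^sub>G Q u + b *\<^sub>G Q v)"
    by (rule boundary_eqI[OF c _ _ *]; use u v in auto)+
qed

text \<open>Adjoint pairs of \<open>M0\<close> and the left side of Green's identity depend only on
  the class of \<open>u\<close>, hence so do the domain, the operator and the boundary
  values.\<close>

lemma boundary_cong:
  assumes u: "u \<in> D" and u': "u' \<in> HX" "X.eqn u u'"
  shows "u' \<in> D" "X.eqn (A u) (A u')" "G.eqn (P u') (P u)" "G.eqn (Q u') (Q u)"
proof -
  have "u' \<in> D \<and> X.eqn (A u) (A u')"
  proof (rule maximal)
    fix p q assume pq: "(p, q) \<in> M0"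
    have "ipX q u' = ipX q u" using u u' minimal[OF pq] X.eqn_ip_right[of u u' q] by simp
    then show "ipX q u' = ipX p (A u)" using minimal_green[OF pq u] u by simp
  qed (use u u' in auto)
  then show D: "u' \<in> D" and A: "X.eqn (A u) (A u')" by auto
  have *: "ipX (A u') v - ipX u' (A v) = (\<i> / 2) * (ipG (P u) (P v) - ipG (Q u) (Q v))" if "v \<in> D" for v
    using green[OF u that] X.eqn_ip_left[OF A, of v] X.eqn_ip_left[OF u'(2), of "A v"] u u' D that by simp
  show "G.eqn (P u') (P u)" "G.eqn (Q u') (Q u)"
    by (rule boundary_eqI[OF D _ _ *]; use u in auto)+
qed

text \<open>For v = u the left side of Green's identity is 2 i Im (A u | u), which turns the factor
  i/2 into 1/4.\<close>

lemma Im_A: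
  assumes "u \<in> D"
  shows "Im (ipX (A u) u) = ((G.nrm (P u))\<^sup>2 - (G.nrm (Q u))\<^sup>2) / 4"
proof -
  have "ipX (A u) u - ipX u (A u) = (\<i> / 2) * complex_of_real ((G.nrm (P u))\<^sup>2 - (G.nrm (Q u))\<^sup>2)"
    using green[OF assms assms] assms by (simp add: G.ip_self)
  from arg_cong[OF this, of Im]
  have "Im (ipX (A u) u) - Im (ipX u (A u)) = ((G.nrm (P u))\<^sup>2 - (G.nrm (Q u))\<^sup>2) / 2"
    by simp
  moreover have "Im (ipX u (A u)) = - Im (ipX (A u) u)" using X.ip_cnj[of "A u" u] assms by simp
  ultimately show ?thesis by simp
qed

section \<open>Operators defined by contractive boundary conditions\<close>

definition BC :: "('b \<Rightarrow> 'b) \<Rightarrow> ('a \<times> 'a) set" where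
  "BC K = {(u, w). u \<in> D \<and> w \<in> HX \<and> X.eqn w (A u) \<and> G.eqn (P u) (K (Q u))}"

lemma minimal_BC:
  assumes K: "G.contr K" shows "M0 \<subseteq> BC K"
proof clarify
  fix u z assume uz: "(u, z) \<in> M0"
  note m = minimal[OF uz] and KD = G.contrD[OF K]
  have "G.nrm (Q u) = 0" using m by (simp add: G.eqn_zero_iff)
  then have "G.nrm (K (Q u)) \<le> 0" using KD(4)[of "Q u"] m by simp
  then have "G.eqn (K (Q u)) 0" using m KD(1) by (simp add: G.nrm_le_zero_iff)
  then have "G.eqn (P u) (K (Q u))"
    using m KD(1) G.eqn_trans[of "P u" 0 "K (Q u)"] G.eqn_sym[of "K (Q u)" 0] by simp
  then show "(u, z) \<in> BC K" using m by (simp add: BC_def)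
qed

lemma isop_BC:
  assumes K: "G.contr K" shows "X.isop (BC K)"
  unfolding X.isop_def
proof (intro conjI allI impI)
  note KD = G.contrD[OF K]
  show "\<forall>(u, w)\<in>BC K. u \<in> HX \<and> w \<in> HX" by (auto simp: BC_def)
next
  note KD = G.contrD[OF K]
  fix u w u' w' assume "(u, w) \<in> BC K \<and> u' \<in> HX \<and> w' \<in> HX \<and> X.eqn u u' \<and> X.eqn w w'"
  then have a: "u \<in> D" "w \<in> HX" "X.eqn w (A u)" "G.eqn (P u) (K (Q u))" "u' \<in> HX" "w' \<in> HX" "X.eqn u u'" "X.eqn w w'"
    by (auto simp: BC_def)
  note c = boundary_cong[OF a(1,5,7)]
  have "X.eqn w' w" using a X.eqn_sym[of w w'] by simp
  then have "X.eqn w' (A u)" using a by (intro X.eqn_trans[of w' w "A u"]) auto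
  then have 1: "X.eqn w' (A u')" using a c by (intro X.eqn_trans[of w' "A u" "A u'"]) auto
  have "G.eqn (K (Q u)) (K (Q u'))" using a c G.eqn_sym[of "Q u'" "Q u"] by (intro KD(2)) auto
  then have "G.eqn (P u) (K (Q u'))" using a c KD(1) by (intro G.eqn_trans[of "P u" "K (Q u)" "K (Q u')"]) auto
  then have 2: "G.eqn (P u') (K (Q u'))" using a c KD(1) by (intro G.eqn_trans[of "P u'" "P u" "K (Q u')"]) auto
  show "(u', w') \<in> BC K" using 1 2 c a by (simp add: BC_def)
next
  fix u w w' assume "(u, w) \<in> BC K \<and> (u, w') \<in> BC K"
  then have "u \<in> D" "w \<in> HX" "X.eqn w (A u)" "w' \<in> HX" "X.eqn w' (A u)" by (auto simp: BC_def)
  then show "X.eqn w w'" using X.eqn_trans[of w "A u" w'] X.eqn_sym[of w' "A u"] by simp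
next
  note KD = G.contrD[OF K]
  fix u w u' w' a b assume "(u, w) \<in> BC K \<and> (u', w') \<in> BC K"
  then have h: "u \<in> D" "w \<in> HX" "X.eqn w (A u)" "G.eqn (P u) (K (Q u))"
    "u' \<in> D" "w' \<in> HX" "X.eqn w' (A u')" "G.eqn (P u') (K (Q u'))" by (auto simp: BC_def)
  let ?c = "a *\<^sub>X u + b *\<^sub>X u'"
  have c: "?c \<in> D" using D_lin h by blast
  have "X.eqn (a *\<^sub>X w + b *\<^sub>X w') (a *\<^sub>X A u + b *\<^sub>X A u')" using h by (intro X.eqn_lin) auto
  then have 1: "X.eqn (a *\<^sub>X w + b *\<^sub>X w') (A ?c)"
    using h c D_lin(2)[of u u' a b] X.eqn_trans[of "a *\<^sub>X w + b *\<^sub>X w'" "a *\<^sub>X A u + b *\<^sub>X A u'" "A ?c"] by simp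
  have "G.eqn (P ?c) (a *\<^sub>G P u + b *\<^sub>G P u')" using h boundary_lin by simp
  moreover have "G.eqn (a *\<^sub>G P u + b *\<^sub>G P u') (a *\<^sub>G K (Q u) + b *\<^sub>G K (Q u'))"
    using h KD(1) by (intro G.eqn_lin) auto
  ultimately have "G.eqn (P ?c) (a *\<^sub>G K (Q u) + b *\<^sub>G K (Q u'))"
    using h c KD(1) G.eqn_trans[of "P ?c" "a *\<^sub>G P u + b *\<^sub>G P u'" "a *\<^sub>G K (Q u) + b *\<^sub>G K (Q u')"] by simp
  moreover have "G.eqn (a *\<^sub>G K (Q u) + b *\<^sub>G K (Q u')) (K (a *\<^sub>G Q u + b *\<^sub>G Q u'))"
    using h KD(1) G.eqn_sym[OF KD(3)[of "Q u" "Q u'" a b]] by simp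
  ultimately have "G.eqn (P ?c) (K (a *\<^sub>G Q u + b *\<^sub>G Q u'))"
    using h c KD(1) G.eqn_trans[of "P ?c" "a *\<^sub>G K (Q u) + b *\<^sub>G K (Q u')" "K (a *\<^sub>G Q u + b *\<^sub>G Q u')"] by simp
  moreover have "G.eqn (K (a *\<^sub>G Q u + b *\<^sub>G Q u')) (K (Q ?c))"
    using h c G.eqn_sym[OF boundary_lin(2)[of u u' a b]] by (intro KD(2)) auto
  ultimately have "G.eqn (P ?c) (K (Q ?c))"
    using h c KD(1) G.eqn_trans[of "P ?c" "K (a *\<^sub>G Q u + b *\<^sub>G Q u')" "K (Q ?c)"] by simp
  then show "(a *\<^sub>X u + b *\<^sub>X u', a *\<^sub>X w + b *\<^sub>X w') \<in> BC K" using 1 c h by (simp add: BC_def)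
qed

lemma Im_BC:
  assumes K: "G.contr K" and uw: "(u, w) \<in> BC K"
  shows "Im (ipX w u) \<le> 0"
proof -
  have h: "u \<in> D" "w \<in> HX" "X.eqn w (A u)" "G.eqn (P u) (K (Q u))" using uw by (auto simp: BC_def)
  have "G.nrm (P u) \<le> G.nrm (Q u)"
    using G.eqn_nrm[OF h(4)] G.contrD[OF K] h by simp
  then have "(G.nrm (P u))\<^sup>2 \<le> (G.nrm (Q u))\<^sup>2" using h by (intro power_mono) auto
  moreover have "ipX w u = ipX (A u) u" using X.eqn_ip_left[OF h(3), of u] h by simp
  ultimately show ?thesis using Im_A[OF h(1)] by simp
qed

text \<open>Every \<open>q\<close> occurs as a boundary value Q u in the domain, so all values of
  \<open>K\<close> can be read off from the graph.\<close>

lemma BC_element: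
  assumes K: "G.contr K" and q: "q \<in> HG"
  obtains u where "u \<in> D" "(u, A u) \<in> BC K" "G.eqn (Q u) q" "G.eqn (P u) (K q)"
proof -
  note KD = G.contrD[OF K]
  obtain u where u: "u \<in> D" "G.eqn (P u) (K q)" "G.eqn (Q u) q" using onto[of "K q" q] KD q by blast
  have "G.eqn (K q) (K (Q u))" using u q G.eqn_sym[of "Q u" q] by (intro KD(2)) auto
  then have "G.eqn (P u) (K (Q u))" using u q KD(1) G.eqn_trans[of "P u" "K q" "K (Q u)"] by simp
  then show ?thesis using u that by (simp add: BC_def)
qed

text \<open>The boundary form between \<open>v\<close> and a domain element with Q u = g vanishes
  exactly when (K g | P v) = (g | Q v), and every \<open>g\<close> occurs. This says in weak form
  that the adjoint of \<open>K\<close> maps P v to Q v.\<close>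

lemma adjoint_BC:
  assumes K: "G.contr K"
  shows "(v, w) \<in> X.adjoint (BC K) \<longleftrightarrow>
    v \<in> D \<and> w \<in> HX \<and> X.eqn w (A v) \<and> (\<forall>g\<in>HG. ipG (K g) (P v) = ipG g (Q v))"
proof
  note KD = G.contrD[OF K]
  assume "(v, w) \<in> X.adjoint (BC K)"
  then have h: "v \<in> HX" "w \<in> HX" "\<And>u z. (u, z) \<in> BC K \<Longrightarrow> ipX z v = ipX u w"
    by (auto simp: X.adjoint_def)
  then have v: "v \<in> D" "X.eqn w (A v)" using maximal[of v w] minimal_BC[OF K] by blast+
  have "ipG (K g) (P v) = ipG g (Q v)" if g: "g \<in> HG" for g
  proof -
    obtain u where u: "u \<in> D" "(u, A u) \<in> BC K" "G.eqn (Q u) g" "G.eqn (P u) (K g)"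
      using BC_element[OF K g] by blast
    have "ipX (A u) v = ipX u (A v)"
      using h(3)[OF u(2)] X.eqn_ip_right[OF v(2), of u] u v h by simp
    then have "ipG (P u) (P v) = ipG (Q u) (Q v)" using green[OF u(1) v(1)] by simp
    then show ?thesis
      using G.eqn_ip_left[OF u(3), of "Q v"] G.eqn_ip_left[OF u(4), of "P v"] u v g KD(1) by simp
  qed
  then show "v \<in> D \<and> w \<in> HX \<and> X.eqn w (A v) \<and> (\<forall>g\<in>HG. ipG (K g) (P v) = ipG g (Q v))"
    using h v by blast
next
  note KD = G.contrD[OF K]
  assume h: "v \<in> D \<and> w \<in> HX \<and> X.eqn w (A v) \<and> (\<forall>g\<in>HG. ipG (K g) (P v) = ipG g (Q v))"
  have "ipX z v = ipX u w" if "(u, z) \<in> BC K" for u z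
  proof -
    have u: "u \<in> D" "z \<in> HX" "X.eqn z (A u)" "G.eqn (P u) (K (Q u))" using that by (auto simp: BC_def)
    have "ipG (P u) (P v) = ipG (Q u) (Q v)"
      using G.eqn_ip_left[OF u(4), of "P v"] u h KD(1) by simp
    then have "ipX (A u) v = ipX u (A v)" using green[of u v] u h by simp
    then show ?thesis using X.eqn_ip_left[OF u(3), of v] X.eqn_ip_right[of w "A v" u] u h by simp
  qed
  then show "(v, w) \<in> X.adjoint (BC K)" using h by (auto simp: X.adjoint_def)
qed

text \<open>The locale postulates no continuity of \<open>P\<close> and \<open>Q\<close>, so the
  boundary condition passes to the limit weakly, tested against elements of the adjoint.\<close>

lemma closed_BC:
  assumes K: "G.contr K" and s: "\<And>n. (u n, w n) \<in> BC K"
    and conv: "X.conv u u0" "X.conv w w0" and mem: "u0 \<in> HX" "w0 \<in> HX"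
  shows "(u0, w0) \<in> BC K"
proof -
  note KD = G.contrD[OF K]
  have h: "u n \<in> D" "w n \<in> HX" "X.eqn (w n) (A (u n))" "G.eqn (P (u n)) (K (Q (u n)))" for n
    using s[of n] by (auto simp: BC_def)
  have lim: "ipX w0 v = ipX u0 w'" if v: "v \<in> D" "w' \<in> HX" and eq: "\<And>n. ipX (w n) v = ipX (u n) w'" for v w'
  proof (rule LIMSEQ_unique)
    show "(\<lambda>n. ipX (w n) v) \<longlonglongrightarrow> ipX w0 v" using conv mem h v by (intro X.conv_ip_left) auto
    show "(\<lambda>n. ipX (w n) v) \<longlonglongrightarrow> ipX u0 w'" unfolding eq using conv mem h v by (intro X.conv_ip_left) auto
  qed
  have u0: "u0 \<in> D \<and> X.eqn w0 (A u0)"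
  proof (rule maximal[OF mem])
    fix p q assume pq: "(p, q) \<in> M0"
    note m = minimal[OF pq]
    have "ipX (w n) p = ipX (u n) q" for n
      using minimal_green[OF pq h(1) h(2) h(3)] X.ip_cnj[of q "u n"] X.ip_cnj[of p "w n"] m h by simp
    then have "ipX w0 p = ipX u0 q" using lim m by blast
    then show "ipX q u0 = ipX p w0" using X.ip_cnj[of u0 q] X.ip_cnj[of w0 p] m mem by simp
  qed
  have "ipG (P u0) g = ipG (K (Q u0)) g" if g: "g \<in> HG" for g
  proof -
    obtain k where k: "k \<in> HG" "\<And>f. f \<in> HG \<Longrightarrow> ipG (K f) g = ipG f k" using G.contr_adjoint[OF K g] by blast
    \<comment> \<open>\<open>v\<close> meets the adjoint boundary condition with prescribed P v = g,
      so the limit relation compares P u0 and K (Q u0) against an arbitrary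
      \<open>g\<close>.\<close>
    obtain v where v: "v \<in> D" "G.eqn (P v) g" "G.eqn (Q v) k" using onto[OF g k(1)] by blast
    have adj: "(v, A v) \<in> X.adjoint (BC K)"
      unfolding adjoint_BC[OF K] using v k g KD(1) G.eqn_ip_right[of "P v" g] G.eqn_ip_right[of "Q v" k] by simp
    have "ipX (w n) v = ipX (u n) (A v)" for n using adj s[of n] by (auto simp: X.adjoint_def)
    then have "ipX w0 v = ipX u0 (A v)" using lim v by simp
    then have "ipX (A u0) v = ipX u0 (A v)" using X.eqn_ip_left[of w0 "A u0" v] u0 mem v by simp
    then have "ipG (P u0) (P v) = ipG (Q u0) (Q v)" using green[of u0 v] u0 v by simp
    then have "ipG (P u0) g = ipG (Q u0) k"
      using G.eqn_ip_right[of "P v" g "P u0"] G.eqn_ip_right[of "Q v" k "Q u0"] u0 v k g by simp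
    then show ?thesis using k u0 by simp
  qed
  then have "G.eqn (P u0) (K (Q u0))" using u0 KD(1) by (simp add: G.eqn_iff_ip)
  then show ?thesis using u0 mem by (simp add: BC_def)
qed

text \<open>A vector orthogonal to the range satisfies A h = cnj z h and lies in the domain of the
  adjoint, where |Q h| \<le> |P h|. Hence Im (A h | h) is nonnegative, while it also equals -Im z
  |h|^2.\<close>

lemma range_BC_complement:
  assumes K: "G.contr K" and z: "Im z > 0" and h: "h \<in> HX"
    and orth: "\<And>u w. (u, w) \<in> BC K \<Longrightarrow> ipX (w - z *\<^sub>X u) h = 0"
  shows "X.eqn h 0"
proof -
  note KD = G.contrD[OF K]
  have BH: "u \<in> HX" "w \<in> HX" if "(u, w) \<in> BC K" for u w using that by (auto simp: BC_def)
  have eq: "ipX w h = ipX u (cnj z *\<^sub>X h)" if "(u, w) \<in> BC K" for u w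
    using orth[OF that] BH[OF that] h by (simp add: X.ip_diff_left X.ip_scale_left X.ip_scale_right)
  have adj: "(h, cnj z *\<^sub>X h) \<in> X.adjoint (BC K)" using eq h by (simp add: X.adjoint_def)
  then have hD: "h \<in> D" "X.eqn (cnj z *\<^sub>X h) (A h)" "\<And>g. g \<in> HG \<Longrightarrow> ipG (K g) (P h) = ipG g (Q h)"
    unfolding adjoint_BC[OF K] by auto
  \<comment> \<open>The adjoint condition is used at g = Q h.\<close>
  have "complex_of_real ((G.nrm (Q h))\<^sup>2) = ipG (K (Q h)) (P h)" using hD by (simp add: G.ip_self)
  then have "(G.nrm (Q h))\<^sup>2 = cmod (ipG (K (Q h)) (P h))"
    by (metis norm_of_real abs_of_nonneg zero_le_power2)
  also have "\<dots> \<le> G.nrm (K (Q h)) * G.nrm (P h)" using hD KD by (intro G.cauchy_schwarz) auto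
  also have "\<dots> \<le> G.nrm (Q h) * G.nrm (P h)" using hD KD by (intro mult_right_mono) auto
  finally have "G.nrm (Q h) \<le> G.nrm (P h)"
    using G.nrm_nonneg[OF Q_mem[OF hD(1)]] G.nrm_nonneg[OF P_mem[OF hD(1)]]
    by (metis mult_le_cancel_left_pos power2_eq_square order_le_less)
  then have "(G.nrm (Q h))\<^sup>2 \<le> (G.nrm (P h))\<^sup>2" using hD by (intro power_mono) auto
  then have "0 \<le> Im (ipX (A h) h)" using Im_A[OF hD(1)] by simp
  also have "ipX (A h) h = ipX (cnj z *\<^sub>X h) h" using hD h by (intro X.eqn_ip_left[symmetric]) auto
  also have "Im \<dots> = - (Im z * (X.nrm h)\<^sup>2)" using h by (simp add: X.ip_scale_left X.ip_self)
  finally have "Im z * (X.nrm h)\<^sup>2 \<le> 0" by simp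
  then have "(X.nrm h)\<^sup>2 \<le> 0" using z by (simp add: mult_le_0_iff)
  then show ?thesis by (simp add: X.eqn_zero_iff)
qed

text \<open>The lower bound on w - z u makes preimages of a convergent sequence Cauchy, so
  closedness of the graph turns density of the range into surjectivity.\<close>

lemma mdiss_BC:
  assumes K: "G.contr K" shows "X.mdiss (BC K)"
  unfolding X.mdiss_def
proof (intro allI impI conjI ballI)
  note op = isop_BC[OF K] note opD = X.isopD[OF op]
  have bound: "Im z * X.nrm u \<le> X.nrm (w - z *\<^sub>X u)" if "(u, w) \<in> BC K" "Im z > 0" for u w z
    using X.dissipative_bound[OF opD(1,2) Im_BC[OF K]] that by blast
  show "X.nrm u \<le> X.nrm f / Im z" if "Im z > 0" "f \<in> HX \<and> (u, f + z *\<^sub>X u) \<in> BC K" for z f u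
    using bound[of u "f + z *\<^sub>X u" z] that by (simp add: field_simps)
  fix z f assume z: "Im z > 0" and f: "f \<in> HX"
  define S where "S = {w - z *\<^sub>X u | u w. (u, w) \<in> BC K}"
  have S: "X.csub S" unfolding X.csub_def
  proof (intro conjI ballI allI)
    show "S \<subseteq> HX" by (auto simp: S_def BC_def)
    have "(0, 0) \<in> BC K"
    proof -
      obtain u where "(u, A u) \<in> BC K" using BC_element[OF K G.zero_mem] by blast
      from opD(4)[OF this this, of 0 0] show ?thesis by simp
    qed
    then show "0 \<in> S" unfolding S_def by (intro CollectI exI[of _ 0]) simp
    fix x y a b assume "x \<in> S" "y \<in> S"
    then obtain u w u' w' where e: "(u, w) \<in> BC K" "x = w - z *\<^sub>X u" "(u', w') \<in> BC K" "y = w' - z *\<^sub>X u'"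
      by (auto simp: S_def)
    have "a *\<^sub>X x + b *\<^sub>X y = (a *\<^sub>X w + b *\<^sub>X w') - z *\<^sub>X (a *\<^sub>X u + b *\<^sub>X u')"
      unfolding e by (simp add: X.scale_right_diff_distrib X.scale_right_distrib mult.commute)
    then show "a *\<^sub>X x + b *\<^sub>X y \<in> S" using opD(4)[OF e(1,3)] by (auto simp: S_def)
  qed
  have triv: "X.eqn h 0" if "h \<in> HX" "\<And>y. y \<in> S \<Longrightarrow> ipX y h = 0" for h
    using range_BC_complement[OF K z that(1)] that(2) by (auto simp: S_def)
  obtain s where s: "\<And>n. s n \<in> S" "X.conv s f"
    using X.dense_of_trivial_complement[OF S f triv] by blast
  have "\<forall>n. \<exists>u w. (u, w) \<in> BC K \<and> s n = w - z *\<^sub>X u" using s(1) unfolding S_def by blast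
  then obtain u w where uw: "\<And>n. (u n, w n) \<in> BC K" "\<And>n. s n = w n - z *\<^sub>X u n" by metis
  have mem: "u n \<in> HX" "w n \<in> HX" "s n \<in> HX" for n using uw opD(1,2)[OF uw(1)] by auto
  have bd: "Im z * X.nrm (u m - u n) \<le> X.nrm (s m - s n)" for m n
  proof -
    have "(1 *\<^sub>X u m + (-1) *\<^sub>X u n, 1 *\<^sub>X w m + (-1) *\<^sub>X w n) \<in> BC K" by (intro opD(4) uw)
    then have "(u m - u n, w m - w n) \<in> BC K" by simp
    moreover have "s m - s n = (w m - w n) - z *\<^sub>X (u m - u n)"
      unfolding uw by (simp add: X.scale_right_diff_distrib algebra_simps)
    ultimately show ?thesis using bound z by simp
  qed
  have cau: "\<exists>N. \<forall>m\<ge>N. \<forall>n\<ge>N. X.nrm (u m - u n) < e" if e: "e > 0" for e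
  proof -
    obtain N where N: "\<And>m n. m \<ge> N \<Longrightarrow> n \<ge> N \<Longrightarrow> X.nrm (s m - s n) < Im z * e"
      using X.conv_cauchy[OF s(2) mem(3) f, of "Im z * e"] e z by (metis zero_less_mult_iff)
    have "X.nrm (u m - u n) < e" if "m \<ge> N" "n \<ge> N" for m n
      using le_less_trans[OF bd N[OF that]] z by simp
    then show ?thesis by blast
  qed
  obtain u0 where u0: "u0 \<in> HX" "X.conv u u0" using X.cauchy_conv[of u] mem cau by blast
  have "X.conv (\<lambda>n. 1 *\<^sub>X s n + z *\<^sub>X u n) (1 *\<^sub>X f + z *\<^sub>X u0)" using s u0 mem f by (intro X.conv_lin) auto
  moreover have "1 *\<^sub>X s n + z *\<^sub>X u n = w n" for n by (simp add: uw)
  ultimately have "X.conv w (f + z *\<^sub>X u0)" by simp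
  then have "(u0, f + z *\<^sub>X u0) \<in> BC K" using closed_BC[OF K uw(1) u0(2)] u0 f by simp
  then show "\<exists>u. (u, f + z *\<^sub>X u) \<in> BC K" by blast
qed

section \<open>From an m-dissipative extension to its contraction\<close>

text \<open>Adding a multiple a p with (p, q) in \<open>M0\<close> to \<open>u\<close> contributes
  nothing quadratic in a, because Im (q | p) = 0. Thus Im (w | u) + Im (a d) \<le> 0 for every
  complex a, which forces d = 0, and this is the adjoint relation with \<open>M0\<close>.\<close>

lemma mdiss_extension_sub:
  assumes T: "X.isop T" "X.mdiss T" "M0 \<subseteq> T" and uw: "(u, w) \<in> T"
  shows "u \<in> D" "X.eqn w (A u)"
proof -
  note opD = X.isopD[OF T(1)]
  have H: "u \<in> HX" "w \<in> HX" using opD uw by blast+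
  have "u \<in> D \<and> X.eqn w (A u)"
  proof (rule maximal[OF H])
    fix p q assume pq: "(p, q) \<in> M0"
    note m = minimal[OF pq]
    have pH: "p \<in> HX" "q \<in> HX" using m by auto
    have "Im (ipX (A p) p) = 0" using Im_A[of p] m by (simp add: G.eqn_zero_iff)
    then have im0: "Im (ipX q p) = 0" using X.eqn_ip_left[of q "A p" p] m by simp
    define d where "d = ipX q u - cnj (ipX w p)"
    have le: "Im (ipX w u) + Im (a * d) \<le> 0" for a
    proof -
      have "(1 *\<^sub>X u + a *\<^sub>X p, 1 *\<^sub>X w + a *\<^sub>X q) \<in> T" using uw pq T(3) by (intro opD(4)) auto
      then have "Im (ipX (w + a *\<^sub>X q) (u + a *\<^sub>X p)) \<le> 0" using X.mdiss_Im_le[OF T(1,2)] by simp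
      moreover have "ipX (w + a *\<^sub>X q) (u + a *\<^sub>X p)
          = ipX w u + cnj a * ipX w p + a * ipX q u + (a * cnj a) * ipX q p"
        using H pH by (simp add: X.ip_lin algebra_simps)
      moreover have "Im ((a * cnj a) * ipX q p) = 0"
        using im0 by (simp add: complex_norm_square[symmetric])
      ultimately show ?thesis by (simp add: d_def algebra_simps)
    qed
    have "d = 0"
    proof (rule ccontr)
      assume "d \<noteq> 0"
      then have pos: "(cmod d)\<^sup>2 > 0" by simp
      \<comment> \<open>With a = i t cnj d this makes Im (w | u) + Im (a d) equal to 1.\<close>
      define t where "t = (1 - Im (ipX w u)) / (cmod d)\<^sup>2"
      have "(\<i> * of_real t * cnj d) * d = \<i> * of_real (t * (cmod d)\<^sup>2)"
        by (simp add: complex_norm_square mult_ac del: of_real_power)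
      then have "Im ((\<i> * of_real t * cnj d) * d) = t * (cmod d)\<^sup>2"
        by (metis Im_i_times Re_complex_of_real)
      also have "\<dots> = 1 - Im (ipX w u)" using pos by (simp add: t_def)
      finally show False using le[of "\<i> * of_real t * cnj d"] by simp
    qed
    then show "ipX q u = ipX p w" using X.ip_cnj[of w p] H pH by (simp add: d_def)
  qed
  then show "u \<in> D" "X.eqn w (A u)" by auto
qed

lemma mdiss_extension:
  assumes T: "X.isop T" "X.mdiss T" "M0 \<subseteq> T"
  obtains K where "G.contr K" "T = BC K"
proof -
  note opD = X.isopD[OF T(1)] and sub = mdiss_extension_sub[OF T]
  \<comment> \<open>Saturated under \<open>eqn\<close>, since (Q, P) respects linear combinations
    only modulo null vectors.\<close>
  define R where "R = {(x, y). x \<in> HG \<and> y \<in> HG \<and> (\<exists>u w. (u, w) \<in> T \<and> G.eqn (Q u) x \<and> G.eqn (P u) y)}"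
  have surj: "\<exists>u. (u, f + \<i> *\<^sub>X u) \<in> T" if "f \<in> HX" for f using T(2) that unfolding X.mdiss_def by simp
  have RI: "(Q u, P u) \<in> R" if "(u, w) \<in> T" for u w using sub[OF that] that by (auto simp: R_def)
  have lin: "(a *\<^sub>G x + b *\<^sub>G x', a *\<^sub>G y + b *\<^sub>G y') \<in> R" if xy: "(x, y) \<in> R" "(x', y') \<in> R" for x y x' y' a b
  proof -
    obtain u w where u: "(u, w) \<in> T" "G.eqn (Q u) x" "G.eqn (P u) y" "x \<in> HG" "y \<in> HG" using xy(1) by (auto simp: R_def)
    obtain u' w' where u': "(u', w') \<in> T" "G.eqn (Q u') x'" "G.eqn (P u') y'" "x' \<in> HG" "y' \<in> HG" using xy(2) by (auto simp: R_def)
    have D: "u \<in> D" "u' \<in> D" using sub u u' by blast+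
    let ?c = "a *\<^sub>X u + b *\<^sub>X u'"
    have c: "?c \<in> D" using D_lin D by blast
    have "(?c, a *\<^sub>X w + b *\<^sub>X w') \<in> T" using u u' by (intro opD(4))
    moreover have "G.eqn (Q ?c) (a *\<^sub>G x + b *\<^sub>G x')"
      using boundary_lin(2)[OF D] D c u u'
      by (intro G.eqn_trans[OF boundary_lin(2)[OF D] G.eqn_lin]) auto
    moreover have "G.eqn (P ?c) (a *\<^sub>G y + b *\<^sub>G y')"
      using boundary_lin(1)[OF D] D c u u'
      by (intro G.eqn_trans[OF boundary_lin(1)[OF D] G.eqn_lin]) auto
    ultimately show ?thesis using u u' unfolding R_def by auto
  qed
  have R0: "(0, 0) \<in> R"
  proof -
    obtain u w where "(u, w) \<in> T" using surj[of 0] by auto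
    from lin[OF RI RI, OF this this, of 0 0] show ?thesis by simp
  qed
  have le: "G.nrm y \<le> G.nrm x" if "(x, y) \<in> R" for x y
  proof -
    obtain u w where u: "(u, w) \<in> T" "G.eqn (Q u) x" "G.eqn (P u) y" "x \<in> HG" "y \<in> HG" using \<open>(x, y) \<in> R\<close> by (auto simp: R_def)
    have D: "u \<in> D" "X.eqn w (A u)" "w \<in> HX" using sub u opD by blast+
    have "Im (ipX (A u) u) \<le> 0"
      using X.mdiss_Im_le[OF T(1,2) u(1)] X.eqn_ip_left[OF D(2), of u] D by simp
    then have "(G.nrm (P u))\<^sup>2 \<le> (G.nrm (Q u))\<^sup>2" using Im_A[OF D(1)] by simp
    then have "G.nrm (P u) \<le> G.nrm (Q u)" using D by (simp add: power2_le_iff_abs_le)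
    then show ?thesis using G.eqn_nrm[OF u(2)] G.eqn_nrm[OF u(3)] u D by simp
  qed
  obtain K where K: "G.contr K" "\<And>x y. (x, y) \<in> R \<Longrightarrow> G.eqn (K x) y"
    using G.contraction_extension[of R, OF _ R0 lin le] by (auto simp: R_def)
  have TB: "T \<subseteq> BC K"
  proof clarify
    fix u w assume uw: "(u, w) \<in> T"
    have "G.eqn (P u) (K (Q u))"
      using sub[OF uw] G.eqn_sym[OF K(2)[OF RI[OF uw]]] G.contrD(1)[OF K(1)] by simp
    then show "(u, w) \<in> BC K" using sub[OF uw] opD(2)[OF uw] by (simp add: BC_def)
  qed
  moreover have "BC K \<subseteq> T"
  proof clarify
    fix u w assume uw: "(u, w) \<in> BC K"
    note BD = X.isopD[OF isop_BC[OF K(1)]]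
    have H: "u \<in> HX" "w \<in> HX" using BD uw by blast+
    \<comment> \<open>T - i is onto and so reaches the value taken at \<open>u\<close> by the larger
      operator minus i. The two preimages differ by an element of the kernel of the latter, which
      its resolvent bound makes null.\<close>
    obtain u' where u': "(u', (w - \<i> *\<^sub>X u) + \<i> *\<^sub>X u') \<in> T" using surj[of "w - \<i> *\<^sub>X u"] H by auto
    have u'H: "u' \<in> HX" using opD u' by blast
    have "(1 *\<^sub>X u + (-1) *\<^sub>X u', 1 *\<^sub>X w + (-1) *\<^sub>X ((w - \<i> *\<^sub>X u) + \<i> *\<^sub>X u')) \<in> BC K"
      using TB u' uw by (intro BD(4)) auto
    then have "(u - u', 0 + \<i> *\<^sub>X (u - u')) \<in> BC K" by (simp add: X.scale_right_diff_distrib)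
    then have "X.nrm (u - u') \<le> X.nrm 0 / Im \<i>"
      using mdiss_BC[OF K(1)] unfolding X.mdiss_def by (metis X.zero_mem imaginary_unit.sel(2) zero_less_one)
    then have "X.nrm (u - u') = 0" using X.nrm_nonneg[OF X.diff_mem[OF H(1) u'H]] by simp
    then have e: "X.nrm (u' - u) = 0" using X.nrm_minus_commute H u'H by simp
    moreover have "X.nrm ((w - \<i> *\<^sub>X u) + \<i> *\<^sub>X u' - w) = 0"
    proof -
      have "(w - \<i> *\<^sub>X u) + \<i> *\<^sub>X u' - w = \<i> *\<^sub>X (u' - u)" by (simp add: X.scale_right_diff_distrib)
      then show ?thesis using e H u'H by (simp add: X.nrm_scale)
    qed
    ultimately show "(u, w) \<in> T" using opD(3)[OF u' H] by (simp add: X.eqn_def)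
  qed
  ultimately show ?thesis using that K(1) by blast
qed

section \<open>Uniqueness of the contraction, density and selfadjointness\<close>

lemma BC_inj:
  assumes K: "G.contr K" "G.contr K'" "BC K = BC K'" and f: "f \<in> HG"
  shows "G.eqn (K f) (K' f)"
proof -
  note KD = G.contrD[OF K(1)] and KD' = G.contrD[OF K(2)]
  obtain u where u: "u \<in> D" "(u, A u) \<in> BC K" "G.eqn (Q u) f" "G.eqn (P u) (K f)"
    using BC_element[OF K(1) f] by blast
  have "(u, A u) \<in> BC K'" using u(2) K(3) by simp
  then have "G.eqn (P u) (K' (Q u))" by (simp add: BC_def)
  then have "G.eqn (P u) (K' f)"
    using u f KD'(1) by (intro G.eqn_trans[of "P u" "K' (Q u)" "K' f"] KD'(2)) auto
  then show ?thesis
    using u f KD(1) KD'(1) G.eqn_trans[of "K f" "P u" "K' f"] G.eqn_sym[of "P u" "K f"] by simp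
qed

text \<open>A vector \<open>h\<close> orthogonal to the domain is orthogonal to the domain of
  \<open>M0\<close>, so (0, h) is an adjoint pair of \<open>M0\<close>; \<open>maximal\<close> then
  gives h = A 0, and likewise 0 = A 0, modulo null vectors.\<close>

lemma dense_BC:
  assumes K: "G.contr K" and f: "f \<in> HX" and e: "e > 0"
  shows "\<exists>u w. (u, w) \<in> BC K \<and> X.nrm (u - f) < e"
proof -
  note opD = X.isopD[OF isop_BC[OF K]]
  have S: "X.csub (Domain (BC K))" unfolding X.csub_def
  proof (intro conjI ballI allI)
    show "Domain (BC K) \<subseteq> HX" by (auto simp: BC_def)
    obtain u where "(u, A u) \<in> BC K" using BC_element[OF K G.zero_mem] by blast
    from opD(4)[OF this this, of 0 0] show "0 \<in> Domain (BC K)" by auto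
    show "a *\<^sub>X x + b *\<^sub>X y \<in> Domain (BC K)" if "x \<in> Domain (BC K)" "y \<in> Domain (BC K)" for x y a b
      using that opD(4) by blast
  qed
  have "X.eqn h 0" if h: "h \<in> HX" "\<And>y. y \<in> Domain (BC K) \<Longrightarrow> ipX y h = 0" for h
  proof -
    have "X.eqn h (A 0)" using maximal[of 0 h] h minimal minimal_BC[OF K] by (metis Domain.DomainI D_sub X.ip_zero_right X.zero_mem subsetD)
    moreover have "X.eqn 0 (A 0)" using maximal[of 0 0] minimal by simp
    ultimately show ?thesis
      using h zero_D X.eqn_trans[of h "A 0" 0] X.eqn_sym[of 0 "A 0"] by simp
  qed
  then obtain s where s: "\<And>n. s n \<in> Domain (BC K)" "X.conv s f"
    using X.dense_of_trivial_complement[OF S f] by metis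
  obtain N where "\<forall>n\<ge>N. norm (X.nrm (s n - f) - 0) < e"
    using LIMSEQ_D[OF s(2)[unfolded X.conv_def] e] by blast
  then have "X.nrm (s N - f) < e" by fastforce
  then show ?thesis using s(1)[of N] by blast
qed

text \<open>The operator requires P v = K (Q v), its adjoint (K g | P v) = (g | Q v) for all g. For
  unitary \<open>K\<close> these coincide; conversely their coincidence, tested on elements with
  prescribed boundary values, gives isometry and surjectivity.\<close>

lemma selfadj_BC_iff:
  assumes K: "G.contr K" shows "X.selfadj (BC K) \<longleftrightarrow> G.unit K"
proof
  note KD = G.contrD[OF K]
  assume sa: "X.selfadj (BC K)"
  then have adj: "X.adjoint (BC K) = BC K" by (simp add: X.selfadj_def)
  have "G.nrm (K f) = G.nrm f" if f: "f \<in> HG" for f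
  proof -
    obtain u where u: "u \<in> D" "(u, A u) \<in> BC K" "G.eqn (Q u) f" "G.eqn (P u) (K f)"
      using BC_element[OF K f] by blast
    have "ipG (K f) (P u) = ipG f (Q u)" using u(2) f adjoint_BC[OF K, of u "A u"] unfolding adj by blast
    then have "ipG (K f) (K f) = ipG f f"
      using u f KD(1) G.eqn_ip_right[OF u(3), of f] G.eqn_ip_right[OF u(4), of "K f"] by simp
    then show ?thesis by (simp add: G.nrm_def)
  qed
  moreover have "\<exists>f\<in>HG. G.eqn (K f) g" if g: "g \<in> HG" for g
  proof -
    \<comment> \<open>\<open>k\<close> is the adjoint of \<open>K\<close> at \<open>g\<close>. An
      element with P v = g and Q v = k lies in the adjoint, hence in the operator, so
      \<open>K\<close> maps Q v to \<open>g\<close>.\<close>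
    obtain k where k: "k \<in> HG" "\<And>f. f \<in> HG \<Longrightarrow> ipG (K f) g = ipG f k" using G.contr_adjoint[OF K g] by blast
    obtain v where v: "v \<in> D" "G.eqn (P v) g" "G.eqn (Q v) k" using onto[OF g k(1)] by blast
    have "(v, A v) \<in> X.adjoint (BC K)"
      unfolding adjoint_BC[OF K] using v k g KD(1) G.eqn_ip_right[of "P v" g] G.eqn_ip_right[of "Q v" k] by simp
    then have "G.eqn (P v) (K (Q v))" unfolding adj by (simp add: BC_def)
    then have "G.eqn (K (Q v)) g"
      using v g KD(1) G.eqn_trans[of "K (Q v)" "P v" g] G.eqn_sym[of "P v" "K (Q v)"] by simp
    then show ?thesis using Q_mem[OF v(1)] by blast
  qed
  ultimately show "G.unit K" using K by (simp add: G.unit_def)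
next
  note KD = G.contrD[OF K]
  assume "G.unit K"
  then have iso: "\<And>f. f \<in> HG \<Longrightarrow> G.nrm (K f) = G.nrm f" and surj: "\<And>g. g \<in> HG \<Longrightarrow> \<exists>f\<in>HG. G.eqn (K f) g"
    by (auto simp: G.unit_def)
  have "(v, w) \<in> X.adjoint (BC K) \<longleftrightarrow> (v, w) \<in> BC K" for v w
  proof -
    have "(\<forall>g\<in>HG. ipG (K g) (P v) = ipG g (Q v)) \<longleftrightarrow> G.eqn (P v) (K (Q v))" if v: "v \<in> D"
    proof
      assume h: "\<forall>g\<in>HG. ipG (K g) (P v) = ipG g (Q v)"
      have "ipG (P v) g = ipG (K (Q v)) g" if g: "g \<in> HG" for g
      proof -
        obtain f where f: "f \<in> HG" "G.eqn (K f) g" using surj[OF g] by blast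
        have "ipG (K f) (P v) = ipG (K f) (K (Q v))" using h f v G.isometry_ip[OF K iso, of f "Q v"] by simp
        then have "ipG g (P v) = ipG g (K (Q v))"
          using G.eqn_ip_left[OF f(2), of "P v"] G.eqn_ip_left[OF f(2), of "K (Q v)"] f g v KD(1) by simp
        then show ?thesis using G.ip_cnj[of g "P v"] G.ip_cnj[of g "K (Q v)"] g v KD(1) by simp
      qed
      then show "G.eqn (P v) (K (Q v))" using v KD(1) by (simp add: G.eqn_iff_ip)
    next
      assume e: "G.eqn (P v) (K (Q v))"
      show "\<forall>g\<in>HG. ipG (K g) (P v) = ipG g (Q v)"
        using G.eqn_ip_right[OF e] G.isometry_ip[OF K iso] v KD(1) by simp
    qed
    then show ?thesis unfolding adjoint_BC[OF K] by (auto simp: BC_def)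
  qed
  then have "BC K = X.adjoint (BC K)" by auto
  then show "X.selfadj (BC K)" using dense_BC[OF K] unfolding X.selfadj_def by blast
qed

end

section \<open>Square-integrable vector fields\<close>

lemma cdot_simps:
  "cdot (a + b) c = cdot a c + cdot b c" "cdot c (a + b) = cdot c a + cdot c b"
  "cdot (a - b) c = cdot a c - cdot b c" "cdot c (a - b) = cdot c a - cdot c b"
  "cdot (- a) c = - cdot a c" "cdot c (- a) = - cdot c a"
  "cdot 0 c = 0" "cdot c 0 = 0"
  "cdot (k *s a) c = k * cdot a c" "cdot c (k *s a) = cnj k * cdot c a"
  by (auto simp: cdot_def algebra_simps sum.distrib sum_subtractf sum_negf sum_distrib_left)

lemma cdot_cnj: "cnj (cdot a b) = cdot b a"
  by (simp add: cdot_def mult.commute)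

lemma cdot_self: "cdot a a = complex_of_real ((norm a)\<^sup>2)"
  by (simp add: cdot_def norm_vec_def L2_set_def sum_nonneg complex_norm_square[symmetric] del: of_real_power)

lemma norm_cdot_le: "cmod (cdot a b) \<le> norm a * norm b"
proof -
  have "cmod (cdot a b) \<le> (\<Sum>i\<in>UNIV. \<bar>norm (a $ i)\<bar> * \<bar>norm (b $ i)\<bar>)"
    unfolding cdot_def by (rule order_trans[OF norm_sum]) (simp add: norm_mult)
  also have "\<dots> \<le> norm a * norm b" unfolding norm_vec_def by (rule L2_set_mult_ineq)
  finally show ?thesis .
qed

lemma norm_cdot_le_sum: "cmod (cdot a b) \<le> (norm a)\<^sup>2 + (norm b)\<^sup>2"
proof -
  have "2 * (norm a * norm b) \<le> (norm a)\<^sup>2 + (norm b)\<^sup>2"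
    using sum_squares_bound[of "norm a" "norm b"] by simp
  moreover have "0 \<le> norm a * norm b" by simp
  ultimately show ?thesis using norm_cdot_le[of a b] by linarith
qed

lemma norm_add_sq_le: "(norm (a + b))\<^sup>2 \<le> 2 * (norm a)\<^sup>2 + 2 * (norm (b :: 'a::real_normed_vector))\<^sup>2"
proof -
  have "(norm (a + b))\<^sup>2 \<le> (norm a + norm b)\<^sup>2" by (simp add: norm_triangle_ineq power_mono)
  also have "\<dots> \<le> 2 * (norm a)\<^sup>2 + 2 * (norm b)\<^sup>2"
    using sum_squares_bound[of "norm a" "norm b"] by (simp add: power2_sum)
  finally show ?thesis .
qed

lemma norm_cscale: "norm (k *s (a :: cv)) = cmod k * norm a"
  by (simp add: norm_vec_def L2_set_def norm_mult power_mult_distrib sum_distrib_left[symmetric] real_sqrt_mult)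

lemma continuous_cscale: "continuous_on UNIV (\<lambda>v::cv. k *s v)"
  unfolding vector_scalar_mult_def by (intro continuous_intros)

lemma continuous_cdot: "continuous_on UNIV (\<lambda>p. cdot (fst p) (snd p))"
  unfolding cdot_def by (intro continuous_intros)

lemma ndot_simps:
  "ndot n (a + b) = ndot n a + ndot n b" "ndot n (k *s a) = k * ndot n a" "ndot n 0 = 0" "ndot 0 a = 0"
  by (auto simp: ndot_def algebra_simps sum.distrib sum_distrib_left)

lemma tendsto_ndot: "(f \<longlongrightarrow> l) F \<Longrightarrow> ((\<lambda>x. ndot n (f x)) \<longlongrightarrow> ndot n l) F"
  unfolding ndot_def by (intro tendsto_intros)

section \<open>Square-integrable vector fields over a measure and their completeness\<close>

text \<open>Generic in the measure: used for Lebesgue measure on the domain and for surface measure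
  on its boundary.\<close>

definition L2m :: "'x measure \<Rightarrow> ('x \<Rightarrow> cv) \<Rightarrow> bool" where
  "L2m M f \<longleftrightarrow> f \<in> borel_measurable M \<and> integrable M (\<lambda>x. (norm (f x))\<^sup>2)"

definition ipm :: "'x measure \<Rightarrow> ('x \<Rightarrow> cv) \<Rightarrow> ('x \<Rightarrow> cv) \<Rightarrow> complex" where
  "ipm M f g = (LINT x|M. cdot (f x) (g x))"

definition fscale :: "complex \<Rightarrow> ('x \<Rightarrow> cv) \<Rightarrow> ('x \<Rightarrow> cv)" where
  "fscale a f = (\<lambda>x. a *s f x)"

lemma module_fscale: "module (fscale :: complex \<Rightarrow> ('x \<Rightarrow> cv) \<Rightarrow> _)"
  by unfold_locales (auto simp: fscale_def fun_eq_iff vector_add_ldistrib vector_sadd_rdistrib)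

lemma borel_measurable_cscale [measurable]:
  "f \<in> borel_measurable M \<Longrightarrow> (\<lambda>x. k *s (f x :: cv)) \<in> borel_measurable M"
  by (rule measurable_compose[OF _ borel_measurable_continuous_onI[OF continuous_cscale]])

lemma borel_measurable_cdot [measurable]:
  assumes "f \<in> borel_measurable M" "g \<in> borel_measurable M"
  shows "(\<lambda>x. cdot (f x) (g x)) \<in> borel_measurable M"
  using borel_measurable_continuous_Pair[OF assms, of "\<lambda>x y. cdot x y"] continuous_cdot by simp

lemma integrable_cdot:
  assumes "L2m M f" "L2m M g"
  shows "integrable M (\<lambda>x. cdot (f x) (g x))"
proof (rule Bochner_Integration.integrable_bound)
  show "integrable M (\<lambda>x. (norm (f x))\<^sup>2 + (norm (g x))\<^sup>2)" using assms by (simp add: L2m_def)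
  show "(\<lambda>x. cdot (f x) (g x)) \<in> borel_measurable M" using assms by (intro borel_measurable_cdot) (auto simp: L2m_def)
  show "AE x in M. norm (cdot (f x) (g x)) \<le> norm ((norm (f x))\<^sup>2 + (norm (g x))\<^sup>2)"
    using norm_cdot_le_sum by (intro always_eventually allI) (auto intro: order_trans)
qed

lemma L2m_add:
  assumes "L2m M f" "L2m M g"
  shows "L2m M (\<lambda>x. f x + g x)"
  unfolding L2m_def
proof
  have [measurable]: "f \<in> borel_measurable M" "g \<in> borel_measurable M" using assms by (auto simp: L2m_def)
  show "(\<lambda>x. f x + g x) \<in> borel_measurable M" by measurable
  show "integrable M (\<lambda>x. (norm (f x + g x))\<^sup>2)"
  proof (rule Bochner_Integration.integrable_bound)
    show "integrable M (\<lambda>x. 2 * (norm (f x))\<^sup>2 + 2 * (norm (g x))\<^sup>2)" using assms by (simp add: L2m_def)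
    show "(\<lambda>x. (norm (f x + g x))\<^sup>2) \<in> borel_measurable M" by measurable
    show "AE x in M. norm ((norm (f x + g x))\<^sup>2) \<le> norm (2 * (norm (f x))\<^sup>2 + 2 * (norm (g x))\<^sup>2)"
      using norm_add_sq_le by (intro always_eventually allI) (auto intro: order_trans)
  qed
qed

lemma L2m_scale: "L2m M f \<Longrightarrow> L2m M (\<lambda>x. k *s f x)"
  by (auto simp: L2m_def norm_cscale power_mult_distrib)

lemma L2m_zero: "L2m M (\<lambda>x. 0)"
  by (simp add: L2m_def)

lemma L2m_diff: "L2m M f \<Longrightarrow> L2m M g \<Longrightarrow> L2m M (\<lambda>x. f x - g x)"
  using L2m_add[OF _ L2m_scale[of M g "-1"], of f] by (simp add: vector_sneg_minus1[symmetric])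

lemma ipm_self: "ipm M f f = complex_of_real (LINT x|M. (norm (f x))\<^sup>2)"
  unfolding ipm_def cdot_self by (rule integral_complex_of_real)

lemma ipm_cnj: "ipm M g f = cnj (ipm M f g)"
proof -
  have "cnj (ipm M f g) = (LINT x|M. cnj (cdot (f x) (g x)))" by (simp add: ipm_def)
  then show ?thesis by (simp only: ipm_def cdot_cnj)
qed

lemma ipm_add_left:
  "L2m M f \<Longrightarrow> L2m M g \<Longrightarrow> L2m M h \<Longrightarrow> ipm M (\<lambda>x. f x + g x) h = ipm M f h + ipm M g h"
  by (simp add: ipm_def cdot_simps integrable_cdot)

lemma ipm_scale_left: "ipm M (\<lambda>x. k *s f x) h = k * ipm M f h"
  by (simp add: ipm_def cdot_simps)

lemma ipm_zero_iff:
  assumes "L2m M f"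
  shows "(LINT x|M. (norm (f x))\<^sup>2) = 0 \<longleftrightarrow> (AE x in M. f x = 0)"
  using integral_nonneg_eq_0_iff_AE[of M "\<lambda>x. (norm (f x))\<^sup>2"] assms by (simp add: L2m_def)

text \<open>The rate 1/8 leaves the summable factor (1/2)^k after multiplication by the weight 4^k
  in \<open>L2m_complete\<close>.\<close>

lemma cauchy_subsequence:
  fixes d :: "nat \<Rightarrow> nat \<Rightarrow> real"
  assumes "\<And>e. e > 0 \<Longrightarrow> \<exists>N. \<forall>m\<ge>N. \<forall>n\<ge>N. d m n < e"
  obtains r where "strict_mono r" "\<And>k m n. m \<ge> r k \<Longrightarrow> n \<ge> r k \<Longrightarrow> d m n < (1/8)^k"
proof -
  have "\<forall>k. \<exists>N. \<forall>m\<ge>N. \<forall>n\<ge>N. d m n < (1/8)^k" using assms by simp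
  then obtain N where N: "\<And>k m n. m \<ge> N k \<Longrightarrow> n \<ge> N k \<Longrightarrow> d m n < (1/8)^k" by metis
  \<comment> \<open>\<open>Suc a\<close> forces strict growth, \<open>N (Suc k)\<close> the estimate
    at the next rate.\<close>
  define r where "r = rec_nat (N 0) (\<lambda>k a. max (Suc a) (N (Suc k)))"
  have r: "r 0 = N 0" "r (Suc k) = max (Suc (r k)) (N (Suc k))" for k by (simp_all add: r_def)
  have "strict_mono r" unfolding strict_mono_Suc_iff r by auto
  moreover have "r k \<ge> N k" for k by (cases k) (auto simp: r)
  ultimately show ?thesis using that N order_trans by metis
qed

text \<open>Finiteness of the weighted sum bounds its terms, so |h k| is at most a constant times
  (1/2)^k; the geometric weight takes the place of a Cauchy-Schwarz estimate.\<close>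

lemma summable_of_weighted_square:
  fixes h :: "nat \<Rightarrow> 'a::banach"
  assumes "(\<Sum>k. ennreal (4^k * (norm (h k))\<^sup>2)) \<noteq> \<infinity>"
  shows "summable h"
proof -
  have "summable (\<lambda>k. 4^k * (norm (h k))\<^sup>2)"
    by (rule summable_suminf_not_top) (use assms in simp_all)
  then have "(\<lambda>k. 4^k * (norm (h k))\<^sup>2) \<longlonglongrightarrow> 0" by (rule summable_LIMSEQ_zero)
  then have "Bseq (\<lambda>k. 4^k * (norm (h k))\<^sup>2)" by (rule convergent_imp_Bseq[OF convergentI])
  then obtain C where C: "C > 0" "\<And>k. norm (4^k * (norm (h k))\<^sup>2) \<le> C" by (auto simp: Bseq_def)
  have le: "norm (h k) \<le> sqrt C * (1/2)^k" for k
  proof -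
    have "(2 :: real)^k * 2^k = 4^k" by (simp add: power_mult_distrib[symmetric])
    then have "(2^k * norm (h k))\<^sup>2 = 4^k * (norm (h k))\<^sup>2"
      by (simp add: power2_eq_square mult_ac)
    then have "(2^k * norm (h k))\<^sup>2 \<le> C" using C(2)[of k] by simp
    then have "2^k * norm (h k) \<le> sqrt C" using real_le_rsqrt by blast
    then show ?thesis by (simp add: field_simps power_one_over)
  qed
  show ?thesis
    by (rule summable_comparison_test'[OF summable_mult[OF summable_geometric[of "1/2 :: real"], of "sqrt C"], of 0])
      (use le in auto)
qed

text \<open>Riesz-Fischer. The subsequence converging almost everywhere is returned as well, because
  tangentiality is carried to the limit pointwise.\<close>

lemma L2m_complete:
  assumes f: "\<And>n::nat. L2m M (f n)"
    and cau: "\<And>e. e > 0 \<Longrightarrow> \<exists>N. \<forall>m\<ge>N. \<forall>n\<ge>N. sqrt (LINT x|M. (norm (f m x - f n x))\<^sup>2) < e"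
  obtains g r where "L2m M g" "(\<lambda>n. sqrt (LINT x|M. (norm (f n x - g x))\<^sup>2)) \<longlonglongrightarrow> 0"
    "strict_mono (r :: nat \<Rightarrow> nat)" "AE x in M. (\<lambda>k. f (r k) x) \<longlonglongrightarrow> g x"
proof -
  have [measurable]: "f n \<in> borel_measurable M" for n using f by (simp add: L2m_def)
  define d where "d m n = (LINT x|M. (norm (f m x - f n x))\<^sup>2)" for m n
  have int: "integrable M (\<lambda>x. (norm (f m x - f n x))\<^sup>2)" for m n
    using L2m_diff[OF f f, of m n] by (simp add: L2m_def)
  have d0: "0 \<le> d m n" for m n unfolding d_def by simp
  have dcau: "\<exists>N. \<forall>m\<ge>N. \<forall>n\<ge>N. d m n < e" if "e > 0" for e
  proof -
    have "\<exists>N. \<forall>m\<ge>N. \<forall>n\<ge>N. sqrt (d m n) < sqrt e" using cau[of "sqrt e"] that by (simp add: d_def)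
    then show ?thesis by simp
  qed
  have nn: "(\<integral>\<^sup>+x. ennreal ((norm (f m x - f n x))\<^sup>2) \<partial>M) = ennreal (d m n)" for m n
    unfolding d_def by (rule nn_integral_eq_integral[OF int]) simp
  obtain r where r: "strict_mono r" "\<And>k m n. m \<ge> r k \<Longrightarrow> n \<ge> r k \<Longrightarrow> d m n < (1/8)^k"
    using cauchy_subsequence[OF dcau] by blast
  define h where "h k x = f (r (Suc k)) x - f (r k) x" for k x
  have [measurable]: "h k \<in> borel_measurable M" for k unfolding h_def by measurable
  have "(\<integral>\<^sup>+x. (\<Sum>k. ennreal (4^k * (norm (h k x))\<^sup>2)) \<partial>M) = (\<Sum>k. \<integral>\<^sup>+x. ennreal (4^k * (norm (h k x))\<^sup>2) \<partial>M)"
    by (rule nn_integral_suminf) measurable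
  also have "\<dots> \<le> (\<Sum>k. ennreal ((1/2)^k))"
  proof (rule suminf_le)
    fix k
    have "(\<integral>\<^sup>+x. ennreal (4^k * (norm (h k x))\<^sup>2) \<partial>M) = ennreal (4^k) * ennreal (d (r (Suc k)) (r k))"
      unfolding nn[symmetric] h_def by (subst nn_integral_cmult[symmetric]) (auto simp: ennreal_mult)
    also have "\<dots> = ennreal (4^k * d (r (Suc k)) (r k))" using d0 by (simp add: ennreal_mult)
    also have "\<dots> \<le> ennreal (4^k * (1/8)^k)"
      using r(2)[of k "r (Suc k)" "r k"] strict_mono_less_eq[OF r(1), of k "Suc k"]
      by (intro ennreal_leI mult_left_mono) auto
    also have "4^k * (1/8)^k = (1/2 :: real)^k" by (simp add: power_mult_distrib[symmetric])
    finally show "(\<integral>\<^sup>+x. ennreal (4^k * (norm (h k x))\<^sup>2) \<partial>M) \<le> ennreal ((1/2)^k)" .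
  qed auto
  also have "\<dots> = ennreal (\<Sum>k. (1/2)^k)" by (rule suminf_ennreal2) (auto intro: summable_geometric)
  finally have fin: "(\<integral>\<^sup>+x. (\<Sum>k. ennreal (4^k * (norm (h k x))\<^sup>2)) \<partial>M) \<noteq> \<infinity>"
    by (metis ennreal_less_top infinity_ennreal_def leD)
  have "AE x in M. (\<Sum>k. ennreal (4^k * (norm (h k x))\<^sup>2)) \<noteq> \<infinity>"
    by (rule nn_integral_PInf_AE[OF _ fin]) measurable
  then have conv: "AE x in M. convergent (\<lambda>k. f (r k) x)"
  proof eventually_elim
    case (elim x)
    have "summable (\<lambda>k. h k x)" by (rule summable_of_weighted_square[OF elim])
    then have "convergent (\<lambda>n. \<Sum>k<n. h k x)" by (simp add: summable_iff_convergent)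
    moreover have "(\<Sum>k<n. h k x) = f (r n) x - f (r 0) x" for n
      unfolding h_def by (rule sum_lessThan_telescope)
    ultimately have "convergent (\<lambda>n. (f (r n) x - f (r 0) x) + f (r 0) x)"
      by (intro convergent_add convergent_const) simp
    then show ?case by simp
  qed
  define g where "g x = lim (\<lambda>k. f (r k) x)" for x
  have [measurable]: "g \<in> borel_measurable M" unfolding g_def by measurable
  have lim: "AE x in M. (\<lambda>k. f (r k) x) \<longlonglongrightarrow> g x"
    using conv by eventually_elim (simp add: g_def convergent_LIMSEQ_iff)
  \<comment> \<open>Fatou's lemma along the subsequence turns the Cauchy estimate into an estimate
    of the distance to \<open>g\<close>.\<close>
  have fatou: "(\<integral>\<^sup>+x. ennreal ((norm (f n x - g x))\<^sup>2) \<partial>M) \<le> ennreal (e\<^sup>2)"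
    if N: "\<And>m. m \<ge> N \<Longrightarrow> d n m < e\<^sup>2" for n N and e :: real
  proof -
    have "(\<integral>\<^sup>+x. ennreal ((norm (f n x - g x))\<^sup>2) \<partial>M)
        = (\<integral>\<^sup>+x. liminf (\<lambda>k. ennreal ((norm (f n x - f (r k) x))\<^sup>2)) \<partial>M)"
    proof (rule nn_integral_cong_AE, use lim in eventually_elim)
      case (elim x)
      have "(\<lambda>k. ennreal ((norm (f n x - f (r k) x))\<^sup>2)) \<longlonglongrightarrow> ennreal ((norm (f n x - g x))\<^sup>2)"
        by (intro tendsto_ennrealI tendsto_power tendsto_norm tendsto_diff tendsto_const elim)
      then show ?case by (rule lim_imp_Liminf[OF sequentially_bot, symmetric])
    qed
    also have "\<dots> \<le> liminf (\<lambda>k. \<integral>\<^sup>+x. ennreal ((norm (f n x - f (r k) x))\<^sup>2) \<partial>M)"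
      by (rule nn_integral_liminf) measurable
    also have "\<dots> \<le> ennreal (e\<^sup>2)"
    proof (rule Liminf_le)
      show "\<forall>\<^sub>F k in sequentially. (\<integral>\<^sup>+x. ennreal ((norm (f n x - f (r k) x))\<^sup>2) \<partial>M) \<le> ennreal (e\<^sup>2)"
        unfolding nn eventually_sequentially
      proof (intro exI[of _ N] allI impI)
        fix k assume "N \<le> k"
        then have "N \<le> r k" using strict_mono_imp_increasing[OF r(1), of k] by linarith
        then show "ennreal (d n (r k)) \<le> ennreal (e\<^sup>2)" using N[of "r k"] by (intro ennreal_leI) simp
      qed
    qed simp
    finally show ?thesis .
  qed
  have close: "\<exists>N. \<forall>n\<ge>N. L2m M (\<lambda>x. f n x - g x) \<and> (LINT x|M. (norm (f n x - g x))\<^sup>2) \<le> e\<^sup>2" if e: "e > 0" for e :: real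
  proof -
    obtain N where N: "\<And>m n. m \<ge> N \<Longrightarrow> n \<ge> N \<Longrightarrow> d m n < e\<^sup>2" using dcau[of "e\<^sup>2"] e by auto
    have "L2m M (\<lambda>x. f n x - g x) \<and> (LINT x|M. (norm (f n x - g x))\<^sup>2) \<le> e\<^sup>2" if n: "n \<ge> N" for n
    proof -
      have b: "(\<integral>\<^sup>+x. ennreal ((norm (f n x - g x))\<^sup>2) \<partial>M) \<le> ennreal (e\<^sup>2)" using fatou[of N n e] N n by blast
      have i: "integrable M (\<lambda>x. (norm (f n x - g x))\<^sup>2)"
        by (rule integrableI_bounded) (use b in \<open>auto simp: le_less_trans\<close>)
      have "ennreal (LINT x|M. (norm (f n x - g x))\<^sup>2) \<le> ennreal (e\<^sup>2)"
        using b nn_integral_eq_integral[OF i] by simp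
      then show ?thesis using i by (simp add: L2m_def)
    qed
    then show ?thesis by blast
  qed
  have g: "L2m M g"
  proof -
    obtain n where "L2m M (\<lambda>x. f n x - g x)" using close[of 1] by auto
    from L2m_diff[OF f this, of n] show ?thesis by simp
  qed
  have "(\<lambda>n. sqrt (LINT x|M. (norm (f n x - g x))\<^sup>2)) \<longlonglongrightarrow> 0"
  proof (rule LIMSEQ_I)
    fix e :: real assume e: "e > 0"
    obtain N where N: "\<And>n. n \<ge> N \<Longrightarrow> (LINT x|M. (norm (f n x - g x))\<^sup>2) \<le> (e/2)\<^sup>2" using close[of "e/2"] e by auto
    have "norm (sqrt (LINT x|M. (norm (f n x - g x))\<^sup>2) - 0) < e" if "n \<ge> N" for n
    proof -
      have "sqrt (LINT x|M. (norm (f n x - g x))\<^sup>2) \<le> e / 2"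
        using N[OF that] e by (intro real_le_lsqrt) auto
      then show ?thesis using e by (simp add: integral_nonneg_AE)
    qed
    then show "\<exists>N. \<forall>n\<ge>N. norm (sqrt (LINT x|M. (norm (f n x - g x))\<^sup>2) - 0) < e" by blast
  qed
  then show ?thesis using that g r(1) lim by blast
qed

text \<open>The pointwise constraint covers both uses: n = 0 imposes nothing and gives the full
  space, the unit normal gives the tangential fields.\<close>

lemma semihilbert_L2:
  fixes M :: "'x measure" and n :: "'x \<Rightarrow> real^3"
  shows "semihilbert fscale {f. L2m M f \<and> (AE x in M. ndot (n x) (f x) = 0)} (ipm M)"
proof -
  interpret module "fscale :: complex \<Rightarrow> ('x \<Rightarrow> cv) \<Rightarrow> _" by (rule module_fscale)
  show ?thesis
  proof (unfold_locales, goal_cases)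
    case 1 show ?case by (simp add: L2m_zero zero_fun_def ndot_simps)
  next
    case (2 f g)
    have "AE x in M. ndot (n x) (f x + g x) = 0"
      using 2 by (auto simp: ndot_simps)
    then show ?case using 2 by (simp add: plus_fun_def L2m_add)
  next
    case (3 f a) then show ?case by (simp add: fscale_def L2m_scale ndot_simps)
  next
    case (4 f g h) then show ?case by (simp add: plus_fun_def ipm_add_left)
  next
    case (5 f g a) show ?case by (simp add: fscale_def ipm_scale_left)
  next
    case (6 f g) show ?case by (rule ipm_cnj)
  next
    case (7 f) show ?case by (simp add: ipm_self)
  next
    case (8 s)
    have s: "L2m M (s k)" "AE x in M. ndot (n x) (s k x) = 0" for k using 8(1)[of k] by auto
    obtain g r where g: "L2m M g" "(\<lambda>n. sqrt (LINT x|M. (norm (s n x - g x))\<^sup>2)) \<longlonglongrightarrow> 0"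
      "strict_mono (r :: nat \<Rightarrow> nat)" "AE x in M. (\<lambda>k. s (r k) x) \<longlonglongrightarrow> g x"
      using L2m_complete[of M s, OF s(1)] 8(2) by (auto simp: ipm_self)
    have "AE x in M. \<forall>k. ndot (n x) (s (r k) x) = 0" using s(2) by (simp add: AE_all_countable)
    then have "AE x in M. ndot (n x) (g x) = 0" using g(4)
    proof eventually_elim
      case (elim x)
      have "(\<lambda>k. ndot (n x) (s (r k) x)) \<longlonglongrightarrow> ndot (n x) (g x)" by (rule tendsto_ndot[OF elim(2)])
      then show ?case using elim(1) by (simp add: LIMSEQ_const_iff)
    qed
    then show ?case using g by (intro bexI[of _ g]) (auto simp: ipm_self)
  qed
qed

section \<open>Test fields\<close>

lemma pd_eq: "(f has_derivative f') (at x) \<Longrightarrow> pd i f x = f' (axis i 1)"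
  using frechet_derivative_at[of f f' x] by (simp add: pd_def)

lemma pd_has_derivative: "f differentiable (at x) \<Longrightarrow> (f has_derivative frechet_derivative f (at x)) (at x)"
  by (simp add: frechet_derivative_works)

lemma pd_bounded_linear:
  assumes "bounded_linear L" "f differentiable (at x)"
  shows "(\<lambda>y. L (f y)) differentiable (at x)" "pd i (\<lambda>y. L (f y)) x = L (pd i f x)"
proof -
  have d: "((\<lambda>y. L (f y)) has_derivative (\<lambda>h. L (frechet_derivative f (at x) h))) (at x)"
    by (rule bounded_linear.has_derivative[OF assms(1) pd_has_derivative[OF assms(2)]])
  then show "(\<lambda>y. L (f y)) differentiable (at x)" by (auto simp: differentiable_def)
  show "pd i (\<lambda>y. L (f y)) x = L (pd i f x)" using pd_eq[OF d] by (simp add: pd_def)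
qed

lemma pd_mult:
  fixes f g :: "pt \<Rightarrow> 'a::real_normed_algebra"
  assumes "f differentiable (at x)" "g differentiable (at x)"
  shows "pd i (\<lambda>y. f y * g y) x = f x * pd i g x + pd i f x * g x"
  using pd_eq[OF has_derivative_mult[OF pd_has_derivative[OF assms(1)] pd_has_derivative[OF assms(2)]]]
  by (simp add: pd_def)

lemma pd_add:
  assumes "f differentiable (at x)" "g differentiable (at x)"
  shows "pd i (\<lambda>y. f y + g y) x = pd i f x + pd i g x"
  using pd_eq[OF has_derivative_add[OF pd_has_derivative[OF assms(1)] pd_has_derivative[OF assms(2)]]]
  by (simp add: pd_def)

lemma pd_zero_outside:
  assumes "closed K" "\<And>x. x \<notin> K \<Longrightarrow> f x = 0" "x \<notin> K"
  shows "pd i f x = 0"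
proof -
  have "(f has_derivative (\<lambda>h. 0)) (at x)"
    by (rule has_derivative_transform_within_open[of "\<lambda>_. 0" _ _ _ "- K"]) (use assms in auto)
  then show ?thesis using pd_eq by force
qed

lemma has_vector_derivative_line:
  fixes F :: "pt \<Rightarrow> 'b::real_normed_vector"
  assumes "\<And>x. F differentiable (at x)"
  shows "((\<lambda>t. F (x + t *\<^sub>R axis i 1)) has_vector_derivative pd i F (x + t *\<^sub>R axis i 1)) (at t)"
proof -
  let ?e = "axis i 1 :: pt" and ?F' = "frechet_derivative F (at (x + t *\<^sub>R axis i 1))"
  have F: "(F has_derivative ?F') (at (x + t *\<^sub>R ?e))" by (rule pd_has_derivative[OF assms])
  have "((\<lambda>t. x + t *\<^sub>R ?e) has_derivative (\<lambda>h. h *\<^sub>R ?e)) (at t)" by (auto intro!: derivative_eq_intros)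
  from has_derivative_compose[OF this F]
  have "((\<lambda>t. F (x + t *\<^sub>R ?e)) has_derivative (\<lambda>h. ?F' (h *\<^sub>R ?e))) (at t)" .
  moreover have "?F' (h *\<^sub>R ?e) = h *\<^sub>R pd i F (x + t *\<^sub>R ?e)" for h
    using linear_cmul[OF has_derivative_linear[OF F]] by (simp add: pd_def)
  ultimately show ?thesis by (simp add: has_vector_derivative_def)
qed

lemma difference_quotient_tendsto:
  assumes "(f has_vector_derivative D) (at (0::real))"
  shows "((\<lambda>h. (1 / h) *\<^sub>R (f h - f 0)) \<longlongrightarrow> D) (at 0)"
proof -
  have "(\<lambda>h. norm (f (0 + h) - f 0 - h *\<^sub>R D) / norm h) \<midarrow>0\<rightarrow> 0"
    using assms unfolding has_vector_derivative_def has_derivative_at by simp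
  moreover have "norm (f (0 + h) - f 0 - h *\<^sub>R D) / norm h = norm ((1 / h) *\<^sub>R (f h - f 0) - D)" if "h \<noteq> 0" for h
  proof -
    have "(1 / h) *\<^sub>R (f h - f 0) - D = (1 / h) *\<^sub>R (f h - f 0 - h *\<^sub>R D)"
      using that by (simp add: scaleR_diff_right)
    then show ?thesis by simp
  qed
  ultimately have "((\<lambda>h. norm ((1 / h) *\<^sub>R (f h - f 0) - D)) \<longlongrightarrow> 0) (at 0)"
    by (rule Lim_transform_within[OF _ zero_less_one]) auto
  then show ?thesis by (rule LIM_zero_cancel[OF tendsto_norm_zero_cancel])
qed

text \<open>The integral of a difference quotient vanishes because Lebesgue measure is translation
  invariant; dominated convergence carries this over to the derivative.\<close>

lemma integral_pd_zero:
  fixes F :: "pt \<Rightarrow> 'b::{banach, second_countable_topology}"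
  assumes diff: "\<And>x. F differentiable (at x)" and cont: "continuous_on UNIV (pd i F)"
    and K: "compact K" "\<And>x. x \<notin> K \<Longrightarrow> F x = 0"
  shows "(LINT x|lborel. pd i F x) = 0"
proof -
  let ?e = "axis i 1 :: pt"
  have e1: "norm ?e = 1" by simp
  have contF: "continuous_on UNIV F"
    using differentiable_imp_continuous_within[OF diff] by (simp add: continuous_on_eq_continuous_within)
  have [measurable]: "F \<in> borel_measurable borel" "pd i F \<in> borel_measurable borel"
    using contF cont borel_measurable_continuous_onI by blast+
  have intF: "integrable lborel F"
  proof -
    have "integrable lborel (\<lambda>x. indicator K x *\<^sub>R F x)"
      by (rule borel_integrable_compact[OF K(1) continuous_on_subset[OF contF]]) simp
    moreover have "indicator K x *\<^sub>R F x = F x" for x using K(2) by (auto simp: indicator_def)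
    ultimately show ?thesis by simp
  qed
  obtain R where R: "R > 0" "\<And>x. x \<in> K \<Longrightarrow> norm x \<le> R"
    using compact_imp_bounded[OF K(1)] unfolding bounded_pos by blast
  \<comment> \<open>Difference quotients can be nonzero only for |x| \<le> R + 1, and steps of
    length at most 1 from there stay within radius R + 2.\<close>
  have "bounded (pd i F ` cball 0 (R + 2))"
    by (intro compact_imp_bounded compact_continuous_image continuous_on_subset[OF cont]) auto
  then obtain B where B: "B > 0" "\<And>x. norm x \<le> R + 2 \<Longrightarrow> norm (pd i F x) \<le> B"
    unfolding bounded_pos by auto
  define h where "h n = 1 / real (Suc n)" for n
  have h: "0 < h n" "h n \<le> 1" for n by (auto simp: h_def)
  define Q where "Q n x = (1 / h n) *\<^sub>R (F (x + h n *\<^sub>R ?e) - F x)" for n x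
  have [measurable]: "Q n \<in> borel_measurable borel" for n unfolding Q_def by measurable
  have lim: "(\<lambda>n. LINT x|lborel. Q n x) \<longlonglongrightarrow> (LINT x|lborel. pd i F x)"
  proof (rule integral_dominated_convergence)
    show "integrable lborel (\<lambda>x. indicator (cball 0 (R + 1)) x *\<^sub>R B)"
      by (intro borel_integrable_compact) auto
    show "AE x in lborel. (\<lambda>n. Q n x) \<longlonglongrightarrow> pd i F x"
    proof (intro always_eventually allI)
      fix x
      have "((\<lambda>t. (1 / t) *\<^sub>R (F (x + t *\<^sub>R ?e) - F (x + 0 *\<^sub>R ?e))) \<longlongrightarrow> pd i F (x + 0 *\<^sub>R ?e)) (at 0)"
        by (rule difference_quotient_tendsto[OF has_vector_derivative_line[OF diff]])
      moreover have "filterlim h (at 0) sequentially"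
        unfolding filterlim_at h_def using LIMSEQ_inverse_real_of_nat by (simp add: inverse_eq_divide)
      ultimately show "(\<lambda>n. Q n x) \<longlonglongrightarrow> pd i F x"
        unfolding Q_def by (auto dest: filterlim_compose)
    qed
    show "AE x in lborel. norm (Q n x) \<le> indicator (cball 0 (R + 1)) x *\<^sub>R B" for n
    proof (intro always_eventually allI)
      fix x
      show "norm (Q n x) \<le> indicator (cball 0 (R + 1)) x *\<^sub>R B"
      proof (cases "norm x \<le> R + 1")
        case True
        have "norm (F (x + h n *\<^sub>R ?e) - F (x + 0 *\<^sub>R ?e)) \<le> B * h n - B * 0"
        proof (rule differentiable_bound_general[where f = "\<lambda>t. F (x + t *\<^sub>R ?e)" and \<phi> = "\<lambda>t. B * t"
              and f' = "\<lambda>t. pd i F (x + t *\<^sub>R ?e)" and \<phi>' = "\<lambda>t. B"])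
          show "continuous_on {0..h n} (\<lambda>t. F (x + t *\<^sub>R ?e))"
            by (intro continuous_on_compose2[OF contF] continuous_intros) auto
          show "norm (pd i F (x + t *\<^sub>R ?e)) \<le> B" if "0 < t" "t < h n" for t
          proof (rule B(2))
            have "norm (x + t *\<^sub>R ?e) \<le> norm x + norm (t *\<^sub>R ?e)" by (rule norm_triangle_ineq)
            then show "norm (x + t *\<^sub>R ?e) \<le> R + 2" using that h[of n] True by simp
          qed
          show "((*) B has_vector_derivative B) (at t)" for t by (auto intro!: derivative_eq_intros)
        qed (use h has_vector_derivative_line[OF diff] in \<open>auto intro!: continuous_intros\<close>)
        moreover have "norm (Q n x) = norm (F (x + h n *\<^sub>R ?e) - F (x + 0 *\<^sub>R ?e)) / h n"
          using h[of n] by (simp add: Q_def divide_inverse mult.commute)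
        ultimately have "norm (Q n x) \<le> B" using h[of n] by (simp add: pos_divide_le_eq)
        then show ?thesis using True by (simp add: indicator_def)
      next
        case False
        have "norm x \<le> norm (x + h n *\<^sub>R ?e) + norm (h n *\<^sub>R ?e)"
          using norm_triangle_ineq4[of "x + h n *\<^sub>R ?e" "h n *\<^sub>R ?e"] by simp
        then have "norm (x + h n *\<^sub>R ?e) > R" using False h[of n] by simp
        then have "x \<notin> K" "x + h n *\<^sub>R ?e \<notin> K" using R(2)[of x] R(2)[of "x + h n *\<^sub>R ?e"] False by auto
        then show ?thesis using K(2) B(1) by (simp add: Q_def indicator_def)
      qed
    qed
  qed auto
  have "(LINT x|lborel. Q n x) = 0" for n
  proof -
    have d: "distr lborel borel ((+) (h n *\<^sub>R ?e)) = (lborel :: pt measure)" by (rule lborel_distr_plus)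
    have i: "integrable lborel (\<lambda>x. F (h n *\<^sub>R ?e + x))"
      using intF by (subst (asm) d[symmetric]) (simp add: integrable_distr_eq)
    have "(LINT x|lborel. F x) = (LINT x|distr lborel borel ((+) (h n *\<^sub>R ?e)). F x)" by (simp add: d)
    also have "\<dots> = (LINT x|lborel. F (h n *\<^sub>R ?e + x))" by (rule integral_distr) auto
    finally show ?thesis using i intF by (simp add: Q_def add.commute[of _ "h n *\<^sub>R ?e"])
  qed
  then show ?thesis using lim by (simp add: LIMSEQ_const_iff)
qed

section \<open>Integration by parts for the curl of test fields\<close>

lemma integral_compact_support:
  fixes G :: "pt \<Rightarrow> 'b::{banach, second_countable_topology}"
  assumes "open \<Omega>" "continuous_on UNIV G" "compact K" "K \<subseteq> \<Omega>" "\<And>x. x \<notin> K \<Longrightarrow> G x = 0"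
  shows "integrable (lebesgue_on \<Omega>) G" "(LINT x|lebesgue_on \<Omega>. G x) = (LINT x|lborel. G x)"
    "integrable lborel G" "G \<in> borel_measurable (lebesgue_on \<Omega>)"
proof -
  have m [measurable]: "G \<in> borel_measurable borel" using assms(2) by (rule borel_measurable_continuous_onI)
  have "integrable lborel (\<lambda>x. indicator K x *\<^sub>R G x)"
    by (rule borel_integrable_compact[OF assms(3) continuous_on_subset[OF assms(2)]]) simp
  moreover have "indicator K x *\<^sub>R G x = G x" for x using assms(5) by (auto simp: indicator_def)
  ultimately show i: "integrable lborel G" by simp
  have *: "indicator \<Omega> x *\<^sub>R G x = G x" for x using assms(4,5) by (auto simp: indicator_def)
  have O: "\<Omega> \<inter> space lebesgue \<in> sets lebesgue" using assms(1) by simp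
  have mc: "G \<in> borel_measurable lebesgue" using m by (simp add: measurable_completion)
  show "integrable (lebesgue_on \<Omega>) G"
    using i by (simp add: integrable_restrict_space[OF O] * integrable_completion)
  show "(LINT x|lebesgue_on \<Omega>. G x) = (LINT x|lborel. G x)"
    by (simp add: integral_restrict_space[OF O] * integral_completion)
  show "G \<in> borel_measurable (lebesgue_on \<Omega>)" using mc by (rule measurable_restrict_space1)
qed

lemma Cinf_differentiable: "Cinf UNIV f \<Longrightarrow> f differentiable (at x)"
  and Cinf_continuous: "Cinf UNIV f \<Longrightarrow> continuous_on UNIV f"
  and Cinf_continuous_pd: "Cinf UNIV f \<Longrightarrow> continuous_on UNIV (pd i f)"
proof -
  assume "Cinf UNIV f"
  then have "Ck 0 UNIV f" "Ck (Suc 0) UNIV f" unfolding Cinf_def by blast+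
  then show "f differentiable (at x)" "continuous_on UNIV f" "continuous_on UNIV (pd i f)" by simp_all
qed

lemma pd_component:
  assumes "f differentiable (at x)"
  shows "pd i (\<lambda>y. (f y :: 'a::real_normed_vector^'n) $ k) x = pd i f x $ k"
  by (rule pd_bounded_linear[OF bounded_linear_vec_nth assms])

lemma curl_component:
  assumes "f differentiable (at x)"
  shows "curl f x = (\<chi> i. if i = 1 then pd 2 f x $ 3 - pd 3 f x $ 2
    else if i = 2 then pd 3 f x $ 1 - pd 1 f x $ 3 else pd 1 f x $ 2 - pd 2 f x $ 1)"
  unfolding curl_def pd_component[OF assms] ..

lemma test_field_support:
  assumes "test_field \<Omega> \<phi>"
  obtains K where "compact K" "K \<subseteq> \<Omega>" "\<And>x. x \<notin> K \<Longrightarrow> \<phi> x = 0" "\<And>i x. x \<notin> K \<Longrightarrow> pd i \<phi> x = 0"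
proof -
  let ?K = "closure {x. \<phi> x \<noteq> 0}"
  have z: "\<phi> x = 0" if "x \<notin> ?K" for x using that closure_subset[of "{x. \<phi> x \<noteq> 0}"] by auto
  show ?thesis
  proof (rule that)
    show "compact ?K" "?K \<subseteq> \<Omega>" using assms by (auto simp: test_field_def)
    show "pd i \<phi> x = 0" if "x \<notin> ?K" for i x by (rule pd_zero_outside[OF closed_closure z that])
  qed (rule z)
qed

lemma test_fieldD:
  assumes "test_field \<Omega> \<phi>"
  shows "\<phi> differentiable (at x)" "continuous_on UNIV \<phi>" "continuous_on UNIV (pd i \<phi>)"
  using assms Cinf_differentiable Cinf_continuous Cinf_continuous_pd by (auto simp: test_field_def)

lemma continuous_curl:
  assumes "test_field \<Omega> \<phi>"
  shows "continuous_on UNIV (curl \<phi>)"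
proof -
  note [continuous_intros] = test_fieldD(3)[OF assms]
  have "curl \<phi> = (\<lambda>x. \<chi> i. if i = 1 then pd 2 \<phi> x $ 3 - pd 3 \<phi> x $ 2
    else if i = 2 then pd 3 \<phi> x $ 1 - pd 1 \<phi> x $ 3 else pd 1 \<phi> x $ 2 - pd 2 \<phi> x $ 1)"
    using curl_component[OF test_fieldD(1)[OF assms]] by auto
  moreover have "continuous_on UNIV \<dots>"
  proof (rule continuous_on_vec_lambda)
    fix i :: 3
    show "continuous_on UNIV (\<lambda>x. if i = 1 then pd 2 \<phi> x $ 3 - pd 3 \<phi> x $ 2
      else if i = 2 then pd 3 \<phi> x $ 1 - pd 1 \<phi> x $ 3 else pd 1 \<phi> x $ 2 - pd 2 \<phi> x $ 1)"
      by (cases "i = 1"; cases "i = 2"; simp; intro continuous_intros)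
  qed
  ultimately show ?thesis by simp
qed

lemma L2_iff_L2m: "L2 \<Omega> f \<longleftrightarrow> L2m (lebesgue_on \<Omega>) f"
  by (simp add: L2_def L2m_def)

lemma l2ip_eq_ipm: "l2ip \<Omega> = ipm (lebesgue_on \<Omega>)"
  by (simp add: l2ip_def ipm_def fun_eq_iff)

lemma L2_compact_support:
  assumes "open \<Omega>" "continuous_on UNIV G" "compact K" "K \<subseteq> \<Omega>" "\<And>x. x \<notin> K \<Longrightarrow> G x = 0"
  shows "L2 \<Omega> G"
  unfolding L2_def
proof
  show "G \<in> borel_measurable (lebesgue_on \<Omega>)" by (rule integral_compact_support(4)[OF assms])
  show "integrable (lebesgue_on \<Omega>) (\<lambda>x. (norm (G x))\<^sup>2)"
    by (rule integral_compact_support(1)[OF assms(1) _ assms(3,4)]) (use assms in \<open>auto intro!: continuous_intros\<close>)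
qed

lemma L2_test_field:
  assumes "open \<Omega>" "test_field \<Omega> \<phi>"
  shows "L2 \<Omega> \<phi>" "L2 \<Omega> (curl \<phi>)"
proof -
  obtain K where K: "compact K" "K \<subseteq> \<Omega>" "\<And>x. x \<notin> K \<Longrightarrow> \<phi> x = 0" "\<And>i x. x \<notin> K \<Longrightarrow> pd i \<phi> x = 0"
    using test_field_support[OF assms(2)] by blast
  show "L2 \<Omega> \<phi>" by (rule L2_compact_support[OF assms(1) test_fieldD(2)[OF assms(2)] K(1,2,3)])
  have "curl \<phi> x = 0" if "x \<notin> K" for x
    using K(4)[OF that] by (simp add: curl_component[OF test_fieldD(1)[OF assms(2)]] vec_eq_iff)
  then show "L2 \<Omega> (curl \<phi>)" by (rule L2_compact_support[OF assms(1) continuous_curl[OF assms(2)] K(1,2)])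
qed

text \<open>By the product rule \<open>G i a b\<close> is the i-th partial derivative of the
  compactly supported function \<open>\<phi> x $ a * cnj (\<psi> x $ b)\<close>.\<close>

lemma integral_pd_product:
  assumes \<phi>: "test_field \<Omega> \<phi>" and \<psi>: "test_field \<Omega> \<psi>"
  defines "G \<equiv> (\<lambda>i a b x. \<phi> x $ a * cnj (pd i \<psi> x $ b) + pd i \<phi> x $ a * cnj (\<psi> x $ b))"
  shows "(LINT x|lborel. G i a b x) = 0" "continuous_on UNIV (G i a b)"
proof -
  note d\<phi> = test_fieldD(1)[OF \<phi>] and d\<psi> = test_fieldD(1)[OF \<psi>]
  note [continuous_intros] = test_fieldD(2,3)[OF \<phi>] test_fieldD(2,3)[OF \<psi>]
  obtain K where K: "compact K" "\<And>x. x \<notin> K \<Longrightarrow> \<phi> x = 0" using test_field_support[OF \<phi>] by metis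
  let ?F = "\<lambda>x. \<phi> x $ a * cnj (\<psi> x $ b)"
  have bl: "bounded_linear (\<lambda>v::cv. cnj (v $ b))"
    by (rule bounded_linear_compose[OF bounded_linear_cnj bounded_linear_vec_nth])
  have "pd i ?F = G i a b"
    unfolding G_def using pd_mult[OF pd_bounded_linear(1)[OF bounded_linear_vec_nth d\<phi>] pd_bounded_linear(1)[OF bl d\<psi>]]
    by (auto simp: pd_component[OF d\<phi>] pd_bounded_linear(2)[OF bl d\<psi>])
  moreover show c: "continuous_on UNIV (G i a b)" unfolding G_def by (intro continuous_intros)
  moreover have "?F differentiable (at x)" for x
    by (intro differentiable_mult pd_bounded_linear(1)[OF bounded_linear_vec_nth d\<phi>] pd_bounded_linear(1)[OF bl d\<psi>])
  ultimately show "(LINT x|lborel. G i a b x) = 0"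
    using integral_pd_zero[of ?F i K] K by simp
qed

lemma curl_symmetric:
  assumes "open \<Omega>" and \<phi>: "test_field \<Omega> \<phi>" and \<psi>: "test_field \<Omega> \<psi>"
  shows "l2ip \<Omega> \<phi> (curl \<psi>) = l2ip \<Omega> (curl \<phi>) \<psi>"
proof -
  define G where "G = (\<lambda>i a b x. \<phi> x $ a * cnj (pd i \<psi> x $ b) + pd i \<phi> x $ a * cnj (\<psi> x $ b))"
  have G0: "(LINT x|lborel. G i a b x) = 0" and Gc: "continuous_on UNIV (G i a b)" for i a b
    unfolding G_def by (rule integral_pd_product[OF \<phi> \<psi>])+
  obtain K where K: "compact K" "K \<subseteq> \<Omega>" "\<And>x. x \<notin> K \<Longrightarrow> \<phi> x = 0" "\<And>i x. x \<notin> K \<Longrightarrow> pd i \<phi> x = 0"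
    using test_field_support[OF \<phi>] by blast
  have Gi: "integrable (lebesgue_on \<Omega>) (G i a b)" "(LINT x|lebesgue_on \<Omega>. G i a b x) = 0" for i a b
    using integral_compact_support(1,2)[OF assms(1) Gc K(1,2), of i a b] G0 K(3,4) by (simp_all add: G_def)
  \<comment> \<open>The difference is the divergence of the cross product of \<phi> with the
    conjugate of \<psi>, written out as six derivatives of products.\<close>
  have "cdot (curl \<phi> x) (\<psi> x) - cdot (\<phi> x) (curl \<psi> x)
      = (G 1 2 3 x - G 1 3 2 x) + (G 2 3 1 x - G 2 1 3 x) + (G 3 1 2 x - G 3 2 1 x)" for x
    by (simp add: G_def cdot_def sum_3 curl_component[OF test_fieldD(1)[OF \<phi>]]
        curl_component[OF test_fieldD(1)[OF \<psi>]] algebra_simps)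
  then have "(LINT x|lebesgue_on \<Omega>. cdot (curl \<phi> x) (\<psi> x) - cdot (\<phi> x) (curl \<psi> x)) = 0"
    using Gi by simp
  moreover have "integrable (lebesgue_on \<Omega>) (\<lambda>x. cdot (curl \<phi> x) (\<psi> x))" "integrable (lebesgue_on \<Omega>) (\<lambda>x. cdot (\<phi> x) (curl \<psi> x))"
    using L2_test_field[OF assms(1)] \<phi> \<psi> by (auto intro!: integrable_cdot simp: L2_iff_L2m[symmetric])
  ultimately show ?thesis by (simp add: l2ip_def)
qed

lemma is_dcurl_test_field:
  assumes "open \<Omega>" "test_field \<Omega> \<phi>"
  shows "is_dcurl \<Omega> \<phi> (curl \<phi>)"
  using assms L2_test_field curl_symmetric by (simp add: is_dcurl_def)

lemma test_field_zero: "test_field \<Omega> (\<lambda>x. 0)"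
proof -
  have "Ck k UNIV (\<lambda>x. 0 :: cv)" for k
  proof (induction k)
    case (Suc k)
    have "pd i (\<lambda>x. 0 :: cv) = (\<lambda>x. 0)" for i using pd_eq[OF has_derivative_const] by force
    then show ?case using Suc by simp
  qed simp
  then show ?thesis by (simp add: test_field_def Cinf_def)
qed

section \<open>Smooth approximation of open sets\<close>

text \<open>The standard flat function exp (-1/t) with powers of 1/t attached, so that derivatives
  stay in the linear span of the family (\<open>flat_deriv\<close>).\<close>

definition flat :: "nat \<Rightarrow> real \<Rightarrow> real" where
  "flat k t = (if t \<le> 0 then 0 else inverse t ^ k * exp (- inverse t))"

lemma flat_tendsto_zero: "(flat k \<longlongrightarrow> 0) (at 0)"
proof (rule filterlim_split_at)
  show "(flat k \<longlongrightarrow> 0) (at_left 0)"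
    by (rule tendsto_eventually) (auto simp: flat_def eventually_at_left_field intro: exI[of _ "-1"])
  have "((\<lambda>t. inverse t ^ k / exp (inverse t)) \<longlongrightarrow> (0::real)) (at_right 0)"
    by (rule filterlim_compose[OF tendsto_power_div_exp_0 filterlim_inverse_at_top_right])
  then show "(flat k \<longlongrightarrow> 0) (at_right 0)"
  proof (rule Lim_transform_eventually)
    show "\<forall>\<^sub>F t in at_right 0. inverse t ^ k / exp (inverse t) = flat k t"
      by (auto simp: flat_def eventually_at_right_field exp_minus divide_inverse intro: exI[of _ 1])
  qed
qed

lemma flat_deriv:
  "(flat k has_real_derivative (flat (k + 2) t - real k * flat (k + 1) t)) (at t)"
proof -
  consider "t > 0" | "t < 0" | "t = 0" by linarith
  then show ?thesis
  proof cases
    case 1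
    have "((\<lambda>t. inverse t ^ k * exp (- inverse t)) has_real_derivative (flat (k + 2) t - real k * flat (k + 1) t)) (at t)"
    proof -
      have d1: "((\<lambda>t. inverse t ^ k) has_real_derivative (real k * inverse t ^ (k - 1) * (- (inverse t)\<^sup>2))) (at t)"
        using 1 by (auto intro!: derivative_eq_intros simp: power2_eq_square)
      have d2: "((\<lambda>t. exp (- inverse t)) has_real_derivative (exp (- inverse t) * (inverse t)\<^sup>2)) (at t)"
        using 1 by (auto intro!: derivative_eq_intros simp: power2_eq_square)
      have "real k * inverse t ^ (k - 1) * (- (inverse t)\<^sup>2) * exp (- inverse t) + exp (- inverse t) * (inverse t)\<^sup>2 * inverse t ^ k
          = flat (k + 2) t - real k * flat (k + 1) t"
        \<comment> \<open>At k = 0 the exponent k - 1 is truncated, but its factor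
          \<open>real k\<close> vanishes.\<close>
        using 1 by (cases k) (simp_all add: flat_def algebra_simps power2_eq_square)
      with DERIV_mult[OF d1 d2] show ?thesis by simp
    qed
    then show ?thesis
      by (rule has_field_derivative_transform_within_open[of _ _ _ "{0<..}"]) (use 1 in \<open>auto simp: flat_def\<close>)
  next
    case 2
    have "((\<lambda>t. 0) has_real_derivative (flat (k + 2) t - real k * flat (k + 1) t)) (at t)"
      using 2 by (simp add: flat_def)
    then show ?thesis
      by (rule has_field_derivative_transform_within_open[of _ _ _ "{..<0}"]) (use 2 in \<open>auto simp: flat_def\<close>)
  next
    case 3
    \<comment> \<open>Away from 0 the difference quotient is \<open>flat (Suc k)\<close>.\<close>
    have "((\<lambda>y. (flat k y - flat k 0) / (y - 0)) \<longlongrightarrow> 0) (at 0)"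
      by (rule Lim_transform_eventually[OF flat_tendsto_zero[of "Suc k"]])
         (auto simp: flat_def eventually_at_filter divide_inverse)
    then show ?thesis unfolding 3 by (simp add: has_field_derivative_iff flat_def)
  qed
qed

lemma flat0_bounds: "0 \<le> flat 0 t" "flat 0 t \<le> 1"
  by (auto simp: flat_def)

lemma flat0_tendsto_one:
  assumes "c > 0"
  shows "(\<lambda>n. flat 0 (real (Suc n) * c - 1)) \<longlonglongrightarrow> 1"
proof -
  have "filterlim (\<lambda>n. c * real (Suc n)) at_top sequentially"
    by (rule filterlim_tendsto_pos_mult_at_top[OF tendsto_const assms
          filterlim_compose[OF filterlim_real_sequentially filterlim_Suc]])
  from filterlim_tendsto_add_at_top[OF tendsto_const[of "-1"] this]
  have lim: "filterlim (\<lambda>n. real (Suc n) * c - 1) at_top sequentially"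
    by (simp add: algebra_simps)
  then have "(\<lambda>n. exp (- inverse (real (Suc n) * c - 1))) \<longlonglongrightarrow> exp (- 0)"
    by (intro tendsto_exp tendsto_minus tendsto_inverse_0_at_top)
  moreover have "\<forall>\<^sub>F n in sequentially. exp (- inverse (real (Suc n) * c - 1)) = flat 0 (real (Suc n) * c - 1)"
  proof -
    have "\<forall>\<^sub>F n in sequentially. real (Suc n) * c - 1 > 0"
      using lim unfolding filterlim_at_top_dense by blast
    then show ?thesis by eventually_elim (simp add: flat_def)
  qed
  ultimately show ?thesis by (auto intro: Lim_transform_eventually)
qed

text \<open>A class of functions on which partial derivatives act, rich enough to approximate the
  indicator functions of open sets.\<close>

inductive smooth :: "(pt \<Rightarrow> real) \<Rightarrow> bool" where
  smooth_const: "smooth (\<lambda>x. c)"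
| smooth_flat: "smooth (\<lambda>x. flat k (a * x $ i + b))"
| smooth_add: "smooth f \<Longrightarrow> smooth g \<Longrightarrow> smooth (\<lambda>x. f x + g x)"
| smooth_mult: "smooth f \<Longrightarrow> smooth g \<Longrightarrow> smooth (\<lambda>x. f x * g x)"

lemma smooth_pd: "smooth f \<Longrightarrow> (\<forall>x. f differentiable (at x)) \<and> (\<forall>j. smooth (pd j f))"
proof (induction rule: smooth.induct)
  case (smooth_const c)
  have "pd j (\<lambda>x. c) = (\<lambda>x. 0)" for j using pd_eq[OF has_derivative_const] by force
  then show ?case by (simp add: smooth.intros)
next
  case (smooth_flat k a i b)
  let ?D = "\<lambda>x :: pt. flat (k + 2) (a * x $ i + b) + (- real k) * flat (k + 1) (a * x $ i + b)"
  have d: "((\<lambda>x. flat k (a * x $ i + b)) has_derivative (\<lambda>h. ?D x * (a * h $ i))) (at x)" for x :: pt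
  proof -
    have "((\<lambda>x. a * x $ i + b) has_derivative (\<lambda>h. a * h $ i)) (at x)"
      by (auto intro!: derivative_eq_intros bounded_linear.has_derivative[OF bounded_linear_vec_nth])
    from has_derivative_compose[OF this flat_deriv[of k "a * x $ i + b", unfolded has_field_derivative_def]]
    show ?thesis by simp
  qed
  have e: "pd j (\<lambda>x. flat k (a * x $ i + b)) = (\<lambda>x. ?D x * (a * axis j 1 $ i))" for j
    using pd_eq[OF d] by blast
  have "smooth (pd j (\<lambda>x. flat k (a * x $ i + b)))" for j
    unfolding e by (rule smooth.smooth_mult smooth.smooth_add smooth.smooth_flat smooth.smooth_const)+
  moreover have "(\<lambda>x. flat k (a * x $ i + b)) differentiable (at x)" for x
    using d unfolding differentiable_def by blast
  ultimately show ?case by blast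
next
  case (smooth_add f g)
  have "pd j (\<lambda>x. f x + g x) = (\<lambda>x. pd j f x + pd j g x)" for j using pd_add smooth_add.IH by blast
  then show ?case using smooth_add by (auto intro!: smooth.intros)
next
  case (smooth_mult f g)
  have "pd j (\<lambda>x. f x * g x) = (\<lambda>x. f x * pd j g x + pd j f x * g x)" for j using pd_mult smooth_mult.IH by blast
  then show ?case using smooth_mult by (auto intro!: smooth.intros)
qed

lemma smooth_continuous: "smooth f \<Longrightarrow> continuous_on UNIV f"
  using smooth_pd[of f] differentiable_imp_continuous_within by (auto simp: continuous_on_eq_continuous_within)

lemma smooth_prod: "finite I \<Longrightarrow> (\<And>i. i \<in> I \<Longrightarrow> smooth (f i)) \<Longrightarrow> smooth (\<lambda>x. \<Prod>i\<in>I. f i x)"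
  by (induction I rule: finite_induct) (auto intro: smooth.intros)

lemma smooth_diff: "smooth f \<Longrightarrow> smooth g \<Longrightarrow> smooth (\<lambda>x. f x - g x)"
  using smooth_add[OF _ smooth_mult[OF smooth_const[of "-1"]], of f g] by simp

lemma Ck_smooth: "smooth f \<Longrightarrow> Ck k UNIV (\<lambda>x. f x *\<^sub>R v)"
proof (induction k arbitrary: f)
  case 0
  then show ?case using smooth_continuous by (auto intro!: continuous_intros)
next
  case (Suc k)
  have d: "f differentiable (at x)" for x using smooth_pd[OF Suc.prems] by blast
  have "pd i (\<lambda>x. f x *\<^sub>R v) = (\<lambda>x. pd i f x *\<^sub>R v)" for i
    using pd_bounded_linear(2)[OF bounded_linear_scaleR_left d] by blast
  then show ?case using pd_bounded_linear(1)[OF bounded_linear_scaleR_left d] Suc.IH smooth_pd[OF Suc.prems] by simp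
qed

text \<open>Zero outside the box from \<open>a\<close> to \<open>b\<close> and within distance 1/m
  of its faces, tending to 1 inside as m grows. The offset 1 in each argument is what keeps the
  support compactly inside.\<close>

definition bump :: "pt \<Rightarrow> pt \<Rightarrow> real \<Rightarrow> pt \<Rightarrow> real" where
  "bump a b m x = (\<Prod>i\<in>UNIV. flat 0 (m * x $ i + (- m * a $ i - 1)) * flat 0 ((- m) * x $ i + (m * b $ i - 1)))"

lemma smooth_bump: "smooth (bump a b m)"
  unfolding bump_def by (intro smooth_prod smooth_mult smooth_flat) auto

lemma bump_bounds: "0 \<le> bump a b m x" "bump a b m x \<le> 1"
  unfolding bump_def by (auto intro!: prod_nonneg prod_le_1 mult_nonneg_nonneg mult_le_one flat0_bounds)

lemma bump_support:
  assumes "m > 0" "bump a b m x \<noteq> 0"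
  shows "x \<in> cbox (a + (\<chi> i. 1 / m)) (b - (\<chi> i. 1 / m))"
proof -
  have "flat 0 (m * x $ i + (- m * a $ i - 1)) \<noteq> 0 \<and> flat 0 ((- m) * x $ i + (m * b $ i - 1)) \<noteq> 0" for i
    using assms(2) unfolding bump_def by simp
  then have "m * x $ i + (- m * a $ i - 1) > 0 \<and> (- m) * x $ i + (m * b $ i - 1) > 0" for i
    by (metis flat_def not_le)
  then show ?thesis using assms(1) unfolding mem_box_cart
    by (auto simp: field_simps less_imp_le)
qed

lemma cbox_shrink_sub:
  assumes "m > 0"
  shows "cbox (a + (\<chi> i. 1 / m)) (b - (\<chi> i. 1 / m)) \<subseteq> box a (b :: pt)"
proof
  fix x assume x: "x \<in> cbox (a + (\<chi> i. 1 / m)) (b - (\<chi> i. 1 / m))"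
  have m: "1 / m > 0" using assms by simp
  have "a $ i + 1 / m \<le> x $ i \<and> x $ i \<le> b $ i - 1 / m" for i using x unfolding mem_box_cart by simp
  then have "a $ i < x $ i \<and> x $ i < b $ i" for i using m by (smt (verit))
  then show "x \<in> box a b" unfolding mem_box_cart by simp
qed

lemma bump_tendsto:
  assumes "x \<in> box a b"
  shows "(\<lambda>n. bump a b (real (Suc n)) x) \<longlonglongrightarrow> 1"
proof -
  have *: "(\<lambda>n. flat 0 (real (Suc n) * x $ i + (- real (Suc n) * a $ i - 1)) *
      flat 0 ((- real (Suc n)) * x $ i + (real (Suc n) * b $ i - 1))) \<longlonglongrightarrow> 1 * 1" for i
  proof -
    have c: "x $ i - a $ i > 0" "b $ i - x $ i > 0" using assms unfolding mem_box_cart by auto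
    have e: "real (Suc n) * x $ i + (- real (Suc n) * a $ i - 1) = real (Suc n) * (x $ i - a $ i) - 1"
      "(- real (Suc n)) * x $ i + (real (Suc n) * b $ i - 1) = real (Suc n) * (b $ i - x $ i) - 1" for n
      by (simp_all add: algebra_simps del: of_nat_Suc)
    show ?thesis unfolding e by (intro tendsto_mult flat0_tendsto_one c)
  qed
  have "(\<lambda>n. bump a b (real (Suc n)) x) \<longlonglongrightarrow> (\<Prod>i\<in>(UNIV::3 set). 1 * 1)"
    unfolding bump_def by (rule tendsto_prod) (rule *)
  then show ?thesis by simp
qed

text \<open>An open set is a countable union of boxes, and one minus the product of (1 - bump) is a
  smooth substitute for the indicator of a union. The index n governs both the number of boxes and
  the sharpness of each bump.\<close>

lemma open_indicator_approximation:
  fixes U :: "pt set"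
  assumes "open U"
  obtains f where "\<And>n::nat. smooth (f n)" "\<And>n x. 0 \<le> f n x" "\<And>n x. f n x \<le> 1"
    "\<And>n. \<exists>K. compact K \<and> K \<subseteq> U \<and> (\<forall>x. x \<notin> K \<longrightarrow> f n x = 0)"
    "\<And>x. (\<lambda>n. f n x) \<longlonglongrightarrow> indicator U x"
proof -
  obtain D where D: "countable D" "\<And>X. X \<in> D \<Longrightarrow> \<exists>a b. X = box a b" "\<Union>D = U"
    using open_countable_Union_open_box[OF assms] by metis
  \<comment> \<open>The empty box keeps the enumeration by \<open>from_nat_into\<close> meaningful
    when \<open>D\<close> is empty.\<close>
  define D' where "D' = insert {} D"
  have D': "countable D'" "D' \<noteq> {}" "\<Union>D' = U" "\<And>X. X \<in> D' \<Longrightarrow> \<exists>a b. X = box a b"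
  proof -
    have "box (0::pt) 0 = {}" by (auto simp: mem_box_cart)
    then show "\<And>X. X \<in> D' \<Longrightarrow> \<exists>a b. X = box a b" using D(2) unfolding D'_def by (metis insertE)
  qed (use D in \<open>auto simp: D'_def\<close>)
  define X where "X = from_nat_into D'"
  have X: "range X = D'" unfolding X_def using D' by (simp add: range_from_nat_into)
  then have "\<forall>j. \<exists>a b. X j = box a b" using D'(4) by blast
  then obtain a b where ab: "\<And>j. X j = box (a j) (b j)" by metis
  have U: "U = (\<Union>j. box (a j) (b j))" using X D'(3) ab by auto
  define p where "p n x = (\<Prod>j<n. 1 - bump (a j) (b j) (real (Suc n)) x)" for n x
  define f where "f n x = 1 - p n x" for n x
  have p01: "0 \<le> p n x" "p n x \<le> 1" for n x
    unfolding p_def using bump_bounds by (auto intro!: prod_nonneg prod_le_1)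
  show ?thesis
  proof (rule that)
    show "smooth (f n)" for n unfolding f_def p_def
      by (intro smooth_diff smooth_const smooth_prod smooth_bump) auto
    show "0 \<le> f n x" "f n x \<le> 1" for n x using p01[of n x] by (auto simp: f_def)
    show "\<exists>K. compact K \<and> K \<subseteq> U \<and> (\<forall>x. x \<notin> K \<longrightarrow> f n x = 0)" for n
    proof -
      let ?v = "(\<chi> i. 1 / real (Suc n)) :: pt"
      let ?K = "\<Union>j<n. cbox (a j + ?v) (b j - ?v)"
      have "?K \<subseteq> U" unfolding U using cbox_shrink_sub[of "real (Suc n)"] by fastforce
      moreover have "compact ?K" by (intro compact_UN) auto
      moreover have "f n x = 0" if x: "x \<notin> ?K" for x
      proof -
        have "bump (a j) (b j) (real (Suc n)) x = 0" if "j < n" for j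
          using bump_support[of "real (Suc n)" "a j" "b j" x] x that by auto
        then show ?thesis by (simp add: f_def p_def)
      qed
      ultimately show ?thesis by blast
    qed
    show "(\<lambda>n. f n x) \<longlonglongrightarrow> indicator U x" for x
    proof (cases "x \<in> U")
      case True
      then obtain j where j: "x \<in> box (a j) (b j)" using U by auto
      \<comment> \<open>All factors lie in [0, 1], so the product is at most the single factor of a
        box containing \<open>x\<close>.\<close>
      have "p n x \<le> 1 - bump (a j) (b j) (real (Suc n)) x" if "n > j" for n
      proof -
        have "p n x = (1 - bump (a j) (b j) (real (Suc n)) x) * (\<Prod>k\<in>{..<n} - {j}. 1 - bump (a k) (b k) (real (Suc n)) x)"
          unfolding p_def using that by (intro prod.remove) auto
        also have "\<dots> \<le> (1 - bump (a j) (b j) (real (Suc n)) x) * 1"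
          using bump_bounds by (intro mult_left_mono prod_le_1) auto
        finally show ?thesis by simp
      qed
      then have "\<forall>\<^sub>F n in sequentially. norm (p n x) \<le> 1 - bump (a j) (b j) (real (Suc n)) x"
        unfolding eventually_sequentially using p01 by (intro exI[of _ "Suc j"]) auto
      moreover have "(\<lambda>n. 1 - bump (a j) (b j) (real (Suc n)) x) \<longlonglongrightarrow> 0"
        using tendsto_diff[OF tendsto_const[of 1] bump_tendsto[OF j]] by simp
      ultimately have "(\<lambda>n. p n x) \<longlonglongrightarrow> 0" by (rule Lim_null_comparison)
      from tendsto_diff[OF tendsto_const[of 1] this] show ?thesis using True by (simp add: f_def)
    next
      case False
      have "bump (a j) (b j) (real (Suc n)) x = 0" for j n
        using bump_support[of "real (Suc n)" "a j" "b j" x] cbox_shrink_sub[of "real (Suc n)" "a j" "b j"] False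
        unfolding U by fastforce
      then show ?thesis using False by (simp add: f_def p_def)
    qed
  qed
qed

lemma test_field_smooth:
  assumes "smooth f" "compact K" "K \<subseteq> \<Omega>" "\<And>x. x \<notin> K \<Longrightarrow> f x = 0"
  shows "test_field \<Omega> (\<lambda>x. f x *\<^sub>R v)"
proof -
  have sub: "closure {x. f x *\<^sub>R v \<noteq> 0} \<subseteq> K"
    using assms(2,4) by (intro closure_minimal compact_imp_closed) auto
  then have "compact (closure {x. f x *\<^sub>R v \<noteq> 0})"
    using assms(2) by (metis closed_closure compact_Int_closed inf.absorb_iff2)
  then show ?thesis using sub assms(1,3) Ck_smooth by (auto simp: test_field_def Cinf_def)
qed

section \<open>The fundamental lemma for test fields\<close>

text \<open>Inner regularity reduces the claim to closed sets \<open>T\<close> on which g is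
  positive. The integral over \<open>T\<close> is the difference of those over the open sets
  \<Omega> and \<Omega> - T, hence zero, so \<open>T\<close> is null.\<close>

lemma AE_nonpos_of_open_integrals:
  fixes g :: "pt \<Rightarrow> real"
  assumes O: "open \<Omega>" and g: "integrable (lebesgue_on \<Omega>) g"
    and zero: "\<And>U. open U \<Longrightarrow> U \<subseteq> \<Omega> \<Longrightarrow> (LINT x|lebesgue_on \<Omega>. indicator U x * g x) = 0"
  shows "AE x in lebesgue_on \<Omega>. g x \<le> 0"
proof -
  have Om: "\<Omega> \<in> sets lebesgue" using O by simp
  define A where "A = {x \<in> \<Omega>. g x > 0}"
  have gm: "g \<in> borel_measurable (lebesgue_on \<Omega>)" using g by simp
  have "{x \<in> space (lebesgue_on \<Omega>). g x > 0} \<in> sets (lebesgue_on \<Omega>)" using gm by measurable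
  then have A: "A \<in> sets lebesgue" using Om by (simp add: A_def sets_restrict_space_iff)
  have null: "T \<in> null_sets lebesgue" if T: "closed T" "T \<subseteq> A" for T
  proof -
    have TO: "T \<subseteq> \<Omega>" using T by (auto simp: A_def)
    have Tm: "T \<in> sets lebesgue" "T \<in> sets (lebesgue_on \<Omega>)" using T TO Om by (auto simp: sets_restrict_space_iff)
    have i: "integrable (lebesgue_on \<Omega>) (\<lambda>x. indicator T x * g x)"
      using integrable_real_mult_indicator[OF Tm(2) g] by (simp add: mult.commute)
    have i2: "integrable (lebesgue_on \<Omega>) (\<lambda>x. indicator (\<Omega> - T) x * g x)"
      using integrable_real_mult_indicator[of "\<Omega> - T" "lebesgue_on \<Omega>" g] Tm Om g
      by (simp add: mult.commute sets_restrict_space_iff)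
    have "(LINT x|lebesgue_on \<Omega>. indicator \<Omega> x * g x)
        = (LINT x|lebesgue_on \<Omega>. indicator T x * g x + indicator (\<Omega> - T) x * g x)"
      by (intro Bochner_Integration.integral_cong) (use TO in \<open>auto simp: indicator_def\<close>)
    then have "(LINT x|lebesgue_on \<Omega>. indicator T x * g x) = 0"
      using zero[OF O] zero[of "\<Omega> - T"] O T i i2 by (simp add: open_Diff)
    moreover have "AE x in lebesgue_on \<Omega>. 0 \<le> indicator T x * g x"
      using T(2) by (intro always_eventually allI) (auto simp: indicator_def A_def less_imp_le)
    ultimately have "AE x in lebesgue_on \<Omega>. indicator T x * g x = 0"
      using integral_nonneg_eq_0_iff_AE[OF i] by blast
    then have "AE x in lebesgue_on \<Omega>. x \<notin> T"
      by eventually_elim (use T(2) in \<open>auto simp: A_def indicator_def\<close>)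
    then have "AE x in lebesgue. x \<in> \<Omega> \<longrightarrow> x \<notin> T" using Om by (simp add: AE_restrict_space_iff)
    then have "AE x in lebesgue. x \<notin> T" by eventually_elim (use TO in auto)
    then show ?thesis using Tm(1) by (simp add: AE_iff_null_sets)
  qed
  have le: "emeasure lebesgue A \<le> ennreal e" if e: "e > 0" for e
  proof -
    obtain T where T: "closed T" "T \<subseteq> A" "A - T \<in> lmeasurable" "emeasure lebesgue (A - T) < ennreal e"
      using sets_lebesgue_inner_closed[OF A e] by blast
    have "emeasure lebesgue A \<le> emeasure lebesgue (A - T) + emeasure lebesgue T"
      using T emeasure_subadditive[of "A - T" lebesgue T] null[OF T(1,2)]
      by (auto simp: Un_absorb2 Diff_partition fmeasurable_def null_sets_def)
    then show ?thesis using T(4) null[OF T(1,2)] by (auto simp: null_sets_def)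
  qed
  have "emeasure lebesgue A \<le> 0"
  proof (rule ennreal_le_epsilon)
    show "emeasure lebesgue A \<le> 0 + ennreal e" if "0 < e" for e using le[OF that] by simp
  qed
  then have "A \<in> null_sets lebesgue" using A by (simp add: null_sets_def)
  then have "AE x in lebesgue. x \<notin> A" by (rule AE_not_in)
  then show ?thesis using Om by (auto simp: AE_restrict_space_iff A_def)
qed

text \<open>Test fields f_n e_j with f_n tending to the indicator of an open set show that each
  component integrates to zero over open subsets. Boundedness of the domain makes the measure
  finite, so 1 + |W|^2 is an integrable majorant.\<close>

lemma L2_eq_zero_of_test_fields:
  assumes O: "open \<Omega>" "bounded \<Omega>" and W: "L2 \<Omega> W" and zero: "\<And>\<phi>. test_field \<Omega> \<phi> \<Longrightarrow> l2ip \<Omega> W \<phi> = 0"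
  shows "AE x in lebesgue_on \<Omega>. W x = 0"
proof -
  have Om: "\<Omega> \<in> sets lebesgue" "\<Omega> \<in> lmeasurable" using O by (auto intro: bounded_set_imp_lmeasurable)
  interpret finite_measure "lebesgue_on \<Omega>" by (rule finite_measure_lebesgue_on[OF Om(2)])
  have Wm [measurable]: "W \<in> borel_measurable (lebesgue_on \<Omega>)" using W by (simp add: L2_def)
  have Wjm [measurable]: "(\<lambda>x. W x $ j) \<in> borel_measurable (lebesgue_on \<Omega>)" for j
    by (rule measurable_compose[OF Wm]) (auto intro!: borel_measurable_continuous_onI continuous_intros)
  have Wn: "integrable (lebesgue_on \<Omega>) (\<lambda>x. 1 + (norm (W x))\<^sup>2)" using W by (simp add: L2_def)
  have le: "norm (W x $ j) \<le> 1 + (norm (W x))\<^sup>2" for x j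
  proof -
    have "norm (W x $ j) \<le> norm (W x)" by (rule Finite_Cartesian_Product.norm_nth_le)
    also have "\<dots> \<le> 1 + (norm (W x))\<^sup>2"
      using sum_squares_bound[of "norm (W x)" 1] by (smt (verit) norm_ge_zero power_one)
    finally show ?thesis .
  qed
  have Wj: "integrable (lebesgue_on \<Omega>) (\<lambda>x. W x $ j)" for j
    by (rule Bochner_Integration.integrable_bound[OF Wn]) (use le in \<open>auto intro: order_trans\<close>)
  have U0: "(LINT x|lebesgue_on \<Omega>. of_real (indicator U x) * W x $ j) = 0" if U: "open U" "U \<subseteq> \<Omega>" for U j
  proof -
    obtain f where f: "\<And>n::nat. smooth (f n)" "\<And>n x. 0 \<le> f n x" "\<And>n x. f n x \<le> 1"
      "\<And>n. \<exists>K. compact K \<and> K \<subseteq> U \<and> (\<forall>x. x \<notin> K \<longrightarrow> f n x = 0)"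
      "\<And>x. (\<lambda>n. f n x) \<longlonglongrightarrow> indicator U x" using open_indicator_approximation[OF U(1)] by blast
    have fm [measurable]: "f n \<in> borel_measurable (lebesgue_on \<Omega>)" for n
      using borel_measurable_continuous_onI[OF smooth_continuous[OF f(1)]]
      by (intro measurable_restrict_space1) (simp add: measurable_completion)
    have Um [measurable]: "(\<lambda>x. of_real (indicator U x) :: complex) \<in> borel_measurable (lebesgue_on \<Omega>)"
      using U Om by (intro measurable_restrict_space1) (simp add: measurable_completion)
    have "(LINT x|lebesgue_on \<Omega>. of_real (f n x) * W x $ j) = 0" for n
    proof -
      obtain K where K: "compact K" "K \<subseteq> U" "\<And>x. x \<notin> K \<Longrightarrow> f n x = 0" using f(4) by blast
      have "test_field \<Omega> (\<lambda>x. f n x *\<^sub>R axis j 1)"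
        by (rule test_field_smooth[OF f(1) K(1)]) (use K U in auto)
      from zero[OF this] have "(LINT x|lebesgue_on \<Omega>. cdot (W x) (f n x *\<^sub>R axis j 1)) = 0" by (simp add: l2ip_def)
      moreover have "cdot (W x) (f n x *\<^sub>R axis j 1) = of_real (f n x) * W x $ j" for x
      proof -
        have "cdot (W x) (f n x *\<^sub>R axis j 1) = (\<Sum>i\<in>UNIV. if i = j then of_real (f n x) * W x $ j else 0)"
          unfolding cdot_def by (intro sum.cong) (auto simp: axis_def scaleR_conv_of_real[symmetric])
        then show ?thesis by simp
      qed
      ultimately show ?thesis by simp
    qed
    moreover have "(\<lambda>n. LINT x|lebesgue_on \<Omega>. of_real (f n x) * W x $ j) \<longlonglongrightarrow> (LINT x|lebesgue_on \<Omega>. of_real (indicator U x) * W x $ j)"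
    proof (rule integral_dominated_convergence[OF _ _ Wn])
      show "AE x in lebesgue_on \<Omega>. (\<lambda>n. of_real (f n x) * W x $ j) \<longlonglongrightarrow> of_real (indicator U x) * W x $ j"
        by (intro always_eventually allI tendsto_intros f(5))
      show "AE x in lebesgue_on \<Omega>. norm (of_real (f n x) * W x $ j) \<le> 1 + (norm (W x))\<^sup>2" for n
      proof (intro always_eventually allI)
        fix x
        have "norm (of_real (f n x) * W x $ j) \<le> 1 * norm (W x $ j)"
          unfolding norm_mult using f(2,3)[of n x] by (intro mult_right_mono) auto
        then show "norm (of_real (f n x) * W x $ j) \<le> 1 + (norm (W x))\<^sup>2" using le[of x j] by simp
      qed
    qed measurable
    ultimately show ?thesis by (simp add: LIMSEQ_const_iff)
  qed
  have real0: "AE x in lebesgue_on \<Omega>. L (W x $ j) \<le> 0" if L: "bounded_linear L" for L :: "complex \<Rightarrow> real" and j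
  proof (rule AE_nonpos_of_open_integrals[OF O(1)])
    show "integrable (lebesgue_on \<Omega>) (\<lambda>x. L (W x $ j))" using integrable_bounded_linear[OF L Wj] .
    fix U assume U: "open U" "U \<subseteq> \<Omega>"
    have U': "U \<in> sets (lebesgue_on \<Omega>)" using U Om by (simp add: sets_restrict_space_iff)
    have i: "integrable (lebesgue_on \<Omega>) (\<lambda>x. of_real (indicator U x) * W x $ j)"
      using integrable_mult_indicator[OF U' Wj[of j]] by (simp add: scaleR_conv_of_real)
    have "(LINT x|lebesgue_on \<Omega>. L (of_real (indicator U x) * W x $ j)) = 0"
      using integral_bounded_linear[OF L i] U0[OF U] linear_0[OF bounded_linear.linear[OF L]] by simp
    moreover have "L (of_real (indicator U x) * W x $ j) = indicator U x * L (W x $ j)" for x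
      using linear_0[OF bounded_linear.linear[OF L]] by (simp add: indicator_def)
    ultimately show "(LINT x|lebesgue_on \<Omega>. indicator U x * L (W x $ j)) = 0" by simp
  qed
  \<comment> \<open>Nonpositivity of Re, -Re, Im and -Im forces the component to vanish.\<close>
  have "AE x in lebesgue_on \<Omega>. W x $ j = 0" for j
    using real0[OF bounded_linear_Re, of j] real0[OF bounded_linear_minus[OF bounded_linear_Re], of j]
      real0[OF bounded_linear_Im, of j] real0[OF bounded_linear_minus[OF bounded_linear_Im], of j]
    by eventually_elim (simp add: complex_eq_iff)
  then have "AE x in lebesgue_on \<Omega>. \<forall>j. W x $ j = 0" by (simp add: AE_all_countable)
  then show ?thesis by eventually_elim (simp add: vec_eq_iff)
qed

section \<open>The space H(curl)\<close>

lemma fun_combination: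
  "(\<lambda>x. a *s f x + b *s g x) = fscale a f + fscale b g"
  "(\<lambda>x. f x - g x) = f - g" "(\<lambda>x. f x + g x) = f + g" "(\<lambda>x. a *s f x) = fscale a f"
  "(\<lambda>x. 0 :: 'v::ab_group_add) = 0"
  by (auto simp: fscale_def fun_eq_iff)

locale curl_domain =
  fixes \<Omega> :: "pt set"
  assumes open_dom: "open \<Omega>" and bounded_dom: "bounded \<Omega>"

sublocale curl_domain \<subseteq> HL: semihilbert fscale "{f. L2 \<Omega> f}" "l2ip \<Omega>"
proof -
  have "{f. L2 \<Omega> f} = {f. L2m (lebesgue_on \<Omega>) f \<and> (AE x in lebesgue_on \<Omega>. ndot 0 (f x) = 0)}"
    by (simp add: L2_iff_L2m ndot_simps)
  then show "semihilbert fscale {f. L2 \<Omega> f} (l2ip \<Omega>)"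
    using semihilbert_L2[of "lebesgue_on \<Omega>" "\<lambda>_. 0"] by (simp add: l2ip_eq_ipm)
qed

context curl_domain
begin

lemma HL_nrm: "HL.nrm f = l2norm \<Omega> f"
  unfolding HL.nrm_def l2norm_def by (simp add: l2ip_eq_ipm ipm_self)

lemma HL_eqn_iff:
  assumes "L2 \<Omega> f" "L2 \<Omega> g"
  shows "HL.eqn f g \<longleftrightarrow> aeq \<Omega> f g"
proof -
  have d: "L2m (lebesgue_on \<Omega>) (\<lambda>x. f x - g x)" using assms by (simp add: L2_iff_L2m L2m_diff)
  have "HL.eqn f g \<longleftrightarrow> (LINT x|lebesgue_on \<Omega>. (norm (f x - g x))\<^sup>2) = 0"
    by (simp add: HL.eqn_def HL_nrm l2norm_def)
  then show ?thesis using ipm_zero_iff[OF d] by (simp add: aeq_def)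
qed

lemma L2_lin: "L2 \<Omega> f \<Longrightarrow> L2 \<Omega> g \<Longrightarrow> L2 \<Omega> (fscale a f + fscale b g)"
  using HL.add_mem[of "fscale a f" "fscale b g"] HL.scale_mem[of f a] HL.scale_mem[of g b] by simp

lemma L2_scale: "L2 \<Omega> f \<Longrightarrow> L2 \<Omega> (fscale a f)"
  using HL.scale_mem[of f a] by simp

lemma l2ip_lin:
  assumes "L2 \<Omega> f" "L2 \<Omega> g" "L2 \<Omega> h"
  shows "l2ip \<Omega> (fscale a f + fscale b g) h = a * l2ip \<Omega> f h + b * l2ip \<Omega> g h"
  using assms HL.scale_mem[of f a] HL.scale_mem[of g b]
  by (simp add: HL.ip_add_left HL.ip_scale_left)

lemma is_dcurlD:
  assumes "is_dcurl \<Omega> U W"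
  shows "L2 \<Omega> W" "test_field \<Omega> \<phi> \<Longrightarrow> l2ip \<Omega> U (curl \<phi>) = l2ip \<Omega> W \<phi>"
  using assms by (auto simp: is_dcurl_def)

lemma is_dcurl_unique:
  assumes "is_dcurl \<Omega> U W" "is_dcurl \<Omega> U W'"
  shows "HL.eqn W W'"
proof -
  have L: "L2 \<Omega> W" "L2 \<Omega> W'" using assms is_dcurlD by blast+
  have d: "L2 \<Omega> (W - W')" using HL.diff_mem[of W W'] L by simp
  have "l2ip \<Omega> (W - W') \<phi> = 0" if "test_field \<Omega> \<phi>" for \<phi>
    using is_dcurlD(2)[OF assms(1) that] is_dcurlD(2)[OF assms(2) that] L L2_test_field(1)[OF open_dom that]
    by (simp add: HL.ip_diff_left)
  from L2_eq_zero_of_test_fields[OF open_dom bounded_dom d this]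
  have "AE x in lebesgue_on \<Omega>. W x = W' x" by auto
  then show ?thesis using L by (simp add: HL_eqn_iff aeq_def)
qed

lemma is_dcurl_lin:
  assumes "is_dcurl \<Omega> U W" "is_dcurl \<Omega> U' W'" "L2 \<Omega> U" "L2 \<Omega> U'"
  shows "is_dcurl \<Omega> (fscale a U + fscale b U') (fscale a W + fscale b W')"
  unfolding is_dcurl_def
  using assms L2_test_field[OF open_dom] by (auto simp: L2_lin l2ip_lin is_dcurl_def)

lemma hcurl_L2: "hcurl \<Omega> U \<Longrightarrow> L2 \<Omega> U"
  by (simp add: hcurl_def)

lemma is_dcurl_dcurl: "hcurl \<Omega> U \<Longrightarrow> is_dcurl \<Omega> U (dcurl \<Omega> U)"
  unfolding hcurl_def dcurl_def by (metis someI_ex)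

lemma L2_dcurl: "hcurl \<Omega> U \<Longrightarrow> L2 \<Omega> (dcurl \<Omega> U)"
  using is_dcurl_dcurl is_dcurlD by blast

lemma dcurl_eqI:
  assumes "L2 \<Omega> U" "is_dcurl \<Omega> U W"
  shows "hcurl \<Omega> U" "HL.eqn (dcurl \<Omega> U) W"
proof -
  show "hcurl \<Omega> U" using assms by (auto simp: hcurl_def)
  then show "HL.eqn (dcurl \<Omega> U) W" using is_dcurl_unique[OF is_dcurl_dcurl assms(2)] by blast
qed

lemma hcurl_lin:
  assumes "hcurl \<Omega> U" "hcurl \<Omega> U'"
  shows "hcurl \<Omega> (fscale a U + fscale b U')"
    "HL.eqn (dcurl \<Omega> (fscale a U + fscale b U')) (fscale a (dcurl \<Omega> U) + fscale b (dcurl \<Omega> U'))"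
  using dcurl_eqI[OF L2_lin[OF hcurl_L2 hcurl_L2] is_dcurl_lin[OF is_dcurl_dcurl is_dcurl_dcurl hcurl_L2 hcurl_L2]] assms
  by blast+

lemma hcurl_test_field:
  assumes "test_field \<Omega> \<phi>"
  shows "hcurl \<Omega> \<phi>" "HL.eqn (dcurl \<Omega> \<phi>) (curl \<phi>)"
  using dcurl_eqI[OF L2_test_field(1)[OF open_dom assms] is_dcurl_test_field[OF open_dom assms]] by blast+

lemma hcurl_zero: "hcurl \<Omega> 0" "HL.eqn (dcurl \<Omega> 0) 0"
proof -
  have z: "hcurl \<Omega> 0" using hcurl_test_field(1)[OF test_field_zero] by (simp add: fun_combination)
  then show "hcurl \<Omega> 0" .
  show "HL.eqn (dcurl \<Omega> 0) 0" using hcurl_lin(2)[OF z z, of 0 0] by simp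
qed

definition hc_ip :: "fld \<Rightarrow> fld \<Rightarrow> complex" where
  "hc_ip U W = l2ip \<Omega> U W + l2ip \<Omega> (dcurl \<Omega> U) (dcurl \<Omega> W)"

lemma l2ip_dcurl_lin:
  assumes "hcurl \<Omega> U" "hcurl \<Omega> U'" "L2 \<Omega> W"
  shows "l2ip \<Omega> (dcurl \<Omega> (fscale a U + fscale b U')) W = a * l2ip \<Omega> (dcurl \<Omega> U) W + b * l2ip \<Omega> (dcurl \<Omega> U') W"
proof -
  have "l2ip \<Omega> (dcurl \<Omega> (fscale a U + fscale b U')) W = l2ip \<Omega> (fscale a (dcurl \<Omega> U) + fscale b (dcurl \<Omega> U')) W"
    using HL.eqn_ip_left[OF hcurl_lin(2)[OF assms(1,2)], of a b W] assms hcurl_lin(1)[OF assms(1,2), of a b]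
      L2_lin[OF L2_dcurl[OF assms(1)] L2_dcurl[OF assms(2)], of a b] L2_dcurl by simp
  then show ?thesis using assms L2_dcurl by (simp add: l2ip_lin)
qed

lemma hc_ip_lin:
  assumes "hcurl \<Omega> U" "hcurl \<Omega> U'" "hcurl \<Omega> W"
  shows "hc_ip (fscale a U + fscale b U') W = a * hc_ip U W + b * hc_ip U' W"
  using assms by (simp add: hc_ip_def l2ip_lin l2ip_dcurl_lin hcurl_L2 L2_dcurl algebra_simps)

lemma hc_ip_self:
  assumes "hcurl \<Omega> U"
  shows "Re (hc_ip U U) = (l2norm \<Omega> U)\<^sup>2 + (l2norm \<Omega> (dcurl \<Omega> U))\<^sup>2"
  using assms by (simp add: hc_ip_def HL.nrm_sq hcurl_L2 L2_dcurl HL_nrm[symmetric])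

lemma l2norm_dcurl_diff:
  assumes "hcurl \<Omega> U" "hcurl \<Omega> U'"
  shows "hcurl \<Omega> (U - U')" "l2norm \<Omega> (dcurl \<Omega> (U - U')) = l2norm \<Omega> (dcurl \<Omega> U - dcurl \<Omega> U')"
proof -
  have e: "fscale 1 U + fscale (-1) U' = U - U'" "fscale 1 (dcurl \<Omega> U) + fscale (-1) (dcurl \<Omega> U') = dcurl \<Omega> U - dcurl \<Omega> U'"
    by (simp_all del: fun_diff_def plus_fun_def)
  show h: "hcurl \<Omega> (U - U')" using hcurl_lin(1)[OF assms, of 1 "-1"] unfolding e .
  show "l2norm \<Omega> (dcurl \<Omega> (U - U')) = l2norm \<Omega> (dcurl \<Omega> U - dcurl \<Omega> U')"
    using HL.eqn_nrm[OF hcurl_lin(2)[OF assms, of 1 "-1"]] L2_dcurl[OF h] HL.diff_mem[of "dcurl \<Omega> U" "dcurl \<Omega> U'"]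
      L2_dcurl[OF assms(1)] L2_dcurl[OF assms(2)] unfolding e by (simp add: HL_nrm)
qed

end

text \<open>Completeness of the graph norm says that the curl is a closed operator: its weak
  defining identity survives simultaneous limits of fields and of their curls.\<close>

sublocale curl_domain \<subseteq> HC: semihilbert fscale "{U. hcurl \<Omega> U}" hc_ip
proof (unfold_locales, goal_cases)
  case 1 show ?case using hcurl_zero by simp
next
  case (2 x y) then show ?case using hcurl_lin(1)[of x y 1 1] by simp
next
  case (3 x a) then show ?case using hcurl_lin(1)[of x x a 0] by simp
next
  case (4 x y z) then show ?case using hc_ip_lin[of x y z 1 1] by simp
next
  case (5 x y a) then show ?case using hc_ip_lin[of x x y a 0] by simp
next
  case (6 x y) then show ?case
    using HL.ip_cnj[of x y] HL.ip_cnj[of "dcurl \<Omega> x" "dcurl \<Omega> y"] by (simp add: hc_ip_def hcurl_L2 L2_dcurl)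
next
  case (7 x) then show ?case by (simp add: hc_ip_self)
next
  case (8 s)
  have h: "hcurl \<Omega> (s n)" for n using 8(1)[of n] by simp
  have L: "L2 \<Omega> (s n)" "L2 \<Omega> (dcurl \<Omega> (s n))" for n using h hcurl_L2 L2_dcurl by blast+
  have e: "sqrt (Re (hc_ip (s m - s n) (s m - s n)))
      = sqrt ((HL.nrm (s m - s n))\<^sup>2 + (HL.nrm (dcurl \<Omega> (s m) - dcurl \<Omega> (s n)))\<^sup>2)" for m n
    using hc_ip_self[OF l2norm_dcurl_diff(1)[OF h h]] l2norm_dcurl_diff(2)[OF h h] by (simp add: HL_nrm)
  have "HL.nrm (s m - s n) \<le> sqrt (Re (hc_ip (s m - s n) (s m - s n)))"
       "HL.nrm (dcurl \<Omega> (s m) - dcurl \<Omega> (s n)) \<le> sqrt (Re (hc_ip (s m - s n) (s m - s n)))" for m n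
    unfolding e by (auto intro!: real_le_rsqrt)
  then have "\<exists>N. \<forall>m\<ge>N. \<forall>n\<ge>N. HL.nrm (s m - s n) < e" "\<exists>N. \<forall>m\<ge>N. \<forall>n\<ge>N. HL.nrm (dcurl \<Omega> (s m) - dcurl \<Omega> (s n)) < e"
    if "e > 0" for e using 8(2)[OF that] by (meson le_less_trans)+
  then obtain U W where U: "L2 \<Omega> U" "HL.conv s U" and W: "L2 \<Omega> W" "HL.conv (\<lambda>n. dcurl \<Omega> (s n)) W"
    using HL.cauchy_conv[of s] HL.cauchy_conv[of "\<lambda>n. dcurl \<Omega> (s n)"] L by (metis mem_Collect_eq)
  have "l2ip \<Omega> U (curl \<phi>) = l2ip \<Omega> W \<phi>" if t: "test_field \<Omega> \<phi>" for \<phi>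
  proof (rule LIMSEQ_unique)
    note T = L2_test_field[OF open_dom t]
    show "(\<lambda>n. l2ip \<Omega> (s n) (curl \<phi>)) \<longlonglongrightarrow> l2ip \<Omega> U (curl \<phi>)" using U L T by (intro HL.conv_ip_left) auto
    have "l2ip \<Omega> (s n) (curl \<phi>) = l2ip \<Omega> (dcurl \<Omega> (s n)) \<phi>" for n using is_dcurlD(2)[OF is_dcurl_dcurl[OF h] t] .
    then show "(\<lambda>n. l2ip \<Omega> (s n) (curl \<phi>)) \<longlonglongrightarrow> l2ip \<Omega> W \<phi>"
      using W L T by (simp, intro HL.conv_ip_left) auto
  qed
  then have UW: "is_dcurl \<Omega> U W" using W by (simp add: is_dcurl_def)
  have hU: "hcurl \<Omega> U" "HL.eqn (dcurl \<Omega> U) W" using dcurl_eqI[OF U(1) UW] by blast+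
  have "HL.nrm (dcurl \<Omega> (s n) - dcurl \<Omega> U) = HL.nrm (dcurl \<Omega> (s n) - W)" for n
    using HL.eqn_nrm[OF HL.eqn_diff[OF HL.eqn_refl hU(2), of "dcurl \<Omega> (s n)"]] L W L2_dcurl[OF hU(1)]
      HL.diff_mem[of "dcurl \<Omega> (s n)" W] HL.diff_mem[of "dcurl \<Omega> (s n)" "dcurl \<Omega> U"] by simp
  then have "sqrt (Re (hc_ip (s n - U) (s n - U))) = sqrt ((HL.nrm (s n - U))\<^sup>2 + (HL.nrm (dcurl \<Omega> (s n) - W))\<^sup>2)" for n
    using hc_ip_self[OF l2norm_dcurl_diff(1)[OF h hU(1)]] l2norm_dcurl_diff(2)[OF h hU(1)] by (simp add: HL_nrm)
  moreover have "(\<lambda>n. sqrt ((HL.nrm (s n - U))\<^sup>2 + (HL.nrm (dcurl \<Omega> (s n) - W))\<^sup>2)) \<longlonglongrightarrow> sqrt (0\<^sup>2 + 0\<^sup>2)"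
    using U(2) W(2) unfolding HL.conv_def by (intro tendsto_intros)
  ultimately show ?case using hU(1) by (intro bexI[of _ U]) auto
qed

section \<open>The trace pairing on H(curl)\<close>

context curl_domain
begin

lemma HC_nrm: "hcurl \<Omega> U \<Longrightarrow> HC.nrm U = hcurl_norm \<Omega> U"
  by (simp add: HC.nrm_def hc_ip_self hcurl_norm_def)

lemma HC_nrm_ge:
  assumes "hcurl \<Omega> U"
  shows "HL.nrm U \<le> HC.nrm U" "HL.nrm (dcurl \<Omega> U) \<le> HC.nrm U"
  using assms by (auto simp: HC_nrm hcurl_norm_def HL_nrm intro!: real_le_rsqrt)

lemma bd_pair_lin:
  assumes "hcurl \<Omega> U" "hcurl \<Omega> U'" "hcurl \<Omega> W"
  shows "bd_pair \<Omega> (fscale a U + fscale b U') W = a * bd_pair \<Omega> U W + b * bd_pair \<Omega> U' W"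
  using assms by (simp add: bd_pair_def l2ip_lin l2ip_dcurl_lin hcurl_L2 L2_dcurl algebra_simps)

lemma bd_pair_diff:
  assumes "hcurl \<Omega> U" "hcurl \<Omega> U'" "hcurl \<Omega> W"
  shows "bd_pair \<Omega> (U - U') W = bd_pair \<Omega> U W - bd_pair \<Omega> U' W"
  using bd_pair_lin[OF assms, of 1 "-1"] by simp

lemma bd_pair_skew:
  assumes "hcurl \<Omega> U" "hcurl \<Omega> W"
  shows "bd_pair \<Omega> W U = - cnj (bd_pair \<Omega> U W)"
  using HL.ip_cnj[of "dcurl \<Omega> U" W] HL.ip_cnj[of U "dcurl \<Omega> W"] assms
  by (simp add: bd_pair_def hcurl_L2 L2_dcurl)

text \<open>The constant 2 counts the two terms of the pairing, each estimated by
  Cauchy-Schwarz.\<close>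

lemma bd_pair_bound:
  assumes "hcurl \<Omega> U" "hcurl \<Omega> W"
  shows "cmod (bd_pair \<Omega> U W) \<le> 2 * HC.nrm U * HC.nrm W"
proof -
  have L: "L2 \<Omega> U" "L2 \<Omega> W" "L2 \<Omega> (dcurl \<Omega> U)" "L2 \<Omega> (dcurl \<Omega> W)" using assms hcurl_L2 L2_dcurl by auto
  have "cmod (l2ip \<Omega> (dcurl \<Omega> U) W) \<le> HL.nrm (dcurl \<Omega> U) * HL.nrm W" using L by (intro HL.cauchy_schwarz) auto
  also have "\<dots> \<le> HC.nrm U * HC.nrm W" using assms HC_nrm_ge L by (intro mult_mono) auto
  finally have 1: "cmod (l2ip \<Omega> (dcurl \<Omega> U) W) \<le> HC.nrm U * HC.nrm W" .
  have "cmod (l2ip \<Omega> U (dcurl \<Omega> W)) \<le> HL.nrm U * HL.nrm (dcurl \<Omega> W)" using L by (intro HL.cauchy_schwarz) auto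
  also have "\<dots> \<le> HC.nrm U * HC.nrm W" using assms HC_nrm_ge L by (intro mult_mono) auto
  finally show ?thesis using 1 norm_triangle_ineq4[of "l2ip \<Omega> (dcurl \<Omega> U) W" "l2ip \<Omega> U (dcurl \<Omega> W)"]
    unfolding bd_pair_def by linarith
qed

lemma bd_pair_test_field:
  assumes "test_field \<Omega> \<phi>" "hcurl \<Omega> W"
  shows "bd_pair \<Omega> \<phi> W = 0"
proof -
  note T = L2_test_field[OF open_dom assms(1)] and h = hcurl_test_field[OF assms(1)]
  have "l2ip \<Omega> (dcurl \<Omega> \<phi>) W = l2ip \<Omega> (curl \<phi>) W"
    using HL.eqn_ip_left[OF h(2), of W] T hcurl_L2[OF assms(2)] L2_dcurl[OF h(1)] by simp
  also have "\<dots> = l2ip \<Omega> \<phi> (dcurl \<Omega> W)"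
    using is_dcurlD(2)[OF is_dcurl_dcurl[OF assms(2)] assms(1)] HL.ip_cnj[of W "curl \<phi>"] HL.ip_cnj[of "dcurl \<Omega> W" \<phi>]
      T hcurl_L2[OF assms(2)] L2_dcurl[OF assms(2)] by simp
  finally show ?thesis by (simp add: bd_pair_def)
qed

text \<open>The pairing is continuous in the graph norm, so its vanishing on test fields extends to
  their closure.\<close>

lemma bd_pair_hcurl0:
  assumes "hcurl0 \<Omega> U" "hcurl \<Omega> W"
  shows "bd_pair \<Omega> U W = 0"
proof -
  obtain s where U: "hcurl \<Omega> U" and s: "\<And>k. test_field \<Omega> (s k)"
    "(\<lambda>k. hcurl_norm \<Omega> (\<lambda>x. s k x - U x)) \<longlonglongrightarrow> 0" using assms(1) by (auto simp: hcurl0_def)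
  have h: "hcurl \<Omega> (s k)" "hcurl \<Omega> (s k - U)" for k
    using hcurl_test_field[OF s(1)] l2norm_dcurl_diff(1)[OF _ U] by blast+
  have le: "cmod (bd_pair \<Omega> U W) \<le> 2 * HC.nrm (s k - U) * HC.nrm W" for k
    using bd_pair_bound[OF h(2) assms(2), of k] bd_pair_diff[OF h(1) U assms(2), of k]
      bd_pair_test_field[OF s(1) assms(2), of k] by simp
  have "(\<lambda>k. HC.nrm (s k - U)) \<longlonglongrightarrow> 0" using s(2) HC_nrm[OF h(2)] by (simp add: fun_diff_def)
  then have "(\<lambda>k. 2 * HC.nrm (s k - U) * HC.nrm W) \<longlonglongrightarrow> 2 * 0 * HC.nrm W" by (intro tendsto_intros)
  then have "cmod (bd_pair \<Omega> U W) \<le> 2 * 0 * HC.nrm W"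
    by (rule LIMSEQ_le_const) (use le in blast)
  then show ?thesis by simp
qed

lemma teq_iff:
  assumes "hcurl \<Omega> U" "hcurl \<Omega> U'"
  shows "teq \<Omega> U U' \<longleftrightarrow> (\<forall>W. hcurl \<Omega> W \<longrightarrow> bd_pair \<Omega> U W = bd_pair \<Omega> U' W)"
proof -
  have "(\<lambda>x. U x - U' x) = U - U'" by auto
  then show ?thesis unfolding teq_def using bd_pair_diff[OF assms] by auto
qed

lemma hcurl0_test_field: "test_field \<Omega> \<phi> \<Longrightarrow> hcurl0 \<Omega> \<phi>"
proof -
  assume t: "test_field \<Omega> \<phi>"
  have "hcurl_norm \<Omega> (\<lambda>x. \<phi> x - \<phi> x) = HC.nrm 0"
    using HC_nrm[OF hcurl_zero(1)] by (simp add: zero_fun_def)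
  then show ?thesis unfolding hcurl0_def using hcurl_test_field(1)[OF t] t
    by (intro conjI exI[of _ "\<lambda>_. \<phi>"]) auto
qed

lemma hcurl0_hcurl: "hcurl0 \<Omega> U \<Longrightarrow> hcurl \<Omega> U"
  by (simp add: hcurl0_def)

end

section \<open>Coefficient matrices\<close>

lemma rmatvec_component: "rmatvec M v $ i = (\<Sum>j\<in>UNIV. of_real (M $ i $ j) * v $ j)"
  by (simp add: rmatvec_def)

lemma rmatvec_add: "rmatvec M (u + v) = rmatvec M u + rmatvec M v"
  by (simp add: vec_eq_iff rmatvec_component algebra_simps sum.distrib)

lemma rmatvec_scale: "rmatvec M (k *s v) = k *s rmatvec M v"
  by (simp add: vec_eq_iff rmatvec_component sum_distrib_left mult_ac)

lemma rmatvec_rmatvec: "rmatvec A (rmatvec B v) = rmatvec (A ** B) v"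
proof -
  have "rmatvec A (rmatvec B v) $ i = rmatvec (A ** B) v $ i" for i
  proof -
    have "rmatvec A (rmatvec B v) $ i
        = (\<Sum>j\<in>UNIV. \<Sum>k\<in>UNIV. of_real (A $ i $ j) * of_real (B $ j $ k) * v $ k)"
      by (simp add: rmatvec_component sum_distrib_left mult.assoc)
    also have "\<dots> = (\<Sum>k\<in>UNIV. \<Sum>j\<in>UNIV. of_real (A $ i $ j) * of_real (B $ j $ k) * v $ k)"
      by (rule sum.swap)
    also have "\<dots> = rmatvec (A ** B) v $ i"
      by (simp add: rmatvec_component matrix_matrix_mult_def sum_distrib_right)
    finally show ?thesis .
  qed
  then show ?thesis by (simp add: vec_eq_iff)
qed

lemma rmatvec_mat_1: "rmatvec (mat 1) v = v"
  by (simp add: vec_eq_iff rmatvec_component mat_def if_distrib if_distribR cong: if_cong)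

lemma cdot_rmatvec_symmetric:
  assumes "transpose M = M"
  shows "cdot (rmatvec M a) b = cdot a (rmatvec M b)"
proof -
  have s: "M $ i $ j = M $ j $ i" for i j
    using arg_cong[OF assms, of "\<lambda>A. A $ i $ j"] by (simp add: transpose_def)
  have "cdot (rmatvec M a) b = (\<Sum>i\<in>UNIV. \<Sum>j\<in>UNIV. of_real (M $ i $ j) * a $ j * cnj (b $ i))"
    by (simp add: cdot_def rmatvec_component sum_distrib_right)
  also have "\<dots> = (\<Sum>j\<in>UNIV. \<Sum>i\<in>UNIV. of_real (M $ i $ j) * a $ j * cnj (b $ i))" by (rule sum.swap)
  also have "\<dots> = (\<Sum>j\<in>UNIV. \<Sum>i\<in>UNIV. a $ j * (of_real (M $ j $ i) * cnj (b $ i)))"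
    by (intro sum.cong refl) (subst s, simp)
  also have "\<dots> = cdot a (rmatvec M b)" by (simp add: cdot_def rmatvec_component sum_distrib_left)
  finally show ?thesis .
qed

text \<open>Coercivity is given on real vectors. For a = p + i q with real p and q the cross terms
  are purely imaginary, so the real part splits.\<close>

lemma Re_cdot_rmatvec_ge:
  assumes "\<forall>v. v \<bullet> (M *v v) \<ge> c * (norm v)\<^sup>2"
  shows "Re (cdot (rmatvec M a) a) \<ge> c * (norm a)\<^sup>2"
proof -
  define p q where "p = (\<chi> i. Re (a $ i))" and "q = (\<chi> i. Im (a $ i))"
  have "Re (cdot (rmatvec M a) a) = p \<bullet> (M *v p) + q \<bullet> (M *v q)"
    unfolding cdot_def rmatvec_component p_def q_def inner_vec_def matrix_vector_mult_def
    by (simp add: sum_distrib_left sum_distrib_right sum.distrib[symmetric] algebra_simps)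
  moreover have "(norm a)\<^sup>2 = (norm p)\<^sup>2 + (norm q)\<^sup>2"
    by (simp add: norm_vec_def L2_set_def sum_nonneg p_def q_def cmod_power2 sum.distrib)
  ultimately show ?thesis using assms[rule_format, of p] assms[rule_format, of q] by (simp add: algebra_simps)
qed

text \<open>A crude constant: three entries per row and three rows.\<close>

lemma norm_rmatvec_le:
  assumes "\<forall>i j. \<bar>M $ i $ j\<bar> \<le> C"
  shows "norm (rmatvec M v) \<le> 9 * C * norm v"
proof -
  have le: "norm (rmatvec M v $ i) \<le> 3 * C * norm v" for i
  proof -
    have "norm (rmatvec M v $ i) \<le> (\<Sum>j\<in>UNIV. norm (of_real (M $ i $ j) * v $ j))"
      unfolding rmatvec_component by (rule norm_sum)
    also have "\<dots> \<le> (\<Sum>j\<in>(UNIV :: 3 set). C * norm v)"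
    proof (rule sum_mono)
      fix j
      have "\<bar>M $ i $ j\<bar> * norm (v $ j) \<le> C * norm v"
        using order_trans[OF abs_ge_zero assms[rule_format, of i j]] assms
        by (intro mult_mono Finite_Cartesian_Product.norm_nth_le) auto
      then show "norm (of_real (M $ i $ j) * v $ j) \<le> C * norm v" by (simp add: norm_mult)
    qed
    finally show ?thesis by simp
  qed
  have "(\<Sum>i\<in>UNIV. norm (rmatvec M v $ i)) \<le> (\<Sum>i\<in>(UNIV :: 3 set). 3 * C * norm v)"
    by (rule sum_mono) (rule le)
  moreover have "norm (rmatvec M v) \<le> (\<Sum>i\<in>UNIV. norm (rmatvec M v $ i))"
    unfolding norm_vec_def by (rule L2_set_le_sum) simp
  ultimately show ?thesis by simp
qed

text \<open>Coercivity gives injectivity, which for a square matrix is invertibility.\<close>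

lemma rmatvec_matrix_inv:
  assumes "\<forall>v. v \<bullet> (M *v v) \<ge> c * (norm v)\<^sup>2" "c > 0"
  shows "rmatvec (matrix_inv M) (rmatvec M v) = v"
proof -
  have "u = v" if "M *v u = M *v v" for u v
  proof -
    have "M *v (u - v) = 0" using that by (simp add: matrix_vector_mult_diff_distrib)
    then have "c * (norm (u - v))\<^sup>2 \<le> 0" using assms(1)[rule_format, of "u - v"] by simp
    then show ?thesis using assms(2) by (simp add: mult_le_0_iff)
  qed
  then have "inj ((*v) M)" by (rule injI)
  then have "invertible M" unfolding invertible_left_inverse matrix_left_invertible_injective .
  then have "matrix_inv M ** M = mat 1"
    unfolding invertible_def matrix_inv_def by (rule someI2_ex) blast
  then show ?thesis by (simp add: rmatvec_rmatvec rmatvec_mat_1)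
qed

lemma borel_measurable_rmatvec:
  assumes m: "\<And>i j. (\<lambda>x. m x $ i $ j) \<in> borel_measurable M" and f: "f \<in> borel_measurable M"
  shows "(\<lambda>x. rmatvec (m x) (f x)) \<in> borel_measurable M"
proof -
  have fj: "(\<lambda>x. f x $ j) \<in> borel_measurable M" for j
    by (rule measurable_compose[OF f]) (auto intro!: borel_measurable_continuous_onI continuous_intros)
  have "(\<lambda>x. rmatvec (m x) (f x) \<bullet> axis i u) \<in> borel_measurable M" for i u
    unfolding inner_axis rmatvec_component using m fj by measurable
  then have "\<forall>b\<in>Basis. (\<lambda>x. rmatvec (m x) (f x) \<bullet> b) \<in> borel_measurable M" by (auto simp: Basis_vec_def)
  then show ?thesis by (rule borel_measurable_euclidean_space[THEN iffD2])
qed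

section \<open>Weighted L2 spaces and division by a coefficient\<close>

locale weight = curl_domain +
  fixes m :: "pt \<Rightarrow> real^3^3" and c :: real
  assumes adm: "admissible_coeff \<Omega> m" and c_pos: "c > 0" and upos: "unif_pos \<Omega> m c"
begin

definition wt :: "fld \<Rightarrow> fld" where
  "wt f = (\<lambda>x. rmatvec (m x) (f x))"

definition ipw :: "fld \<Rightarrow> fld \<Rightarrow> complex" where
  "ipw f g = l2ip \<Omega> (wt f) g"

lemma wt_lin: "wt (fscale a f + fscale b g) = fscale a (wt f) + fscale b (wt g)"
  by (simp add: wt_def fscale_def fun_eq_iff rmatvec_add rmatvec_scale)

lemma wt_bound:
  obtains C where "C \<ge> 0" "\<And>f. L2 \<Omega> f \<Longrightarrow> L2 \<Omega> (wt f) \<and> HL.nrm (wt f) \<le> C * HL.nrm f"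
proof -
  obtain C0 where C0: "AE x in lebesgue_on \<Omega>. \<forall>i j. \<bar>m x $ i $ j\<bar> \<le> C0"
    using adm unfolding admissible_coeff_def by blast
  define C where "C = 9 * max C0 0"
  have C: "C \<ge> 0" by (simp add: C_def)
  have le: "AE x in lebesgue_on \<Omega>. \<forall>v. norm (rmatvec (m x) v) \<le> C * norm v"
    using C0
  proof eventually_elim
    case (elim x)
    then have "\<forall>i j. \<bar>m x $ i $ j\<bar> \<le> max C0 0" by (simp add: le_max_iff_disj)
    then show ?case using norm_rmatvec_le by (simp add: C_def)
  qed
  have sq: "AE x in lebesgue_on \<Omega>. (norm (wt f x))\<^sup>2 \<le> C\<^sup>2 * (norm (f x))\<^sup>2" for f
    using le unfolding wt_def by eventually_elim (simp add: power_mono flip: power_mult_distrib)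
  have "L2 \<Omega> (wt f) \<and> HL.nrm (wt f) \<le> C * HL.nrm f" if f: "L2 \<Omega> f" for f
  proof -
    have fi: "integrable (lebesgue_on \<Omega>) (\<lambda>x. C\<^sup>2 * (norm (f x))\<^sup>2)" using f by (simp add: L2_def)
    have mm: "wt f \<in> borel_measurable (lebesgue_on \<Omega>)"
      using adm f unfolding wt_def admissible_coeff_def L2_def by (intro borel_measurable_rmatvec) auto
    have i: "integrable (lebesgue_on \<Omega>) (\<lambda>x. (norm (wt f x))\<^sup>2)"
      by (rule Bochner_Integration.integrable_bound[OF fi]) (use mm sq[of f] in auto)
    have "(LINT x|lebesgue_on \<Omega>. (norm (wt f x))\<^sup>2) \<le> (LINT x|lebesgue_on \<Omega>. C\<^sup>2 * (norm (f x))\<^sup>2)"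
      by (rule integral_mono_AE[OF i fi sq])
    then have "HL.nrm (wt f) \<le> sqrt (C\<^sup>2 * (LINT x|lebesgue_on \<Omega>. (norm (f x))\<^sup>2))"
      by (simp add: HL_nrm l2norm_def)
    then have "HL.nrm (wt f) \<le> C * HL.nrm f" using C by (simp add: HL_nrm l2norm_def real_sqrt_mult)
    then show ?thesis using i mm by (simp add: L2_def)
  qed
  then show ?thesis using that C by blast
qed

lemma L2_wt: "L2 \<Omega> f \<Longrightarrow> L2 \<Omega> (wt f)"
  using wt_bound by metis

lemma wt_symmetric: "l2ip \<Omega> (wt f) g = l2ip \<Omega> f (wt g)" if "L2 \<Omega> f" "L2 \<Omega> g"
  unfolding l2ip_def
proof (rule integral_cong_AE)
  show "(\<lambda>x. cdot (wt f x) (g x)) \<in> borel_measurable (lebesgue_on \<Omega>)" "(\<lambda>x. cdot (f x) (wt g x)) \<in> borel_measurable (lebesgue_on \<Omega>)"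
    using that L2_wt[of f] L2_wt[of g] by (auto intro!: borel_measurable_cdot simp: L2_def)
  have "AE x in lebesgue_on \<Omega>. transpose (m x) = m x" using adm by (simp add: admissible_coeff_def)
  then show "AE x in lebesgue_on \<Omega>. cdot (wt f x) (g x) = cdot (f x) (wt g x)"
    by eventually_elim (simp add: wt_def cdot_rmatvec_symmetric)
qed

lemma ipw_ge:
  assumes "L2 \<Omega> f"
  shows "c * (HL.nrm f)\<^sup>2 \<le> Re (ipw f f)"
proof -
  have i: "integrable (lebesgue_on \<Omega>) (\<lambda>x. cdot (wt f x) (f x))"
    using assms L2_wt by (intro integrable_cdot) (auto simp: L2_iff_L2m)
  have "c * (HL.nrm f)\<^sup>2 = (LINT x|lebesgue_on \<Omega>. c * (norm (f x))\<^sup>2)"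
    by (simp add: HL_nrm l2norm_def)
  also have "\<dots> \<le> (LINT x|lebesgue_on \<Omega>. Re (cdot (wt f x) (f x)))"
  proof (rule integral_mono_AE)
    show "AE x in lebesgue_on \<Omega>. c * (norm (f x))\<^sup>2 \<le> Re (cdot (wt f x) (f x))"
      using upos unfolding unif_pos_def by eventually_elim (simp add: wt_def Re_cdot_rmatvec_ge)
  qed (use assms i in \<open>auto simp: L2_def\<close>)
  also have "\<dots> = Re (ipw f f)" using integral_Re[OF i] by (simp add: ipw_def l2ip_def)
  finally show ?thesis .
qed

lemma wt_inj:
  assumes "L2 \<Omega> f" "L2 \<Omega> g" "HL.eqn (wt f) (wt g)"
  shows "HL.eqn f g"
proof -
  have L: "L2 \<Omega> (f - g)" "L2 \<Omega> (wt f)" "L2 \<Omega> (wt g)" using assms HL.diff_mem[of f g] L2_wt by auto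
  have "wt (f - g) = wt f - wt g" using wt_lin[of 1 f "-1" g] by simp
  then have "ipw (f - g) (f - g) = 0"
    using HL.eqn_ip_left[OF assms(3), of "f - g"] L by (simp add: ipw_def HL.ip_diff_left)
  then have "c * (HL.nrm (f - g))\<^sup>2 \<le> 0" using ipw_ge[OF L(1)] by simp
  then show ?thesis using c_pos by (simp add: HL.eqn_def mult_le_0_iff)
qed

end

text \<open>The weighted norm is equivalent to the unweighted one: coercivity carries Cauchy
  sequences over to the unweighted space, boundedness of the coefficient carries limits
  back.\<close>

sublocale weight \<subseteq> HW: semihilbert fscale "{f. L2 \<Omega> f}" ipw
proof (unfold_locales, goal_cases)
  case 1 show ?case using HL.zero_mem .
next
  case (2 x y) then show ?case using HL.add_mem by blast
next
  case (3 x a) then show ?case using HL.scale_mem by blast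
next
  case (4 x y z)
  then show ?case using wt_lin[of 1 x 1 y] L2_wt[of x] L2_wt[of y] by (simp add: ipw_def HL.ip_add_left)
next
  case (5 x y a)
  then show ?case using wt_lin[of a x 0 x] L2_wt[of x] by (simp add: ipw_def HL.ip_scale_left)
next
  case (6 x y)
  then show ?case using wt_symmetric[of y x] HL.ip_cnj[of "wt x" y] L2_wt[of x] by (simp add: ipw_def)
next
  case (7 x)
  have "0 \<le> c * (HL.nrm x)\<^sup>2" using c_pos by simp
  then show ?case using ipw_ge[of x] 7 by simp
next
  case (8 s)
  have s: "L2 \<Omega> (s n)" for n using 8(1)[of n] by simp
  have sd: "L2 \<Omega> (s m - s n)" for m n using HL.diff_mem[of "s m" "s n"] s by simp
  have cau: "\<exists>N. \<forall>m\<ge>N. \<forall>n\<ge>N. HL.nrm (s m - s n) < e" if e: "e > 0" for e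
  proof -
    obtain N where N: "\<And>m n. m \<ge> N \<Longrightarrow> n \<ge> N \<Longrightarrow> sqrt (Re (ipw (s m - s n) (s m - s n))) < sqrt c * e"
      using 8(2)[of "sqrt c * e"] c_pos e by auto
    have "HL.nrm (s m - s n) < e" if "m \<ge> N" "n \<ge> N" for m n
    proof -
      have "sqrt c * HL.nrm (s m - s n) = sqrt (c * (HL.nrm (s m - s n))\<^sup>2)"
        using HL.nrm_nonneg[of "s m - s n"] sd by (simp add: real_sqrt_mult)
      also have "\<dots> \<le> sqrt (Re (ipw (s m - s n) (s m - s n)))" using ipw_ge[OF sd] by simp
      also have "\<dots> < sqrt c * e" by (rule N[OF that])
      finally show ?thesis using c_pos by simp
    qed
    then show ?thesis by blast
  qed
  obtain p where p: "L2 \<Omega> p" "HL.conv s p" by (rule HL.cauchy_conv[of s, OF _ cau]) (use s in auto)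
  obtain C where C: "C \<ge> 0" "\<And>f. L2 \<Omega> f \<Longrightarrow> L2 \<Omega> (wt f) \<and> HL.nrm (wt f) \<le> C * HL.nrm f" using wt_bound by blast
  have "(\<lambda>n. Re (ipw (s n - p) (s n - p))) \<longlonglongrightarrow> 0"
  proof (rule Lim_null_comparison)
    show "\<forall>\<^sub>F n in sequentially. norm (Re (ipw (s n - p) (s n - p))) \<le> C * HL.nrm (s n - p) * HL.nrm (s n - p)"
    proof (intro always_eventually allI)
      fix n
      have d: "L2 \<Omega> (s n - p)" using HL.diff_mem[of "s n" p] s p by simp
      have "norm (Re (ipw (s n - p) (s n - p))) \<le> cmod (ipw (s n - p) (s n - p))" by (simp add: abs_Re_le_cmod)
      also have "\<dots> \<le> HL.nrm (wt (s n - p)) * HL.nrm (s n - p)"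
        unfolding ipw_def using d C(2)[OF d] by (intro HL.cauchy_schwarz) auto
      also have "\<dots> \<le> C * HL.nrm (s n - p) * HL.nrm (s n - p)"
        using d C(2)[OF d] by (intro mult_right_mono) auto
      finally show "norm (Re (ipw (s n - p) (s n - p))) \<le> C * HL.nrm (s n - p) * HL.nrm (s n - p)" .
    qed
    have "(\<lambda>n. C * HL.nrm (s n - p) * HL.nrm (s n - p)) \<longlonglongrightarrow> C * 0 * 0"
      using p(2) unfolding HL.conv_def by (intro tendsto_intros)
    then show "(\<lambda>n. C * HL.nrm (s n - p) * HL.nrm (s n - p)) \<longlonglongrightarrow> 0" by simp
  qed
  then have "(\<lambda>n. sqrt (Re (ipw (s n - p) (s n - p)))) \<longlonglongrightarrow> sqrt 0" by (rule tendsto_real_sqrt)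
  then show ?case using p(1) by auto
qed

context weight
begin

lemma HW_eqn_iff: "HW.eqn f g \<longleftrightarrow> HL.eqn f g" if "L2 \<Omega> f" "L2 \<Omega> g"
proof
  have d: "L2 \<Omega> (f - g)" using HL.diff_mem[of f g] that by simp
  assume "HW.eqn f g"
  then have "c * (HL.nrm (f - g))\<^sup>2 \<le> 0" using ipw_ge[OF d] by (simp add: HW.eqn_def HW.nrm_def)
  then show "HL.eqn f g" using c_pos by (simp add: HL.eqn_def mult_le_0_iff)
next
  have d: "L2 \<Omega> (f - g)" using HL.diff_mem[of f g] that by simp
  assume "HL.eqn f g"
  then have "ipw (f - g) (f - g) = 0"
    using HL.cauchy_schwarz[of "wt (f - g)" "f - g"] d L2_wt[OF d] by (simp add: ipw_def HL.eqn_def)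
  then show "HW.eqn f g" by (simp add: HW.eqn_def HW.nrm_def)
qed

text \<open>Division by the coefficient is obtained from the Riesz theorem in the weighted space, which
  avoids discussing the measurability of the inverse matrix.\<close>

definition solve :: "fld \<Rightarrow> fld" where
  "solve w = (SOME y. L2 \<Omega> y \<and> HL.eqn (wt y) w)"

lemma solve:
  assumes w: "L2 \<Omega> w"
  shows "L2 \<Omega> (solve w)" "HL.eqn (wt (solve w)) w"
proof -
  obtain y where y: "L2 \<Omega> y" "\<And>x. L2 \<Omega> x \<Longrightarrow> l2ip \<Omega> x w = ipw x y"
  proof (rule HW.riesz[of "\<lambda>u. l2ip \<Omega> u w" "HL.nrm w / sqrt c"])
    show "l2ip \<Omega> (fscale a x + fscale b y) w = a * l2ip \<Omega> x w + b * l2ip \<Omega> y w"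
      if "x \<in> {f. L2 \<Omega> f}" "y \<in> {f. L2 \<Omega> f}" for x y a b using that w by (simp add: l2ip_lin)
    show "cmod (l2ip \<Omega> x w) \<le> HL.nrm w / sqrt c * HW.nrm x" if x: "x \<in> {f. L2 \<Omega> f}" for x
    proof -
      have "sqrt c * HL.nrm x = sqrt (c * (HL.nrm x)\<^sup>2)" using HL.nrm_nonneg[OF x] by (simp add: real_sqrt_mult)
      also have "\<dots> \<le> HW.nrm x" using ipw_ge x by (simp add: HW.nrm_def)
      finally have "HL.nrm x \<le> HW.nrm x / sqrt c" using c_pos by (simp add: pos_le_divide_eq mult.commute)
      then have "HL.nrm x * HL.nrm w \<le> HW.nrm x / sqrt c * HL.nrm w" using w by (intro mult_right_mono) auto
      then show ?thesis using HL.cauchy_schwarz[of x w] x w by (simp add: mult.commute)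
    qed
  qed auto
  have "l2ip \<Omega> (wt y) x = l2ip \<Omega> w x" if x: "L2 \<Omega> x" for x
  proof -
    have "l2ip \<Omega> x w = l2ip \<Omega> x (wt y)" using y(2)[OF x] wt_symmetric[OF x y(1)] by (simp add: ipw_def)
    then show ?thesis using HL.ip_cnj[of x w] HL.ip_cnj[of x "wt y"] w x L2_wt[OF y(1)] by simp
  qed
  then have "HL.eqn (wt y) w" using w L2_wt[OF y(1)] by (simp add: HL.eqn_iff_ip)
  then have "\<exists>y. L2 \<Omega> y \<and> HL.eqn (wt y) w" using y(1) by blast
  from someI_ex[OF this] show "L2 \<Omega> (solve w)" "HL.eqn (wt (solve w)) w" unfolding solve_def by blast+
qed

lemma solve_unique: "L2 \<Omega> y \<Longrightarrow> L2 \<Omega> w \<Longrightarrow> HL.eqn (wt y) w \<Longrightarrow> HL.eqn (solve w) y"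
  by (rule wt_inj) (use solve L2_wt HL.eqn_trans[of "wt (solve w)" w "wt y"] HL.eqn_sym[of "wt y" w] in auto)

text \<open>Connects the Riesz solution with the pointwise inverse used in \<open>Mx\<close>: the
  inverse matrix is applied to \<open>wt (solve w) x = w x\<close> at almost every point.\<close>

lemma solve_aeq:
  assumes w: "L2 \<Omega> w"
  shows "AE x in lebesgue_on \<Omega>. solve w x = rmatvec (matrix_inv (m x)) (w x)"
proof -
  have "AE x in lebesgue_on \<Omega>. wt (solve w) x = w x"
    using solve[OF w] w L2_wt by (simp add: HL_eqn_iff aeq_def)
  then show ?thesis using upos unfolding unif_pos_def
  proof eventually_elim
    case (elim x)
    then show ?case using rmatvec_matrix_inv[OF _ c_pos, of "m x" "solve w x"] by (simp add: wt_def)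
  qed
qed

end

section \<open>Traces and the Maxwell operator\<close>

definition pscale :: "complex \<Rightarrow> st \<Rightarrow> st" where
  "pscale a u = (fscale a (fst u), fscale a (snd u))"

lemma lc_eq: "lc a u b v = pscale a u + pscale b v"
  by (simp add: lc_def pscale_def plus_prod_def fscale_def plus_fun_def)

lemma module_pscale: "module pscale"
proof -
  interpret module "fscale :: complex \<Rightarrow> fld \<Rightarrow> _" by (rule module_fscale)
  show ?thesis
    by unfold_locales (auto simp: pscale_def scale_right_distrib scale_left_distrib)
qed

lemma semihilbert_prod:
  assumes "semihilbert fscale Ha ipa" "semihilbert fscale Hb ipb"
  shows "semihilbert pscale {u. fst u \<in> Ha \<and> snd u \<in> Hb} (\<lambda>u v. ipa (fst u) (fst v) + ipb (snd u) (snd v))"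
proof -
  interpret a: semihilbert fscale Ha ipa by fact
  interpret b: semihilbert fscale Hb ipb by fact
  interpret module pscale by (rule module_pscale)
  show ?thesis
  proof (unfold_locales, goal_cases)
    case (8 s)
    have s: "fst (s n) \<in> Ha" "snd (s n) \<in> Hb" for n using 8(1)[of n] by auto
    have sd: "fst (s m) - fst (s n) \<in> Ha" "snd (s m) - snd (s n) \<in> Hb" for m n using s by auto
    define N where "N m n = sqrt (Re (ipa (fst (s m) - fst (s n)) (fst (s m) - fst (s n)) +
      ipb (snd (s m) - snd (s n)) (snd (s m) - snd (s n))))" for m n
    have le: "a.nrm (fst (s m) - fst (s n)) \<le> N m n" "b.nrm (snd (s m) - snd (s n)) \<le> N m n" for m n
      unfolding N_def a.nrm_def b.nrm_def using a.ip_pos[OF sd(1)] b.ip_pos[OF sd(2)] by auto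
    have N: "\<exists>K. \<forall>m\<ge>K. \<forall>n\<ge>K. N m n < e" if "e > 0" for e
      using 8(2)[OF that] by (simp add: N_def)
    have ca: "\<exists>K. \<forall>m\<ge>K. \<forall>n\<ge>K. a.nrm (fst (s m) - fst (s n)) < e" if "e > 0" for e
      using N[OF that] le(1) by (meson le_less_trans)
    have cb: "\<exists>K. \<forall>m\<ge>K. \<forall>n\<ge>K. b.nrm (snd (s m) - snd (s n)) < e" if "e > 0" for e
      using N[OF that] le(2) by (meson le_less_trans)
    obtain p where p: "p \<in> Ha" "a.conv (\<lambda>n. fst (s n)) p" by (rule a.cauchy_conv[of "\<lambda>n. fst (s n)", OF s(1) ca]) auto
    obtain q where q: "q \<in> Hb" "b.conv (\<lambda>n. snd (s n)) q" by (rule b.cauchy_conv[of "\<lambda>n. snd (s n)", OF s(2) cb]) auto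
    have "sqrt (Re (ipa (fst (s n) - p) (fst (s n) - p) + ipb (snd (s n) - q) (snd (s n) - q)))
        = sqrt ((a.nrm (fst (s n) - p))\<^sup>2 + (b.nrm (snd (s n) - q))\<^sup>2)" for n
      using s p q by (simp add: a.nrm_sq b.nrm_sq)
    moreover have "(\<lambda>n. sqrt ((a.nrm (fst (s n) - p))\<^sup>2 + (b.nrm (snd (s n) - q))\<^sup>2)) \<longlonglongrightarrow> sqrt (0\<^sup>2 + 0\<^sup>2)"
      using p(2) q(2) unfolding a.conv_def b.conv_def by (intro tendsto_intros)
    ultimately show ?case using p(1) q(1) by (intro bexI[of _ "(p, q)"]) auto
  next
    case (6 x y)
    then show ?case using a.ip_cnj[of "fst x" "fst y"] b.ip_cnj[of "snd x" "snd y"] by simp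
  qed (auto simp: pscale_def a.ip_add_left b.ip_add_left a.ip_scale_left b.ip_scale_left a.ip_pos b.ip_pos
      algebra_simps)
qed

section \<open>Tangential fields and trace norms\<close>

lemma L2t_iff: "L2t \<Omega> f \<longleftrightarrow> L2m (surf \<Omega>) f \<and> (AE x in surf \<Omega>. ndot (normal \<Omega> x) (f x) = 0)"
  by (simp add: L2t_def L2m_def)

lemma ip_t_eq_ipm: "ip_t \<Omega> = ipm (surf \<Omega>)"
  by (simp add: ip_t_def ipm_def fun_eq_iff)

sublocale curl_domain \<subseteq> G: semihilbert fscale "{f. L2t \<Omega> f}" "ip_t \<Omega>"
  using semihilbert_L2[of "surf \<Omega>" "normal \<Omega>"] by (simp add: L2t_iff ip_t_eq_ipm)

context curl_domain
begin

lemma G_nrm: "G.nrm f = norm_t \<Omega> f"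
  unfolding G.nrm_def norm_t_def by (simp add: ip_t_eq_ipm ipm_self)

lemma G_eqn_iff:
  assumes "L2t \<Omega> f" "L2t \<Omega> g"
  shows "G.eqn f g \<longleftrightarrow> aeq_t \<Omega> f g"
proof -
  have d: "L2m (surf \<Omega>) (\<lambda>x. f x - g x)" using assms by (simp add: L2t_iff L2m_diff)
  have "G.eqn f g \<longleftrightarrow> (LINT x|surf \<Omega>. (norm (f x - g x))\<^sup>2) = 0"
    by (simp add: G.eqn_def G_nrm norm_t_def)
  then show ?thesis using ipm_zero_iff[OF d] by (simp add: aeq_t_def)
qed

lemma L2t_lin: "L2t \<Omega> f \<Longrightarrow> L2t \<Omega> g \<Longrightarrow> L2t \<Omega> (fscale a f + fscale b g)"
  using G.add_mem[of "fscale a f" "fscale b g"] G.scale_mem[of f a] G.scale_mem[of g b] by simp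

lemma contraction_t_iff: "contraction_t \<Omega> K \<longleftrightarrow> G.contr K"
proof -
  have "contraction_t \<Omega> K \<longleftrightarrow>
     (\<forall>f. L2t \<Omega> f \<longrightarrow> L2t \<Omega> (K f)) \<and>
     (\<forall>f g. L2t \<Omega> f \<and> L2t \<Omega> g \<and> aeq_t \<Omega> f g \<longrightarrow> aeq_t \<Omega> (K f) (K g)) \<and>
     (\<forall>f g a b. L2t \<Omega> f \<and> L2t \<Omega> g \<longrightarrow>
        aeq_t \<Omega> (K (fscale a f + fscale b g)) (fscale a (K f) + fscale b (K g))) \<and>
     (\<forall>f. L2t \<Omega> f \<longrightarrow> G.nrm (K f) \<le> G.nrm f)"
    unfolding contraction_t_def G_nrm fun_combination(1)[symmetric] ..
  also have "\<dots> \<longleftrightarrow> G.contr K"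
    unfolding G.contr_def by (auto simp: G_eqn_iff L2t_lin)
  finally show ?thesis .
qed

lemma unitary_t_iff: "unitary_t \<Omega> K \<longleftrightarrow> G.unit K"
proof (cases "G.contr K")
  case True
  then have "aeq_t \<Omega> (K f) g \<longleftrightarrow> G.eqn (K f) g" if "L2t \<Omega> f" "L2t \<Omega> g" for f g
    using G_eqn_iff[OF _ that(2)] that(1) G.contrD(1)[of K f] by simp
  then have "(\<forall>g. L2t \<Omega> g \<longrightarrow> (\<exists>f. L2t \<Omega> f \<and> aeq_t \<Omega> (K f) g))
      \<longleftrightarrow> (\<forall>g\<in>{f. L2t \<Omega> f}. \<exists>f\<in>{f. L2t \<Omega> f}. G.eqn (K f) g)" by blast
  then show ?thesis unfolding unitary_t_def G.unit_def contraction_t_iff G_nrm[symmetric] by simp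
next
  case False
  then show ?thesis by (simp add: unitary_t_def G.unit_def contraction_t_iff)
qed

lemma pi_norm_le:
  assumes "hcurl \<Omega> U'" "teq \<Omega> U' U"
  shows "pi_norm \<Omega> U \<le> HC.nrm U'"
  unfolding pi_norm_def
  by (rule cInf_lower) (use assms HC_nrm in \<open>auto simp: hcurl_norm_def intro!: bdd_belowI[of _ 0]\<close>)

lemma teq_refl: "hcurl \<Omega> U \<Longrightarrow> teq \<Omega> U U"
  by (simp add: teq_iff)

lemma pi_norm_nonneg:
  assumes "hcurl \<Omega> U"
  shows "0 \<le> pi_norm \<Omega> U"
  unfolding pi_norm_def
  by (rule cInf_greatest) (use assms teq_refl in \<open>auto simp: hcurl_norm_def\<close>)

text \<open>The pairing sees only the trace of \<open>U\<close>, so its continuity bound can be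
  minimised over all fields with the same trace.\<close>

lemma bd_pair_pi_norm:
  assumes "hcurl \<Omega> U" "hcurl \<Omega> W"
  shows "cmod (bd_pair \<Omega> U W) \<le> 2 * pi_norm \<Omega> U * HC.nrm W"
proof (cases "HC.nrm W = 0")
  case True
  then show ?thesis using bd_pair_bound[OF assms] by simp
next
  case False
  then have pos: "HC.nrm W > 0" using HC.nrm_nonneg[of W] assms by (simp add: less_le)
  have "cmod (bd_pair \<Omega> U W) / (2 * HC.nrm W) \<le> pi_norm \<Omega> U"
    unfolding pi_norm_def
  proof (rule cInf_greatest)
    show "{hcurl_norm \<Omega> U' | U'. hcurl \<Omega> U' \<and> teq \<Omega> U' U} \<noteq> {}" using assms teq_refl by blast
    fix x assume "x \<in> {hcurl_norm \<Omega> U' | U'. hcurl \<Omega> U' \<and> teq \<Omega> U' U}"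
    then obtain U' where U': "hcurl \<Omega> U'" "teq \<Omega> U' U" "x = HC.nrm U'" using HC_nrm by auto
    have "bd_pair \<Omega> U W = bd_pair \<Omega> U' W" using U' assms teq_iff by simp
    then have "cmod (bd_pair \<Omega> U W) \<le> 2 * HC.nrm U' * HC.nrm W" using bd_pair_bound[OF U'(1) assms(2)] by simp
    then show "cmod (bd_pair \<Omega> U W) / (2 * HC.nrm W) \<le> x" using pos U'(3) by (simp add: field_simps)
  qed
  then show ?thesis using pos by (simp add: field_simps)
qed

end

section \<open>The inverse of V and its pairing-adjoint\<close>

locale maxwell = curl_domain \<Omega> + E: weight \<Omega> \<epsilon> c + M: weight \<Omega> \<mu> c
  for \<Omega> :: "pt set" and \<epsilon> \<mu> :: "pt \<Rightarrow> real^3^3" and c :: real +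
  fixes V :: "fld \<Rightarrow> fld"
  assumes V: "lin_homeo_V \<Omega> V"

sublocale maxwell \<subseteq> X: semihilbert pscale "{u. L2em \<Omega> u}" "em_ip \<Omega> \<epsilon> \<mu>"
proof -
  have "em_ip \<Omega> \<epsilon> \<mu> = (\<lambda>u v. E.ipw (fst u) (fst v) + M.ipw (snd u) (snd v))"
    by (simp add: fun_eq_iff em_ip_def E.ipw_def M.ipw_def E.wt_def M.wt_def)
  moreover have "{u. L2em \<Omega> u} = {u. fst u \<in> {f. L2 \<Omega> f} \<and> snd u \<in> {f. L2 \<Omega> f}}" by (simp add: L2em_def)
  ultimately show "semihilbert pscale {u. L2em \<Omega> u} (em_ip \<Omega> \<epsilon> \<mu>)"
    using semihilbert_prod[OF E.HW.semihilbert_axioms M.HW.semihilbert_axioms] by simp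
qed

context maxwell
begin

lemma em_ip_eq: "em_ip \<Omega> \<epsilon> \<mu> u v = E.ipw (fst u) (fst v) + M.ipw (snd u) (snd v)"
  by (simp add: em_ip_def E.ipw_def M.ipw_def E.wt_def M.wt_def)

lemma X_nrm: "X.nrm = em_norm \<Omega> \<epsilon> \<mu>"
  by (simp add: fun_eq_iff X.nrm_def em_norm_def)

lemma X_eqn_iff_HL:
  assumes "L2em \<Omega> u" "L2em \<Omega> v"
  shows "X.eqn u v \<longleftrightarrow> HL.eqn (fst u) (fst v) \<and> HL.eqn (snd u) (snd v)"
proof -
  have L: "L2 \<Omega> (fst u)" "L2 \<Omega> (fst v)" "L2 \<Omega> (snd u)" "L2 \<Omega> (snd v)" using assms by (auto simp: L2em_def)
  have d: "L2 \<Omega> (fst u - fst v)" "L2 \<Omega> (snd u - snd v)"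
    using L HL.diff_mem[of "fst u" "fst v"] HL.diff_mem[of "snd u" "snd v"] by auto
  have "X.eqn u v \<longleftrightarrow> (E.HW.nrm (fst u - fst v))\<^sup>2 + (M.HW.nrm (snd u - snd v))\<^sup>2 = 0"
    using d by (simp add: X.eqn_def X.nrm_def em_ip_eq E.HW.nrm_sq M.HW.nrm_sq)
  also have "\<dots> \<longleftrightarrow> E.HW.eqn (fst u) (fst v) \<and> M.HW.eqn (snd u) (snd v)"
    by (simp add: E.HW.eqn_def M.HW.eqn_def sum_power2_eq_zero_iff)
  finally show ?thesis using L by (simp add: E.HW_eqn_iff M.HW_eqn_iff)
qed

lemma X_eqn_iff: "L2em \<Omega> u \<Longrightarrow> L2em \<Omega> v \<Longrightarrow> X.eqn u v \<longleftrightarrow> eqv \<Omega> u v"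
  by (simp add: X_eqn_iff_HL eqv_def HL_eqn_iff L2em_def)

lemma hcurl_V: "L2t \<Omega> f \<Longrightarrow> hcurl \<Omega> (V f)"
  using V by (simp add: lin_homeo_V_def)

lemma V_lin:
  "L2t \<Omega> f \<Longrightarrow> L2t \<Omega> g \<Longrightarrow> teq \<Omega> (V (fscale a f + fscale b g)) (fscale a (V f) + fscale b (V g))"
  using V unfolding lin_homeo_V_def fun_combination(1)[symmetric] by blast

lemma V_inj:
  assumes "L2t \<Omega> f" "L2t \<Omega> g" "\<And>W. hcurl \<Omega> W \<Longrightarrow> bd_pair \<Omega> (V f) W = bd_pair \<Omega> (V g) W"
  shows "G.eqn f g"
proof -
  have "teq \<Omega> (V f) (V g)" using assms hcurl_V teq_iff by simp
  then have "aeq_t \<Omega> f g" using V assms(1,2) unfolding lin_homeo_V_def by blast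
  then show ?thesis using G_eqn_iff assms by simp
qed

lemma Vinv:
  assumes "hcurl \<Omega> U"
  shows "L2t \<Omega> (Vinv \<Omega> V U)" "teq \<Omega> (V (Vinv \<Omega> V U)) U"
proof -
  have "\<exists>f. L2t \<Omega> f \<and> teq \<Omega> (V f) U" using V assms unfolding lin_homeo_V_def by blast
  from someI_ex[OF this] show "L2t \<Omega> (Vinv \<Omega> V U)" "teq \<Omega> (V (Vinv \<Omega> V U)) U" unfolding Vinv_def by blast+
qed

lemma bd_pair_Vinv: "hcurl \<Omega> U \<Longrightarrow> hcurl \<Omega> W \<Longrightarrow> bd_pair \<Omega> (V (Vinv \<Omega> V U)) W = bd_pair \<Omega> U W"
  using Vinv[of U] teq_iff[OF hcurl_V, of "Vinv \<Omega> V U" U] by blast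

lemma bd_pair_V_lin:
  assumes "L2t \<Omega> f" "L2t \<Omega> g" "hcurl \<Omega> W"
  shows "bd_pair \<Omega> (V (fscale a f + fscale b g)) W = a * bd_pair \<Omega> (V f) W + b * bd_pair \<Omega> (V g) W"
proof -
  have "bd_pair \<Omega> (V (fscale a f + fscale b g)) W = bd_pair \<Omega> (fscale a (V f) + fscale b (V g)) W"
    using V_lin[OF assms(1,2), of a b] teq_iff[OF hcurl_V[OF L2t_lin[OF assms(1,2)]] hcurl_lin(1)[OF hcurl_V hcurl_V]] assms
    by blast
  then show ?thesis using bd_pair_lin hcurl_V assms by simp
qed

text \<open>\<open>Vinv\<close> is a choice; its pairings with all of H(curl) pin it down modulo
  null fields, because \<open>V\<close> is injective modulo equality of traces.\<close>

lemma Vinv_unique: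
  assumes "hcurl \<Omega> U" "L2t \<Omega> f" "\<And>W. hcurl \<Omega> W \<Longrightarrow> bd_pair \<Omega> (V f) W = bd_pair \<Omega> U W"
  shows "G.eqn (Vinv \<Omega> V U) f"
  using assms Vinv bd_pair_Vinv by (intro V_inj) auto

lemma Vinv_lin:
  assumes "hcurl \<Omega> U" "hcurl \<Omega> U'"
  shows "G.eqn (Vinv \<Omega> V (fscale a U + fscale b U')) (fscale a (Vinv \<Omega> V U) + fscale b (Vinv \<Omega> V U'))"
  using assms hcurl_lin(1)[OF assms] L2t_lin Vinv bd_pair_V_lin bd_pair_lin bd_pair_Vinv
  by (intro Vinv_unique) auto

lemma Vinv_eq_zero:
  assumes "hcurl \<Omega> U" "\<And>W. hcurl \<Omega> W \<Longrightarrow> bd_pair \<Omega> U W = 0"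
  shows "G.eqn (Vinv \<Omega> V U) 0"
proof (rule Vinv_unique[OF assms(1)])
  show z: "L2t \<Omega> 0" using G.zero_mem by simp
  show "bd_pair \<Omega> (V 0) W = bd_pair \<Omega> U W" if "hcurl \<Omega> W" for W
    using bd_pair_V_lin[OF z z that, of 0 0] assms(2)[OF that] by simp
qed

text \<open>The second estimate is continuity of the inverse: \<open>U\<close> itself competes in
  the infimum defining the trace norm of \<open>V (Vinv \<Omega> V U)\<close>.\<close>

lemma V_bounds:
  obtains C where "C \<ge> 0" "\<And>f. L2t \<Omega> f \<Longrightarrow> pi_norm \<Omega> (V f) \<le> C * G.nrm f"
    "\<And>U. hcurl \<Omega> U \<Longrightarrow> G.nrm (Vinv \<Omega> V U) \<le> C * HC.nrm U"
proof -
  obtain C0 where C0: "\<And>f. L2t \<Omega> f \<Longrightarrow> pi_norm \<Omega> (V f) \<le> C0 * G.nrm f"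
    "\<And>f. L2t \<Omega> f \<Longrightarrow> G.nrm f \<le> C0 * pi_norm \<Omega> (V f)"
    using V unfolding lin_homeo_V_def G_nrm by blast
  have 1: "pi_norm \<Omega> (V f) \<le> \<bar>C0\<bar> * G.nrm f" if "L2t \<Omega> f" for f
    using C0(1)[OF that] mult_right_mono[OF abs_ge_self[of C0], of "G.nrm f"] that by simp
  have 2: "G.nrm (Vinv \<Omega> V U) \<le> \<bar>C0\<bar> * HC.nrm U" if U: "hcurl \<Omega> U" for U
  proof -
    note v = Vinv[OF U]
    have t: "teq \<Omega> U (V (Vinv \<Omega> V U))" using bd_pair_Vinv[OF U] U hcurl_V[OF v(1)] by (simp add: teq_iff)
    have "G.nrm (Vinv \<Omega> V U) \<le> C0 * pi_norm \<Omega> (V (Vinv \<Omega> V U))" by (rule C0(2)[OF v(1)])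
    also have "\<dots> \<le> \<bar>C0\<bar> * pi_norm \<Omega> (V (Vinv \<Omega> V U))"
      using pi_norm_nonneg[OF hcurl_V[OF v(1)]] by (intro mult_right_mono) auto
    also have "\<dots> \<le> \<bar>C0\<bar> * HC.nrm U" using pi_norm_le[OF U t] by (intro mult_left_mono) auto
    finally show ?thesis .
  qed
  show ?thesis using that[of "\<bar>C0\<bar>"] 1 2 by simp
qed

text \<open>The choice in \<open>Vsharp\<close> is legitimate: \<open>V\<close> is bounded into the
  trace norm, so pairing with \<open>W\<close> is a bounded functional on tangential fields,
  represented by Riesz.\<close>

lemma Vsharp:
  assumes W: "hcurl \<Omega> W"
  shows "L2t \<Omega> (Vsharp \<Omega> V W)" "\<And>f. L2t \<Omega> f \<Longrightarrow> bd_pair \<Omega> (V f) W = ip_t \<Omega> f (Vsharp \<Omega> V W)"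
proof -
  obtain C where C: "C \<ge> 0" "\<And>f. L2t \<Omega> f \<Longrightarrow> pi_norm \<Omega> (V f) \<le> C * G.nrm f" using V_bounds by metis
  obtain g where "g \<in> {f. L2t \<Omega> f}" "\<And>f. f \<in> {f. L2t \<Omega> f} \<Longrightarrow> bd_pair \<Omega> (V f) W = ip_t \<Omega> f g"
  proof (rule G.riesz[of "\<lambda>f. bd_pair \<Omega> (V f) W" "2 * C * HC.nrm W"])
    show "bd_pair \<Omega> (V (fscale a x + fscale b y)) W = a * bd_pair \<Omega> (V x) W + b * bd_pair \<Omega> (V y) W"
      if "x \<in> {f. L2t \<Omega> f}" "y \<in> {f. L2t \<Omega> f}" for x y a b using bd_pair_V_lin that W by simp
    show "cmod (bd_pair \<Omega> (V x) W) \<le> 2 * C * HC.nrm W * G.nrm x" if x: "x \<in> {f. L2t \<Omega> f}" for x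
    proof -
      have "cmod (bd_pair \<Omega> (V x) W) \<le> 2 * pi_norm \<Omega> (V x) * HC.nrm W"
        using bd_pair_pi_norm[OF hcurl_V W] x by simp
      also have "\<dots> \<le> 2 * (C * G.nrm x) * HC.nrm W"
        using C(2)[of x] x W HC.nrm_nonneg[of W] by (intro mult_right_mono mult_left_mono) auto
      finally show ?thesis by (simp add: mult_ac)
    qed
  qed blast
  then have "\<exists>g. L2t \<Omega> g \<and> (\<forall>f. L2t \<Omega> f \<longrightarrow> bd_pair \<Omega> (V f) W = ip_t \<Omega> f g)" by auto
  from someI_ex[OF this]
  show "L2t \<Omega> (Vsharp \<Omega> V W)" "\<And>f. L2t \<Omega> f \<Longrightarrow> bd_pair \<Omega> (V f) W = ip_t \<Omega> f (Vsharp \<Omega> V W)"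
    unfolding Vsharp_def by blast+
qed

text \<open>Moves the boundary pairing into one Hilbert space, the tangential fields, where
  contractions can act on it.\<close>

lemma bd_pair_eq_ip_t:
  assumes "hcurl \<Omega> U" "hcurl \<Omega> W"
  shows "bd_pair \<Omega> U W = ip_t \<Omega> (Vinv \<Omega> V U) (Vsharp \<Omega> V W)"
  using bd_pair_Vinv[OF assms] Vsharp(2)[OF assms(2) Vinv(1)[OF assms(1)]] by simp

lemma Vsharp_unique:
  assumes "hcurl \<Omega> W" "L2t \<Omega> g" "\<And>f. L2t \<Omega> f \<Longrightarrow> bd_pair \<Omega> (V f) W = ip_t \<Omega> f g"
  shows "G.eqn (Vsharp \<Omega> V W) g"
proof -
  have "ip_t \<Omega> (Vsharp \<Omega> V W) f = ip_t \<Omega> g f" if "L2t \<Omega> f" for f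
    using Vsharp(2)[OF assms(1) that] assms(3)[OF that] Vsharp(1)[OF assms(1)] assms(2) that
      G.ip_cnj[of f g] G.ip_cnj[of f "Vsharp \<Omega> V W"] by simp
  then show ?thesis using Vsharp(1)[OF assms(1)] assms(2) by (simp add: G.eqn_iff_ip)
qed

lemma Vinv_surj: "L2t \<Omega> f \<Longrightarrow> G.eqn (Vinv \<Omega> V (V f)) f"
  using hcurl_V by (intro Vinv_unique) auto

text \<open>The field representing a given trace functional on H(curl) is the curl of its Riesz
  representative R, because curl curl R = - R.\<close>

lemma Vsharp_surj:
  assumes g: "L2t \<Omega> g"
  obtains W where "hcurl \<Omega> W" "G.eqn (Vsharp \<Omega> V W) g"
proof -
  obtain C where C: "C \<ge> 0" "\<And>U. hcurl \<Omega> U \<Longrightarrow> G.nrm (Vinv \<Omega> V U) \<le> C * HC.nrm U" using V_bounds by metis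
  obtain R where R: "hcurl \<Omega> R" "\<And>U. hcurl \<Omega> U \<Longrightarrow> ip_t \<Omega> (Vinv \<Omega> V U) g = hc_ip U R"
  proof (rule HC.riesz[of "\<lambda>U. ip_t \<Omega> (Vinv \<Omega> V U) g" "C * G.nrm g"])
    fix x y a b assume xy: "x \<in> {U. hcurl \<Omega> U}" "y \<in> {U. hcurl \<Omega> U}"
    have L: "L2t \<Omega> (Vinv \<Omega> V x)" "L2t \<Omega> (Vinv \<Omega> V y)" "L2t \<Omega> (Vinv \<Omega> V (fscale a x + fscale b y))"
      using Vinv(1) hcurl_lin(1)[of x y] xy by auto
    have "ip_t \<Omega> (Vinv \<Omega> V (fscale a x + fscale b y)) g = ip_t \<Omega> (fscale a (Vinv \<Omega> V x) + fscale b (Vinv \<Omega> V y)) g"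
      using Vinv_lin[of x y a b] L L2t_lin[OF L(1,2)] xy g by (intro G.eqn_ip_left) auto
    then show "ip_t \<Omega> (Vinv \<Omega> V (fscale a x + fscale b y)) g = a * ip_t \<Omega> (Vinv \<Omega> V x) g + b * ip_t \<Omega> (Vinv \<Omega> V y) g"
      using L g G.scale_mem[of "Vinv \<Omega> V x" a] G.scale_mem[of "Vinv \<Omega> V y" b] by (simp add: G.ip_add_left G.ip_scale_left)
  next
    fix x assume x: "x \<in> {U. hcurl \<Omega> U}"
    have "cmod (ip_t \<Omega> (Vinv \<Omega> V x) g) \<le> G.nrm (Vinv \<Omega> V x) * G.nrm g"
      using Vinv(1) x g by (intro G.cauchy_schwarz) auto
    also have "\<dots> \<le> C * HC.nrm x * G.nrm g" using C(2) x g by (intro mult_right_mono) auto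
    finally show "cmod (ip_t \<Omega> (Vinv \<Omega> V x) g) \<le> C * G.nrm g * HC.nrm x" by (simp add: mult_ac)
  qed auto
  note L = hcurl_L2[OF R(1)] L2_dcurl[OF R(1)]
  have mR: "L2 \<Omega> (- R)" using HL.uminus_mem[of R] L by simp
  have "l2ip \<Omega> (dcurl \<Omega> R) (curl \<phi>) = l2ip \<Omega> (- R) \<phi>" if t: "test_field \<Omega> \<phi>" for \<phi>
  proof -
    note h = hcurl_test_field[OF t] and T = L2_test_field[OF open_dom t]
    \<comment> \<open>Test fields have zero trace, so the graph product of \<phi> with
      \<open>R\<close> vanishes; this is curl curl R = -R in weak form.\<close>
    have "G.eqn (Vinv \<Omega> V \<phi>) 0" using Vinv_eq_zero[OF h(1)] bd_pair_test_field[OF t] by simp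
    then have "ip_t \<Omega> (Vinv \<Omega> V \<phi>) g = 0"
      using G.eqn_ip_left[of "Vinv \<Omega> V \<phi>" 0 g] Vinv(1)[OF h(1)] G.zero_mem g by simp
    then have "l2ip \<Omega> \<phi> R + l2ip \<Omega> (dcurl \<Omega> \<phi>) (dcurl \<Omega> R) = 0" using R(2)[OF h(1)] by (simp add: hc_ip_def)
    moreover have "l2ip \<Omega> (dcurl \<Omega> \<phi>) (dcurl \<Omega> R) = l2ip \<Omega> (curl \<phi>) (dcurl \<Omega> R)"
      using h L T L2_dcurl by (intro HL.eqn_ip_left) auto
    ultimately have "l2ip \<Omega> (curl \<phi>) (dcurl \<Omega> R) = - l2ip \<Omega> \<phi> R" by (simp add: add_eq_0_iff)
    then have "l2ip \<Omega> (dcurl \<Omega> R) (curl \<phi>) = - l2ip \<Omega> R \<phi>"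
      using HL.ip_cnj[of "curl \<phi>" "dcurl \<Omega> R"] HL.ip_cnj[of \<phi> R] T L by simp
    then show ?thesis using T L by (simp add: HL.ip_minus_left)
  qed
  then have "is_dcurl \<Omega> (dcurl \<Omega> R) (- R)" using mR by (simp add: is_dcurl_def)
  from dcurl_eqI[OF L(2) this] have W: "hcurl \<Omega> (dcurl \<Omega> R)" "HL.eqn (dcurl \<Omega> (dcurl \<Omega> R)) (- R)" .
  \<comment> \<open>With this second curl, the pairing with \<open>dcurl \<Omega> R\<close> becomes
    the graph inner product with \<open>R\<close>.\<close>
  have bd: "bd_pair \<Omega> U (dcurl \<Omega> R) = hc_ip U R" if U: "hcurl \<Omega> U" for U
  proof -
    have "l2ip \<Omega> U (dcurl \<Omega> (dcurl \<Omega> R)) = l2ip \<Omega> U (- R)"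
      using W mR L2_dcurl[OF W(1)] hcurl_L2[OF U] by (intro HL.eqn_ip_right) auto
    then show ?thesis using hcurl_L2[OF U] L by (simp add: bd_pair_def hc_ip_def HL.ip_minus_right)
  qed
  have "bd_pair \<Omega> (V f) (dcurl \<Omega> R) = ip_t \<Omega> f g" if f: "L2t \<Omega> f" for f
  proof -
    have "bd_pair \<Omega> (V f) (dcurl \<Omega> R) = ip_t \<Omega> (Vinv \<Omega> V (V f)) g"
      using bd R(2) hcurl_V[OF f] by simp
    then show ?thesis using G.eqn_ip_left[OF Vinv_surj[OF f], of g] Vinv(1)[OF hcurl_V[OF f]] f g by simp
  qed
  from Vsharp_unique[OF W(1) g this] show ?thesis using that W(1) by blast
qed

section \<open>The Maxwell operator as a boundary triple\<close>

definition dom :: "st set" where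
  "dom = {u. hcurl \<Omega> (fst u) \<and> hcurl \<Omega> (snd u)}"

text \<open>The adjoint expression with \<open>solve\<close> in place of pointwise inverse matrices,
  so that square-integrability and weighted products are immediate. It agrees with \<open>Mx\<close>
  almost everywhere.\<close>

definition mxop :: "st \<Rightarrow> st" where
  "mxop u = (fscale \<i> (E.solve (dcurl \<Omega> (snd u))), fscale (- \<i>) (M.solve (dcurl \<Omega> (fst u))))"

definition bP :: "st \<Rightarrow> fld" where
  "bP u = Vsharp \<Omega> V (fst u) + Vinv \<Omega> V (snd u)"

definition bQ :: "st \<Rightarrow> fld" where
  "bQ u = Vsharp \<Omega> V (fst u) - Vinv \<Omega> V (snd u)"

lemma L2em_mxop: "u \<in> dom \<Longrightarrow> L2em \<Omega> (mxop u)"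
  using E.solve(1)[OF L2_dcurl, of "snd u"] M.solve(1)[OF L2_dcurl, of "fst u"]
    HL.scale_mem[of "E.solve (dcurl \<Omega> (snd u))" \<i>] HL.scale_mem[of "M.solve (dcurl \<Omega> (fst u))" "- \<i>"]
  by (simp add: dom_def mxop_def L2em_def)

lemma mxop_Mx: "u \<in> dom \<Longrightarrow> eqv \<Omega> (mxop u) (Mx \<Omega> \<epsilon> \<mu> u)"
  using E.solve_aeq[OF L2_dcurl, of "snd u"] M.solve_aeq[OF L2_dcurl, of "fst u"]
  by (auto simp: dom_def mxop_def Mx_def eqv_def aeq_def fscale_def)

lemma AE_eq_trans:
  assumes "AE x in M. f x = g x"
  shows "(AE x in M. w x = g x) \<longleftrightarrow> (AE x in M. w x = f x)"
  by (rule eventually_subst) (use assms in \<open>auto elim!: eventually_mono\<close>)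

lemma eqv_Mx_iff:
  assumes "u \<in> dom" "L2em \<Omega> w"
  shows "eqv \<Omega> w (Mx \<Omega> \<epsilon> \<mu> u) \<longleftrightarrow> X.eqn w (mxop u)"
proof -
  have "eqv \<Omega> w (Mx \<Omega> \<epsilon> \<mu> u) \<longleftrightarrow> eqv \<Omega> w (mxop u)"
    using mxop_Mx[OF assms(1)] AE_eq_trans unfolding eqv_def aeq_def by blast
  then show ?thesis using X_eqn_iff[OF assms(2) L2em_mxop[OF assms(1)]] by simp
qed

lemma ipw_solve:
  assumes "L2 \<Omega> w" "L2 \<Omega> f"
  shows "E.ipw (fscale k (E.solve w)) f = k * l2ip \<Omega> w f" "M.ipw (fscale k (M.solve w)) f = k * l2ip \<Omega> w f"
  using assms E.solve[OF assms(1)] M.solve[OF assms(1)] E.HW.ip_scale_left[of "E.solve w" f k] M.HW.ip_scale_left[of "M.solve w" f k]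
    HL.eqn_ip_left[OF E.solve(2)[OF assms(1)], of f] HL.eqn_ip_left[OF M.solve(2)[OF assms(1)], of f] E.L2_wt M.L2_wt
  by (simp_all add: E.ipw_def M.ipw_def)

text \<open>The weights of the inner product cancel the inverse coefficients, leaving unweighted
  curl terms.\<close>

lemma em_ip_mxop:
  assumes "u \<in> dom" "L2em \<Omega> v"
  shows "em_ip \<Omega> \<epsilon> \<mu> (mxop u) v = \<i> * l2ip \<Omega> (dcurl \<Omega> (snd u)) (fst v) - \<i> * l2ip \<Omega> (dcurl \<Omega> (fst u)) (snd v)"
proof -
  have L: "L2 \<Omega> (dcurl \<Omega> (snd u))" "L2 \<Omega> (dcurl \<Omega> (fst u))" "L2 \<Omega> (fst v)" "L2 \<Omega> (snd v)"
    using assms L2_dcurl by (auto simp: dom_def L2em_def)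
  show ?thesis
    unfolding em_ip_eq mxop_def fst_conv snd_conv ipw_solve(1)[OF L(1,3)] ipw_solve(2)[OF L(2,4)] by simp
qed

lemma L2em_dom: "u \<in> dom \<Longrightarrow> L2em \<Omega> u"
  by (simp add: dom_def L2em_def hcurl_L2)

text \<open>The curl terms add up to i ((a | b') + (b | a')), with a from the magnetic field through
  V^{-1} and b from the electric field through V^#. Half the difference of (b + a | b' + a') and (b
  - a | b' - a') is the same sum.\<close>

lemma maxwell_green:
  assumes u: "u \<in> dom" and v: "v \<in> dom"
  shows "em_ip \<Omega> \<epsilon> \<mu> (mxop u) v - em_ip \<Omega> \<epsilon> \<mu> u (mxop v)
    = (\<i> / 2) * (ip_t \<Omega> (bP u) (bP v) - ip_t \<Omega> (bQ u) (bQ v))"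
proof -
  have h: "hcurl \<Omega> (fst u)" "hcurl \<Omega> (snd u)" "hcurl \<Omega> (fst v)" "hcurl \<Omega> (snd v)" using u v by (auto simp: dom_def)
  have L: "L2t \<Omega> (Vsharp \<Omega> V (fst u))" "L2t \<Omega> (Vinv \<Omega> V (snd u))" "L2t \<Omega> (Vsharp \<Omega> V (fst v))" "L2t \<Omega> (Vinv \<Omega> V (snd v))"
    using h Vsharp(1) Vinv(1) by auto
  have "em_ip \<Omega> \<epsilon> \<mu> u (mxop v) = cnj (em_ip \<Omega> \<epsilon> \<mu> (mxop v) u)"
    using X.ip_cnj[of "mxop v" u] L2em_mxop[OF v] L2em_dom[OF u] by simp
  also have "\<dots> = - \<i> * l2ip \<Omega> (fst u) (dcurl \<Omega> (snd v)) + \<i> * l2ip \<Omega> (snd u) (dcurl \<Omega> (fst v))"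
    using em_ip_mxop[OF v L2em_dom[OF u]] HL.ip_cnj[of "dcurl \<Omega> (snd v)" "fst u"] HL.ip_cnj[of "dcurl \<Omega> (fst v)" "snd u"]
      h hcurl_L2 L2_dcurl by simp
  finally have "em_ip \<Omega> \<epsilon> \<mu> (mxop u) v - em_ip \<Omega> \<epsilon> \<mu> u (mxop v)
      = \<i> * bd_pair \<Omega> (snd u) (fst v) - \<i> * bd_pair \<Omega> (fst u) (snd v)"
    using em_ip_mxop[OF u L2em_dom[OF v]] by (simp add: bd_pair_def algebra_simps)
  also have "bd_pair \<Omega> (fst u) (snd v) = - cnj (bd_pair \<Omega> (snd v) (fst u))" using bd_pair_skew h by blast
  also have "cnj (bd_pair \<Omega> (snd v) (fst u)) = ip_t \<Omega> (Vsharp \<Omega> V (fst u)) (Vinv \<Omega> V (snd v))"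
    using bd_pair_eq_ip_t[OF h(4,1)] G.ip_cnj[of "Vinv \<Omega> V (snd v)" "Vsharp \<Omega> V (fst u)"] L by simp
  also have "bd_pair \<Omega> (snd u) (fst v) = ip_t \<Omega> (Vinv \<Omega> V (snd u)) (Vsharp \<Omega> V (fst v))"
    using bd_pair_eq_ip_t[OF h(2,3)] .
  finally show ?thesis
    using L G.add_mem[of "Vsharp \<Omega> V (fst v)" "Vinv \<Omega> V (snd v)"] G.diff_mem[of "Vsharp \<Omega> V (fst v)" "Vinv \<Omega> V (snd v)"]
    by (simp add: bP_def bQ_def G.ip_add_left G.ip_add_right G.ip_diff_left G.ip_diff_right algebra_simps)
qed

text \<open>The values b = (p + q)/2 and a = (p - q)/2 can be met independently: b by the electric
  field, since V^# is onto, and a by the magnetic field V a.\<close>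

lemma maxwell_onto:
  assumes p: "L2t \<Omega> p" and q: "L2t \<Omega> q"
  shows "\<exists>u\<in>dom. G.eqn (bP u) p \<and> G.eqn (bQ u) q"
proof -
  define g f where "g = fscale (1/2) p + fscale (1/2) q" and "f = fscale (1/2) p + fscale (-1/2) q"
  have L: "L2t \<Omega> g" "L2t \<Omega> f" unfolding g_def f_def by (rule L2t_lin[OF p q])+
  have e: "g + f = p" "g - f = q"
    by (auto simp: g_def f_def fun_eq_iff fscale_def vec_eq_iff)
  obtain W where W: "hcurl \<Omega> W" "G.eqn (Vsharp \<Omega> V W) g" using Vsharp_surj[OF L(1)] by blast
  have h: "hcurl \<Omega> (V f)" and vf: "G.eqn (Vinv \<Omega> V (V f)) f" using hcurl_V Vinv_surj L by auto
  have "G.eqn (bP (W, V f)) (g + f)" "G.eqn (bQ (W, V f)) (g - f)"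
    using W h vf L Vsharp(1)[OF W(1)] Vinv(1)[OF h]
    by (auto simp: bP_def bQ_def intro!: G.eqn_add G.eqn_diff)
  then show ?thesis unfolding e using W h by (intro bexI[of _ "(W, V f)"]) (auto simp: dom_def)
qed

lemma Mmin_test_field:
  assumes "test_field \<Omega> \<phi>" "test_field \<Omega> \<psi>"
  shows "((\<phi>, \<psi>), mxop (\<phi>, \<psi>)) \<in> Mmin \<Omega> \<epsilon> \<mu>"
  using hcurl0_test_field assms L2em_mxop[of "(\<phi>, \<psi>)"] mxop_Mx[of "(\<phi>, \<psi>)"] hcurl_test_field
  by (auto simp: Mmin_def dom_def)

lemma maxwell_minimal:
  assumes "(u, z) \<in> Mmin \<Omega> \<epsilon> \<mu>"
  shows "u \<in> dom \<and> L2em \<Omega> z \<and> X.eqn z (mxop u) \<and> G.eqn (bP u) 0 \<and> G.eqn (bQ u) 0"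
proof -
  have h0: "hcurl0 \<Omega> (fst u)" "hcurl0 \<Omega> (snd u)" and z: "L2em \<Omega> z" "eqv \<Omega> z (Mx \<Omega> \<epsilon> \<mu> u)"
    using assms by (auto simp: Mmin_def)
  have h: "hcurl \<Omega> (fst u)" "hcurl \<Omega> (snd u)" using h0 hcurl0_hcurl by auto
  then have d: "u \<in> dom" by (simp add: dom_def)
  have L: "L2t \<Omega> (Vsharp \<Omega> V (fst u))" "L2t \<Omega> (Vinv \<Omega> V (snd u))" using h Vsharp(1) Vinv(1) by auto
  have z0: "L2t \<Omega> 0" using G.zero_mem by simp
  have 1: "G.eqn (Vinv \<Omega> V (snd u)) 0" using Vinv_eq_zero[OF h(2)] bd_pair_hcurl0[OF h0(2)] by simp
  have "bd_pair \<Omega> (V f) (fst u) = 0" if "L2t \<Omega> f" for f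
    using bd_pair_skew[OF h(1) hcurl_V[OF that]] bd_pair_hcurl0[OF h0(1) hcurl_V[OF that]] by simp
  then have 2: "G.eqn (Vsharp \<Omega> V (fst u)) 0" using Vsharp_unique[OF h(1) z0] by simp
  have "G.eqn (bP u) (0 + 0)" "G.eqn (bQ u) (0 - 0)"
    unfolding bP_def bQ_def using 1 2 L z0 by (intro G.eqn_add G.eqn_diff; simp)+
  then show ?thesis using d z eqv_Mx_iff[OF d z(1)] by simp
qed

text \<open>Testing with (\<phi>, 0) and (0, \<phi>) decouples the components: the first yields the
  curl of the magnetic part of \<open>v\<close>, the second that of the electric part. Uniqueness of
  division by the coefficients then identifies \<open>w\<close>.\<close>

lemma maxwell_maximal:
  assumes v: "L2em \<Omega> v" and w: "L2em \<Omega> w"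
    and adj: "\<And>u z. (u, z) \<in> Mmin \<Omega> \<epsilon> \<mu> \<Longrightarrow> em_ip \<Omega> \<epsilon> \<mu> z v = em_ip \<Omega> \<epsilon> \<mu> u w"
  shows "v \<in> dom \<and> X.eqn w (mxop v)"
proof -
  have L: "L2 \<Omega> (fst v)" "L2 \<Omega> (snd v)" "L2 \<Omega> (fst w)" "L2 \<Omega> (snd w)" using v w by (auto simp: L2em_def)
  have z: "test_field \<Omega> 0" "L2 \<Omega> 0" using test_field_zero HL.zero_mem by (simp_all add: zero_fun_def)
  have wz: "E.wt 0 = 0" "M.wt 0 = 0" using E.wt_lin[of 0 0 0 0] M.wt_lin[of 0 0 0 0] by simp_all
  have dz: "l2ip \<Omega> (dcurl \<Omega> 0) f = 0" if "L2 \<Omega> f" for f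
    using HL.eqn_ip_left[OF hcurl_zero(2), of f] L2_dcurl[OF hcurl_zero(1)] z(2) that by simp
  have dt: "l2ip \<Omega> (dcurl \<Omega> \<phi>) f = l2ip \<Omega> (curl \<phi>) f" if "test_field \<Omega> \<phi>" "L2 \<Omega> f" for \<phi> f
    using hcurl_test_field[OF that(1)] L2_dcurl L2_test_field(2)[OF open_dom that(1)] that(2) by (intro HL.eqn_ip_left) auto
  have 1: "is_dcurl \<Omega> (snd v) (fscale (- \<i>) (E.wt (fst w)))" unfolding is_dcurl_def
  proof (intro conjI allI impI)
    show "L2 \<Omega> (fscale (- \<i>) (E.wt (fst w)))" by (intro L2_scale E.L2_wt L)
    fix \<phi> assume t: "test_field \<Omega> \<phi>"
    note T = L2_test_field[OF open_dom t] and h = hcurl_test_field(1)[OF t]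
    have d: "(\<phi>, 0) \<in> dom" using h hcurl_zero by (simp add: dom_def)
    have "em_ip \<Omega> \<epsilon> \<mu> (mxop (\<phi>, 0)) v = em_ip \<Omega> \<epsilon> \<mu> (\<phi>, 0) w" using adj[OF Mmin_test_field[OF t z(1)]] .
    then have "- \<i> * l2ip \<Omega> (curl \<phi>) (snd v) = l2ip \<Omega> \<phi> (E.wt (fst w))"
      using em_ip_mxop[OF d v] dz dt[OF t] L E.wt_symmetric[OF T(1)] by (simp add: em_ip_eq E.ipw_def M.ipw_def wz)
    then have "l2ip \<Omega> (curl \<phi>) (snd v) = \<i> * l2ip \<Omega> \<phi> (E.wt (fst w))" by (auto simp: algebra_simps complex_eq_iff)
    then show "l2ip \<Omega> (snd v) (curl \<phi>) = l2ip \<Omega> (fscale (- \<i>) (E.wt (fst w))) \<phi>"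
      using HL.ip_cnj[of "curl \<phi>" "snd v"] HL.ip_cnj[of \<phi> "E.wt (fst w)"] T L E.L2_wt[OF L(3)]
      by (simp add: HL.ip_scale_left HL.ip_minus_left L2_scale)
  qed
  have 2: "is_dcurl \<Omega> (fst v) (fscale \<i> (M.wt (snd w)))" unfolding is_dcurl_def
  proof (intro conjI allI impI)
    show "L2 \<Omega> (fscale \<i> (M.wt (snd w)))" by (intro L2_scale M.L2_wt L)
    fix \<phi> assume t: "test_field \<Omega> \<phi>"
    note T = L2_test_field[OF open_dom t] and h = hcurl_test_field(1)[OF t]
    have d: "(0, \<phi>) \<in> dom" using h hcurl_zero by (simp add: dom_def)
    have "em_ip \<Omega> \<epsilon> \<mu> (mxop (0, \<phi>)) v = em_ip \<Omega> \<epsilon> \<mu> (0, \<phi>) w" using adj[OF Mmin_test_field[OF z(1) t]] .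
    then have "\<i> * l2ip \<Omega> (curl \<phi>) (fst v) = l2ip \<Omega> \<phi> (M.wt (snd w))"
      using em_ip_mxop[OF d v] dz dt[OF t] L M.wt_symmetric[OF T(1)] by (simp add: em_ip_eq E.ipw_def M.ipw_def wz)
    then have "l2ip \<Omega> (curl \<phi>) (fst v) = - \<i> * l2ip \<Omega> \<phi> (M.wt (snd w))" by (auto simp: algebra_simps complex_eq_iff)
    then show "l2ip \<Omega> (fst v) (curl \<phi>) = l2ip \<Omega> (fscale \<i> (M.wt (snd w))) \<phi>"
      using HL.ip_cnj[of "curl \<phi>" "fst v"] HL.ip_cnj[of \<phi> "M.wt (snd w)"] T L M.L2_wt[OF L(4)] by (simp add: HL.ip_scale_left)
  qed
  note d1 = dcurl_eqI[OF L(2) 1] and d2 = dcurl_eqI[OF L(1) 2]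
  have d: "v \<in> dom" using d1 d2 by (simp add: dom_def)
  have s1: "HL.eqn (E.solve (dcurl \<Omega> (snd v))) (fscale (- \<i>) (fst w))"
  proof (rule E.solve_unique)
    show "L2 \<Omega> (fscale (- \<i>) (fst w))" "L2 \<Omega> (dcurl \<Omega> (snd v))" by (intro L2_scale L2_dcurl d1 L)+
    have "E.wt (fscale (- \<i>) (fst w)) = fscale (- \<i>) (E.wt (fst w))" using E.wt_lin[of "- \<i>" "fst w" 0 0] by simp
    then show "HL.eqn (E.wt (fscale (- \<i>) (fst w))) (dcurl \<Omega> (snd v))"
      using HL.eqn_sym[OF d1(2)] is_dcurlD(1)[OF 1] L2_dcurl[OF d1(1)] by simp
  qed
  have s2: "HL.eqn (M.solve (dcurl \<Omega> (fst v))) (fscale \<i> (snd w))"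
  proof (rule M.solve_unique)
    show "L2 \<Omega> (fscale \<i> (snd w))" "L2 \<Omega> (dcurl \<Omega> (fst v))" by (intro L2_scale L2_dcurl d2 L)+
    have "M.wt (fscale \<i> (snd w)) = fscale \<i> (M.wt (snd w))" using M.wt_lin[of "\<i>" "snd w" 0 0] by simp
    then show "HL.eqn (M.wt (fscale \<i> (snd w))) (dcurl \<Omega> (fst v))"
      using HL.eqn_sym[OF d2(2)] is_dcurlD(1)[OF 2] L2_dcurl[OF d2(1)] by simp
  qed
  have S: "L2 \<Omega> (E.solve (dcurl \<Omega> (snd v)))" "L2 \<Omega> (M.solve (dcurl \<Omega> (fst v)))"
    using E.solve(1) M.solve(1) L2_dcurl d1 d2 by auto
  have "HL.eqn (fst w) (fst (mxop v))"
  proof (rule HL.eqn_sym)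
    have "HL.eqn (fscale \<i> (E.solve (dcurl \<Omega> (snd v)))) (fscale \<i> (fscale (- \<i>) (fst w)))"
      by (rule HL.eqn_scale[OF s1]) (use S L L2_scale in blast)+
    then show "HL.eqn (fst (mxop v)) (fst w)" by (simp add: mxop_def)
  qed (use L L2em_mxop[OF d] in \<open>auto simp: L2em_def\<close>)
  moreover have "HL.eqn (snd w) (snd (mxop v))"
  proof (rule HL.eqn_sym)
    have "HL.eqn (fscale (- \<i>) (M.solve (dcurl \<Omega> (fst v)))) (fscale (- \<i>) (fscale \<i> (snd w)))"
      by (rule HL.eqn_scale[OF s2]) (use S L L2_scale in blast)+
    then show "HL.eqn (snd (mxop v)) (snd w)" by (simp add: mxop_def)
  qed (use L L2em_mxop[OF d] in \<open>auto simp: L2em_def\<close>)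
  ultimately show ?thesis using d X_eqn_iff_HL[OF w L2em_mxop[OF d]] by simp
qed

end

sublocale maxwell \<subseteq> B: boundary_triple pscale "{u. L2em \<Omega> u}" "em_ip \<Omega> \<epsilon> \<mu>" fscale "{f. L2t \<Omega> f}" "ip_t \<Omega>"
  dom mxop bP bQ "Mmin \<Omega> \<epsilon> \<mu>"
proof (unfold_locales, goal_cases)
  case (1 u) then show ?case using L2em_dom by simp
next
  case (2 u) then show ?case using L2em_mxop by simp
next
  case (3 u) then show ?case
    using G.add_mem[of "Vsharp \<Omega> V (fst u)" "Vinv \<Omega> V (snd u)"] Vsharp(1) Vinv(1) by (simp add: dom_def bP_def)
next
  case (4 u) then show ?case
    using G.diff_mem[of "Vsharp \<Omega> V (fst u)" "Vinv \<Omega> V (snd u)"] Vsharp(1) Vinv(1) by (simp add: dom_def bQ_def)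
next
  case (5 u v) then show ?case by (rule maxwell_green)
next
  case (6 p q) then show ?case using maxwell_onto by simp
next
  case (7 v w) then show ?case using maxwell_maximal by simp
next
  case (8 u z) then show ?case using maxwell_minimal by simp
qed

section \<open>Return to the notions of the theorem\<close>

context maxwell
begin

text \<open>(a + K a) + (b - K b) = 0 is b + a = K b - K a, and linearity of \<open>K\<close> turns
  the right side into K (b - a).\<close>

lemma Mbc_eq_BC:
  assumes K: "contraction_t \<Omega> K"
  shows "Mbc \<Omega> \<epsilon> \<mu> V K = B.BC K"
proof -
  note KD = G.contrD[OF K[unfolded contraction_t_iff], simplified mem_Collect_eq]
  have "bc \<Omega> V K u \<longleftrightarrow> G.eqn (bP u) (K (bQ u))" if u: "u \<in> dom" for u
  proof -
    define a b where "a = Vinv \<Omega> V (snd u)" and "b = Vsharp \<Omega> V (fst u)"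
    have L: "L2t \<Omega> a" "L2t \<Omega> b" "L2t \<Omega> (K a)" "L2t \<Omega> (K b)"
      using u Vinv(1) Vsharp(1) KD(1) by (auto simp: dom_def a_def b_def)
    have mem: "L2t \<Omega> 0" "L2t \<Omega> (b - a)" "L2t \<Omega> (b + a)" "L2t \<Omega> (K b - K a)" "L2t \<Omega> ((a + K a) + (b - K b))"
      using L G.zero_mem G.diff_mem[of b a] G.add_mem[of b a] G.diff_mem[of "K b" "K a"]
        G.add_mem[of a "K a"] G.diff_mem[of b "K b"] G.add_mem[of "a + K a" "b - K b"] by simp_all
    have lin: "G.eqn (K (b - a)) (K b - K a)" using KD(3)[OF L(2,1), of 1 "-1"] by simp
    have e: "(\<lambda>x. (a x + K a x) + (b x - K b x)) = (a + K a) + (b - K b)" "(\<lambda>x. 0 :: cv) = 0" by auto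
    have "bc \<Omega> V K u \<longleftrightarrow> aeq_t \<Omega> (\<lambda>x. (a x + K a x) + (b x - K b x)) (\<lambda>x. 0)"
      by (simp only: bc_def Let_def a_def b_def)
    also have "\<dots> \<longleftrightarrow> G.eqn ((a + K a) + (b - K b)) 0"
      unfolding e by (rule G_eqn_iff[OF mem(5,1), symmetric])
    also have "\<dots> \<longleftrightarrow> G.eqn (b + a) (K b - K a)"
      by (simp add: G.eqn_def algebra_simps)
    also have "\<dots> \<longleftrightarrow> G.eqn (b + a) (K (b - a))"
      using lin G.eqn_sym[OF lin] G.eqn_trans[of "b + a"] mem KD(1)[OF mem(2)] by (metis mem_Collect_eq)
    finally show ?thesis by (simp only: bP_def bQ_def a_def b_def)
  qed
  then show ?thesis
    unfolding Mbc_def B.BC_def using eqv_Mx_iff by (auto simp: dom_def)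
qed

text \<open>The agreement of \<open>eqv\<close> with \<open>X.eqn\<close> is available for
  square-integrable fields, so the membership clause is settled first; where it fails, both sides
  are false.\<close>

lemma is_op_iff: "is_op \<Omega> T \<longleftrightarrow> X.isop T"
proof (cases "\<forall>(u, w)\<in>T. L2em \<Omega> u \<and> L2em \<Omega> w")
  case True
  then have m: "(u, w) \<in> T \<Longrightarrow> L2em \<Omega> u \<and> L2em \<Omega> w" for u w by blast
  have 2: "(u, w) \<in> T \<and> L2em \<Omega> u' \<and> L2em \<Omega> w' \<and> eqv \<Omega> u u' \<and> eqv \<Omega> w w'
      \<longleftrightarrow> (u, w) \<in> T \<and> u' \<in> {u. L2em \<Omega> u} \<and> w' \<in> {u. L2em \<Omega> u} \<and> X.eqn u u' \<and> X.eqn w w'" for u w u' w'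
    using m[of u w] X_eqn_iff[of u u'] X_eqn_iff[of w w'] by auto
  have 3: "((u, w) \<in> T \<and> (u, w') \<in> T \<longrightarrow> eqv \<Omega> w w') \<longleftrightarrow> ((u, w) \<in> T \<and> (u, w') \<in> T \<longrightarrow> X.eqn w w')" for u w w'
    using m[of u w] m[of u w'] X_eqn_iff[of w w'] by auto
  show ?thesis unfolding is_op_def X.isop_def lc_eq 2 3 by simp
next
  case False
  then show ?thesis unfolding is_op_def X.isop_def mem_Collect_eq by argo
qed

lemma m_dissipative_iff: "m_dissipative \<Omega> \<epsilon> \<mu> T \<longleftrightarrow> X.mdiss T"
  unfolding m_dissipative_def X.mdiss_def lc_eq X_nrm by simp

lemma selfadjoint_iff: "selfadjoint \<Omega> \<epsilon> \<mu> T \<longleftrightarrow> X.selfadj T"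
proof -
  have "lc 1 u (-1) f = u - f" for u f by (simp add: lc_eq)
  moreover have "adj \<Omega> \<epsilon> \<mu> T = X.adjoint T" by (auto simp: adj_def X.adjoint_def)
  ultimately show ?thesis unfolding selfadjoint_def X.selfadj_def X_nrm by simp
qed

end

theorem theorem2p3:
  fixes \<Omega> :: "pt set" and \<epsilon> \<mu> :: "pt \<Rightarrow> real^3^3" and c :: real
    and V :: "fld \<Rightarrow> fld" and T :: mop
  assumes "lipschitz_domain \<Omega>"
    and "admissible_coeff \<Omega> \<epsilon>" and "admissible_coeff \<Omega> \<mu>"
    and "c > 0" and "unif_pos \<Omega> \<epsilon> c" and "unif_pos \<Omega> \<mu> c"
    and "lin_homeo_V \<Omega> V"
    and "is_op \<Omega> T" and "Mmin \<Omega> \<epsilon> \<mu> \<subseteq> T"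
  shows "(m_dissipative \<Omega> \<epsilon> \<mu> T \<longleftrightarrow> (\<exists>K. contraction_t \<Omega> K \<and> T = Mbc \<Omega> \<epsilon> \<mu> V K))
    \<and> (\<forall>K. contraction_t \<Omega> K \<longrightarrow>
          is_op \<Omega> (Mbc \<Omega> \<epsilon> \<mu> V K) \<and> Mmin \<Omega> \<epsilon> \<mu> \<subseteq> Mbc \<Omega> \<epsilon> \<mu> V K
          \<and> m_dissipative \<Omega> \<epsilon> \<mu> (Mbc \<Omega> \<epsilon> \<mu> V K))
    \<and> (\<forall>K K'. contraction_t \<Omega> K \<and> contraction_t \<Omega> K' \<and> Mbc \<Omega> \<epsilon> \<mu> V K = Mbc \<Omega> \<epsilon> \<mu> V K'
          \<longrightarrow> (\<forall>f. L2t \<Omega> f \<longrightarrow> aeq_t \<Omega> (K f) (K' f)))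
    \<and> (\<forall>K. contraction_t \<Omega> K \<and> T = Mbc \<Omega> \<epsilon> \<mu> V K \<longrightarrow>
          (selfadjoint \<Omega> \<epsilon> \<mu> T \<longleftrightarrow> unitary_t \<Omega> K))"
proof -
  have "open \<Omega>" "bounded \<Omega>" using assms(1) by (auto simp: lipschitz_domain_def)
  then interpret maxwell \<Omega> \<epsilon> \<mu> c V
    using assms by unfold_locales auto
  have T: "X.isop T" using assms(8) is_op_iff by blast
  \<comment> \<open>This also covers the implication from the boundary condition to m-dissipativity,
    because \<open>T\<close> then equals this operator.\<close>
  have "is_op \<Omega> (Mbc \<Omega> \<epsilon> \<mu> V K) \<and> Mmin \<Omega> \<epsilon> \<mu> \<subseteq> Mbc \<Omega> \<epsilon> \<mu> V K \<and> m_dissipative \<Omega> \<epsilon> \<mu> (Mbc \<Omega> \<epsilon> \<mu> V K)"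
    if K: "contraction_t \<Omega> K" for K
    using B.isop_BC B.minimal_BC B.mdiss_BC K is_op_iff m_dissipative_iff unfolding Mbc_eq_BC[OF K] contraction_t_iff by simp
  moreover have "\<exists>K. contraction_t \<Omega> K \<and> T = Mbc \<Omega> \<epsilon> \<mu> V K" if md: "m_dissipative \<Omega> \<epsilon> \<mu> T"
  proof -
    obtain K where "G.contr K" "T = B.BC K"
      using B.mdiss_extension[OF T md[unfolded m_dissipative_iff] assms(9)] by blast
    then show ?thesis using Mbc_eq_BC contraction_t_iff by blast
  qed
  moreover have "aeq_t \<Omega> (K f) (K' f)"
    if K: "contraction_t \<Omega> K" "contraction_t \<Omega> K'" "Mbc \<Omega> \<epsilon> \<mu> V K = Mbc \<Omega> \<epsilon> \<mu> V K'" and f: "L2t \<Omega> f" for K K' f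
  proof -
    have "G.eqn (K f) (K' f)"
      using B.BC_inj[of K K' f] K f Mbc_eq_BC[OF K(1)] Mbc_eq_BC[OF K(2)] contraction_t_iff by simp
    then show ?thesis using K(1,2) f by (simp add: G_eqn_iff contraction_t_def)
  qed
  moreover have "selfadjoint \<Omega> \<epsilon> \<mu> T \<longleftrightarrow> unitary_t \<Omega> K" if "contraction_t \<Omega> K" "T = Mbc \<Omega> \<epsilon> \<mu> V K" for K
    using B.selfadj_BC_iff[of K] that Mbc_eq_BC[OF that(1)] contraction_t_iff selfadjoint_iff unitary_t_iff by simp
  ultimately show ?thesis by blast
qed

end
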